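(* Let $E=E(0,1)$ be a symmetric function space such that $E(0,1)\supset L_p(0,1)$ for some $1\le p<2$. Let $F$ be a separable symmetric sequence space such that for every $\epsilon>0$ there exists $r\in(2-\epsilon,2)$ with $\ell_r\not\hookrightarrow F$. Then $E(0,1)\not\hookrightarrow C_F$.
   Context: For a measurable $f$ on $(0,1)$ (Lebesgue measure $m$), $f^*(t)=\inf\{s\ge 0: m\{|f|>s\}\le t\}$. A symmetric function space $E=E(0,1)$ is a Banach space of (classes of) real-valued Lebesgue measurable functions on $(0,1)$ such that: $f\in E$, $g$ measurable, $|g|\le|f|$ a.e. imply $g\in E$, $\|g\|_E\le\|f\|_E$; and $f\in E$, $g$ measurable, $g^*=f^*$ imply $g\in E$, $\|g\|_E=\|f\|_E$. It is normalized by $\|\chi_{[0,1]}\|_E=1$. A symmetric sequence space $F$ is defined in the same way as a Banach space of bounded real sequences $(a_n)_{n\ge0}$ (with counting measure, $a^*$ denoting the decreasing rearrangement of $(|a_n|)$), normalized by $\|e_0\|_F=1$, $e_k$ being the unit vectors. For a bounded operator $x$ on a separable infinite-dimensional Hilbert space $\mathcal H$ (say $\ell_2$), $\mu(x)=(\mu(n;x))_{n\ge 0}$ is its sequence of singular values in non-increasing order with multiplicity. $C_F=\{x\in B(\mathcal H):\mu(x)\in F\}$ with norm $\|x\|_{C_F}=\|\mu(x)\|_F$. $A\hookrightarrow B$ (resp. $A\not\hookrightarrow B$) means that the Banach space $A$ is (resp. is not) isomorphic (linearly homeomorphic) to a subspace of the Banach space $B$. *)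

theory Defs
  imports "HOL-Analysis.Analysis" "HOL-Library.Function_Algebras"
begin

instantiation "fun" :: (type, real_vector) real_vector
begin

definition scaleR_fun :: "real \<Rightarrow> ('a \<Rightarrow> 'b) \<Rightarrow> 'a \<Rightarrow> 'b"
  where "scaleR_fun c f = (\<lambda>x. c *\<^sub>R f x)"

instance
  by standard (auto simp: scaleR_fun_def fun_eq_iff scaleR_add_right scaleR_add_left)

end


section \<open>Spaces of measurable functions\<close>

text \<open>
  A Banach space of classes of functions modulo equality almost everywhere is given by the set
  \<open>E\<close> of all representatives together with the norm \<open>N\<close> as a function of representatives.
\<close>

definition banach_function_space :: "'a measure \<Rightarrow> ('a \<Rightarrow> real) set \<Rightarrow> (('a \<Rightarrow> real) \<Rightarrow> real) \<Rightarrow> bool"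
  where "banach_function_space M E N \<longleftrightarrow>
    E \<subseteq> borel_measurable M \<and> subspace E \<and>
    (\<forall>f\<in>E. 0 \<le> N f) \<and>
    (\<forall>f\<in>E. N f = 0 \<longleftrightarrow> (AE x in M. f x = 0)) \<and>
    (\<forall>f\<in>E. \<forall>c. N (c *\<^sub>R f) = \<bar>c\<bar> * N f) \<and>
    (\<forall>f\<in>E. \<forall>g\<in>E. N (f + g) \<le> N f + N g) \<and>
    (\<forall>X. (\<forall>n. X n \<in> E) \<and> (\<forall>e>0. \<exists>K. \<forall>m\<ge>K. \<forall>n\<ge>K. N (X m - X n) < e)
          \<longrightarrow> (\<exists>f\<in>E. (\<lambda>n. N (X n - f)) \<longlonglongrightarrow> 0))"

text \<open>
  Taking the infimum in \<^typ>\<open>ennreal\<close> makes \<open>f\<^sup>*(t)\<close> infinite, rather than unspecified, where no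
  finite \<open>s\<close> qualifies. For the counting measure on \<^typ>\<open>nat\<close> and \<open>t = n\<close> it is the
  \<open>n\<close>-th term of the decreasing rearrangement of a sequence.
\<close>

definition rearrangement :: "'a measure \<Rightarrow> ('a \<Rightarrow> real) \<Rightarrow> ennreal \<Rightarrow> ennreal"
  where "rearrangement M f t = Inf {s. emeasure M {x \<in> space M. s < ennreal \<bar>f x\<bar>} \<le> t}"

definition symmetric_space :: "'a measure \<Rightarrow> ('a \<Rightarrow> real) set \<Rightarrow> (('a \<Rightarrow> real) \<Rightarrow> real) \<Rightarrow> bool"
  where "symmetric_space M E N \<longleftrightarrow>
    banach_function_space M E N \<and>
    (\<forall>f\<in>E. \<forall>g\<in>borel_measurable M. (AE x in M. \<bar>g x\<bar> \<le> \<bar>f x\<bar>) \<longrightarrow> g \<in> E \<and> N g \<le> N f) \<and>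
    (\<forall>f\<in>E. \<forall>g\<in>borel_measurable M. rearrangement M g = rearrangement M f \<longrightarrow> g \<in> E \<and> N g = N f)"

definition symmetric_function_space :: "(real \<Rightarrow> real) set \<Rightarrow> ((real \<Rightarrow> real) \<Rightarrow> real) \<Rightarrow> bool"
  where "symmetric_function_space E N \<longleftrightarrow>
    symmetric_space (lebesgue_on {0<..<1}) E N \<and> indicator {0..1} \<in> E \<and> N (indicator {0..1}) = 1"

definition unit_seq :: "nat \<Rightarrow> nat \<Rightarrow> real"
  where "unit_seq k = indicator {k}"

definition symmetric_sequence_space :: "(nat \<Rightarrow> real) set \<Rightarrow> ((nat \<Rightarrow> real) \<Rightarrow> real) \<Rightarrow> bool"
  where "symmetric_sequence_space F N \<longleftrightarrow>
    symmetric_space (count_space UNIV) F N \<and> (\<forall>a\<in>F. bounded (range a)) \<and>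
    unit_seq 0 \<in> F \<and> N (unit_seq 0) = 1"

definition Lp_space :: "'a measure \<Rightarrow> real \<Rightarrow> ('a \<Rightarrow> real) set"
  where "Lp_space M p = {f \<in> borel_measurable M. integrable M (\<lambda>x. \<bar>f x\<bar> powr p)}"

definition Lp_norm :: "'a measure \<Rightarrow> real \<Rightarrow> ('a \<Rightarrow> real) \<Rightarrow> real"
  where "Lp_norm M p f = (LINT x|M. \<bar>f x\<bar> powr p) powr (1 / p)"

abbreviation lp_space :: "real \<Rightarrow> (nat \<Rightarrow> real) set"
  where "lp_space \<equiv> Lp_space (count_space UNIV)"

abbreviation lp_norm :: "real \<Rightarrow> (nat \<Rightarrow> real) \<Rightarrow> real"
  where "lp_norm \<equiv> Lp_norm (count_space UNIV)"


section \<open>Separability and isomorphic embeddings\<close>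

definition separable_normed :: "'a::real_vector set \<Rightarrow> ('a \<Rightarrow> real) \<Rightarrow> bool"
  where "separable_normed A N \<longleftrightarrow>
    (\<exists>D. countable D \<and> D \<subseteq> A \<and> (\<forall>f\<in>A. \<forall>e>0. \<exists>d\<in>D. N (f - d) < e))"

text \<open>
  A linear map between normed spaces is a homeomorphism onto its range iff it is bounded and
  bounded below. If \<open>A\<close> consists of representatives, the upper bound makes \<open>T\<close> well defined on
  classes. A complex space \<open>B\<close> is regarded as a real one, since function spaces here are real.
\<close>

definition isomorphically_embeds ::
  "'a::real_vector set \<Rightarrow> ('a \<Rightarrow> real) \<Rightarrow> 'b::real_vector set \<Rightarrow> ('b \<Rightarrow> real) \<Rightarrow> bool"
  where "isomorphically_embeds A N\<^sub>A B N\<^sub>B \<longleftrightarrow>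
    (\<exists>T. (\<forall>f\<in>A. T f \<in> B) \<and>
         (\<forall>f\<in>A. \<forall>g\<in>A. T (f + g) = T f + T g) \<and>
         (\<forall>f\<in>A. \<forall>c. T (c *\<^sub>R f) = c *\<^sub>R T f) \<and>
         (\<exists>C. \<forall>f\<in>A. N\<^sub>B (T f) \<le> C * N\<^sub>A f) \<and>
         (\<exists>c>0. \<forall>f\<in>A. c * N\<^sub>A f \<le> N\<^sub>B (T f)))"


section \<open>The complex Hilbert space of square-summable sequences\<close>

typedef ell2 = "{a :: nat \<Rightarrow> complex. summable (\<lambda>n. (cmod (a n))\<^sup>2)}"
  morphisms coord Abs_ell2
  by (rule exI[of _ "\<lambda>_. 0"]) simp

setup_lifting type_definition_ell2

lemma summable_coord: "summable (\<lambda>n. (cmod (coord u n))\<^sup>2)"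
  using coord[of u] by simp

lemma ell2_eqI: "(\<And>n. coord u n = coord v n) \<Longrightarrow> u = v"
  by (metis coord_inject ext)

lemma square_summable_add:
  fixes a b :: "nat \<Rightarrow> complex"
  assumes "summable (\<lambda>n. (cmod (a n))\<^sup>2)" "summable (\<lambda>n. (cmod (b n))\<^sup>2)"
  shows "summable (\<lambda>n. (cmod (a n + b n))\<^sup>2)"
proof (rule summable_comparison_test')
  show "summable (\<lambda>n. 2 * (cmod (a n))\<^sup>2 + 2 * (cmod (b n))\<^sup>2)"
    by (intro summable_add summable_mult assms)
  fix n :: nat
  have "(cmod (a n + b n))\<^sup>2 \<le> (cmod (a n) + cmod (b n))\<^sup>2"
    by (intro power_mono norm_triangle_ineq) auto
  also have "\<dots> \<le> 2 * (cmod (a n))\<^sup>2 + 2 * (cmod (b n))\<^sup>2"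
    using sum_squares_bound[of "cmod (a n)" "cmod (b n)"] by (simp add: power2_sum)
  finally show "norm ((cmod (a n + b n))\<^sup>2) \<le> 2 * (cmod (a n))\<^sup>2 + 2 * (cmod (b n))\<^sup>2"
    by simp
qed

lemma square_summable_mult:
  fixes a :: "nat \<Rightarrow> complex"
  assumes "summable (\<lambda>n. (cmod (a n))\<^sup>2)"
  shows "summable (\<lambda>n. (cmod (c * a n))\<^sup>2)"
  using summable_mult[OF assms, of "(cmod c)\<^sup>2"] by (simp add: norm_mult power_mult_distrib)

lift_definition scaleC :: "complex \<Rightarrow> ell2 \<Rightarrow> ell2" (infixr "*\<^sub>C" 75)
  is "\<lambda>c a n. c * a n"
  using square_summable_mult by simp

instantiation ell2 :: real_vector
begin

lift_definition zero_ell2 :: ell2 is "\<lambda>_. 0" by simp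
lift_definition plus_ell2 :: "ell2 \<Rightarrow> ell2 \<Rightarrow> ell2" is "\<lambda>a b n. a n + b n"
  using square_summable_add by simp
lift_definition uminus_ell2 :: "ell2 \<Rightarrow> ell2" is "\<lambda>a n. - a n" by simp
lift_definition minus_ell2 :: "ell2 \<Rightarrow> ell2 \<Rightarrow> ell2" is "\<lambda>a b n. a n - b n"
  subgoal for a b using square_summable_add[of a "\<lambda>n. - b n"] by simp
  done
definition scaleR_ell2 :: "real \<Rightarrow> ell2 \<Rightarrow> ell2"
  where "scaleR_ell2 c u = complex_of_real c *\<^sub>C u"

instance
  by standard (unfold scaleR_ell2_def, (transfer; simp add: fun_eq_iff algebra_simps)+)

end

lemma coord_simps [simp]:
  "coord 0 n = 0" "coord (u + v) n = coord u n + coord v n"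
  "coord (u - v) n = coord u n - coord v n" "coord (- u) n = - coord u n"
  "coord (c *\<^sub>C u) n = c * coord u n" "coord (r *\<^sub>R u) n = r *\<^sub>R coord u n"
  by (transfer; simp; fail)+ (unfold scaleR_ell2_def, transfer, simp add: scaleR_conv_of_real)

lemma summable_coord_inner: "summable (\<lambda>n. coord u n \<bullet> coord v n)"
proof (rule summable_comparison_test')
  show "summable (\<lambda>n. (cmod (coord u n))\<^sup>2 + (cmod (coord v n))\<^sup>2)"
    by (intro summable_add summable_coord)
  fix n :: nat
  have "\<bar>coord u n \<bullet> coord v n\<bar> \<le> cmod (coord u n) * cmod (coord v n)"
    by (rule Cauchy_Schwarz_ineq2)
  also have "\<dots> \<le> 2 * cmod (coord u n) * cmod (coord v n)"
    by (simp add: mult_nonneg_nonneg)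
  also have "\<dots> \<le> (cmod (coord u n))\<^sup>2 + (cmod (coord v n))\<^sup>2"
    by (rule sum_squares_bound)
  finally show "norm (coord u n \<bullet> coord v n) \<le> (cmod (coord u n))\<^sup>2 + (cmod (coord v n))\<^sup>2"
    by simp
qed

text \<open>
  The class \<^class>\<open>real_inner\<close> is instantiated with the real part of the complex inner product,
  which induces the same norm.
\<close>

instantiation ell2 :: real_inner
begin

definition inner_ell2 :: "ell2 \<Rightarrow> ell2 \<Rightarrow> real"
  where "inner_ell2 u v = (\<Sum>n. coord u n \<bullet> coord v n)"
definition norm_ell2 :: "ell2 \<Rightarrow> real"
  where "norm_ell2 u = sqrt (u \<bullet> u)"
definition dist_ell2 :: "ell2 \<Rightarrow> ell2 \<Rightarrow> real"
  where "dist_ell2 u v = norm (u - v)"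
definition sgn_ell2 :: "ell2 \<Rightarrow> ell2"
  where "sgn_ell2 u = u /\<^sub>R norm u"
definition uniformity_ell2 :: "(ell2 \<times> ell2) filter"
  where "uniformity_ell2 = (INF e\<in>{0<..}. principal {(u, v). dist u v < e})"
definition open_ell2 :: "ell2 set \<Rightarrow> bool"
  where "open_ell2 U \<longleftrightarrow> (\<forall>u\<in>U. eventually (\<lambda>(u', v). u' = u \<longrightarrow> v \<in> U) uniformity)"

instance
proof
  fix u v w :: ell2 and r :: real
  show "u \<bullet> v = v \<bullet> u"
    by (simp add: inner_ell2_def inner_commute)
  show "(u + v) \<bullet> w = u \<bullet> w + v \<bullet> w"
    by (simp add: inner_ell2_def inner_add_left suminf_add summable_coord_inner)
  show "(r *\<^sub>R u) \<bullet> v = r * (u \<bullet> v)"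
    by (simp add: inner_ell2_def suminf_mult summable_coord_inner del: scaleR_conv_of_real)
  show "0 \<le> u \<bullet> u"
    by (simp add: inner_ell2_def suminf_nonneg summable_coord_inner)
  show "(u \<bullet> u = 0) = (u = 0)"
    using suminf_eq_zero_iff[OF summable_coord_inner[of u u]]
    by (auto simp: inner_ell2_def intro: ell2_eqI)
qed (simp_all add: norm_ell2_def dist_ell2_def sgn_ell2_def uniformity_ell2_def open_ell2_def)

end

lemma norm_ell2_square: "(norm (u :: ell2))\<^sup>2 = (\<Sum>n. (cmod (coord u n))\<^sup>2)"
  unfolding power2_norm_eq_inner inner_ell2_def ..

lemma sum_coord_le_norm: "(\<Sum>n<k. (cmod (coord u n))\<^sup>2) \<le> (norm u)\<^sup>2"
  unfolding norm_ell2_square by (rule sum_le_suminf) (auto simp: summable_coord)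

lemma coord_le_norm: "cmod (coord u n) \<le> norm u"
proof -
  have "(cmod (coord u n))\<^sup>2 \<le> (\<Sum>n<Suc n. (cmod (coord u n))\<^sup>2)"
    by (simp add: sum_nonneg)
  also have "\<dots> \<le> (norm u)\<^sup>2"
    by (rule sum_coord_le_norm)
  finally show ?thesis
    by (rule power2_le_imp_le) simp
qed

instance ell2 :: banach
proof
  fix X :: "nat \<Rightarrow> ell2"
  assume X: "Cauchy X"
  have "Cauchy (\<lambda>m. coord (X m) n)" for n
  proof (rule metric_CauchyI)
    fix e :: real assume "0 < e"
    then obtain K where "\<forall>m\<ge>K. \<forall>k\<ge>K. dist (X m) (X k) < e"
      using metric_CauchyD[OF X] by blast
    moreover have "dist (coord u n) (coord v n) \<le> dist u v" for u v
      using coord_le_norm[of "u - v" n] by (simp add: dist_norm)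
    ultimately show "\<exists>K. \<forall>m\<ge>K. \<forall>k\<ge>K. dist (coord (X m) n) (coord (X k) n) < e"
      by (meson le_less_trans)
  qed
  then obtain a where a: "\<And>n. (\<lambda>m. coord (X m) n) \<longlonglongrightarrow> a n"
    unfolding Cauchy_convergent_iff convergent_def by metis
  have bound: "\<exists>K. \<forall>m\<ge>K. \<forall>j. (\<Sum>n<j. (cmod (coord (X m) n - a n))\<^sup>2) \<le> e\<^sup>2" if "0 < e" for e
  proof -
    obtain K where K: "\<And>m k. m \<ge> K \<Longrightarrow> k \<ge> K \<Longrightarrow> dist (X m) (X k) < e"
      using metric_CauchyD[OF X \<open>0 < e\<close>] by blast
    have "(\<Sum>n<j. (cmod (coord (X m) n - a n))\<^sup>2) \<le> e\<^sup>2" if "m \<ge> K" for m j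
    proof (rule tendsto_upperbound)
      show "(\<lambda>k. \<Sum>n<j. (cmod (coord (X m) n - coord (X k) n))\<^sup>2)
              \<longlonglongrightarrow> (\<Sum>n<j. (cmod (coord (X m) n - a n))\<^sup>2)"
        by (intro tendsto_intros a)
      show "\<forall>\<^sub>F k in sequentially. (\<Sum>n<j. (cmod (coord (X m) n - coord (X k) n))\<^sup>2) \<le> e\<^sup>2"
        unfolding eventually_sequentially
      proof (intro exI allI impI)
        fix k assume "K \<le> k"
        have "(\<Sum>n<j. (cmod (coord (X m) n - coord (X k) n))\<^sup>2) \<le> (norm (X m - X k))\<^sup>2"
          using sum_coord_le_norm[of "X m - X k" j] by simp
        also have "\<dots> \<le> e\<^sup>2"
          using K[OF \<open>m \<ge> K\<close> \<open>K \<le> k\<close>] by (intro power_mono) (auto simp: dist_norm)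
        finally show "(\<Sum>n<j. (cmod (coord (X m) n - coord (X k) n))\<^sup>2) \<le> e\<^sup>2" .
      qed
    qed simp
    then show ?thesis by blast
  qed
  have summ: "summable (\<lambda>n. (cmod (coord (X m) n - a n))\<^sup>2)"
    if "\<forall>j. (\<Sum>n<j. (cmod (coord (X m) n - a n))\<^sup>2) \<le> e" for m e
    using that by (intro summableI_nonneg_bounded[where x = e]) auto
  obtain K where "\<forall>j. (\<Sum>n<j. (cmod (coord (X K) n - a n))\<^sup>2) \<le> 1\<^sup>2"
    using bound[of 1] by auto
  from square_summable_add[OF summable_coord[of "X K"] square_summable_mult[OF summ[OF this], of "-1"]]
  have "summable (\<lambda>n. (cmod (a n))\<^sup>2)"
    by simp
  then have L: "coord (Abs_ell2 a) = a"
    by (simp add: Abs_ell2_inverse)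
  have "X \<longlonglongrightarrow> Abs_ell2 a"
  proof (rule metric_LIMSEQ_I)
    fix e :: real assume "0 < e"
    then obtain K where K: "\<And>m j. m \<ge> K \<Longrightarrow> (\<Sum>n<j. (cmod (coord (X m) n - a n))\<^sup>2) \<le> (e / 2)\<^sup>2"
      using bound[of "e / 2"] by auto
    have "dist (X m) (Abs_ell2 a) < e" if "m \<ge> K" for m
    proof -
      have "(norm (X m - Abs_ell2 a))\<^sup>2 \<le> (e / 2)\<^sup>2"
        unfolding norm_ell2_square using K[OF that] summable_coord[of "X m - Abs_ell2 a"]
        by (intro suminf_le_const) (auto simp: L)
      then have "norm (X m - Abs_ell2 a) \<le> e / 2"
        by (rule power2_le_imp_le) (use \<open>0 < e\<close> in simp)
      then show ?thesis
        using \<open>0 < e\<close> by (simp add: dist_norm)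
    qed
    then show "\<exists>K. \<forall>m\<ge>K. dist (X m) (Abs_ell2 a) < e"
      by blast
  qed
  then show "convergent X"
    by (auto simp: convergent_def)
qed

global_interpretation complex: vector_space "scaleC :: complex \<Rightarrow> ell2 \<Rightarrow> ell2"
  defines cspan = complex.span
  by standard (auto intro!: ell2_eqI simp: algebra_simps)


section \<open>Singular values and the operator space of a sequence space\<close>

definition complex_linear :: "(ell2 \<Rightarrow>\<^sub>L ell2) \<Rightarrow> bool"
  where "complex_linear x \<longleftrightarrow> (\<forall>c u. blinfun_apply x (c *\<^sub>C u) = c *\<^sub>C blinfun_apply x u)"

definition compact_operator :: "(ell2 \<Rightarrow>\<^sub>L ell2) \<Rightarrow> bool"
  where "compact_operator x \<longleftrightarrow> compact (closure (blinfun_apply x ` cball 0 1))"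

definition essential_norm :: "(ell2 \<Rightarrow>\<^sub>L ell2) \<Rightarrow> real"
  where "essential_norm x = Inf {norm (x - k) | k. complex_linear k \<and> compact_operator k}"

text \<open>
  The kernel of \<open>x\<^sup>*x - t\<^sup>2\<close>, that is, for \<open>t \<ge> 0\<close>, the eigenspace of \<open>\<bar>x\<bar>\<close> for the eigenvalue \<open>t\<close>.
  The adjoint of a bounded operator exists by the Riesz representation theorem, and for
  complex-linear \<open>x\<close> the adjoint with respect to the real inner product is the usual one.
\<close>

definition singular_space :: "(ell2 \<Rightarrow>\<^sub>L ell2) \<Rightarrow> real \<Rightarrow> ell2 set"
  where "singular_space x t =
    {u. adjoint (blinfun_apply x) (blinfun_apply x u) = t\<^sup>2 *\<^sub>R u}"

text \<open>
  The condition on \<open>B\<close> says that \<open>\<bar>x\<bar>\<close> has at most \<open>n\<close> eigenvalues in \<open>(s, \<infinity>)\<close>, counted with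
  multiplicity. For compact \<open>x\<close> the essential norm is 0, and \<open>singular_value x n\<close> is the
  \<open>n\<close>-th eigenvalue of \<open>\<bar>x\<bar>\<close> in non-increasing order with multiplicity, starting from \<open>n = 0\<close> and
  continued by 0 when \<open>x\<close> has finite rank. For other bounded \<open>x\<close> this is the convention of Gohberg
  and Krein: only eigenvalues of \<open>\<bar>x\<bar>\<close> above its essential spectrum are counted, and the list is
  continued by the maximum of the essential spectrum, which is the essential norm.
\<close>

definition singular_value :: "(ell2 \<Rightarrow>\<^sub>L ell2) \<Rightarrow> nat \<Rightarrow> real"
  where "singular_value x n =
    Inf {s. essential_norm x \<le> s \<and>
            (\<exists>B. finite B \<and> card B \<le> n \<and> (\<forall>t>s. singular_space x t \<subseteq> cspan B))}"

definition operator_space :: "(nat \<Rightarrow> real) set \<Rightarrow> (ell2 \<Rightarrow>\<^sub>L ell2) set"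
  where "operator_space F = {x. complex_linear x \<and> singular_value x \<in> F}"

definition operator_space_norm :: "((nat \<Rightarrow> real) \<Rightarrow> real) \<Rightarrow> (ell2 \<Rightarrow>\<^sub>L ell2) \<Rightarrow> real"
  where "operator_space_norm N x = N (singular_value x)"

end

theory Submission
  imports Defs "HOL-Probability.Weak_Convergence" "HOL-Probability.Independent_Family"
    "HOL-Probability.Infinite_Product_Measure" "HOL-Probability.Probability_Mass_Function"
begin

text \<open>
  Let \<open>L\<^sub>p \<subseteq> E\<close> with \<open>p < 2\<close>, and choose \<open>r\<close> with \<open>p < r < 2\<close> such that \<open>\<ell>\<^sub>r\<close> does not embed into
  \<open>F\<close>. The space \<open>E\<close> contains \<open>\<ell>\<^sub>r\<close>, and if \<open>C\<^sub>F\<close> contained \<open>\<ell>\<^sub>r\<close>, then so would \<open>F\<close>.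

  The copy of \<open>\<ell>\<^sub>r\<close> in \<open>E\<close> is spanned by independent symmetric variables \<open>X k\<close> with the tails of an
  \<open>r\<close>-stable law. Let \<open>S\<close> be a linear combination with coefficients of \<open>\<ell>\<^sub>r\<close>-norm 1. An inequality
  of type 2 for the function \<open>min (s\<^sup>2) (\<bar>s\<bar> powr p)\<close> bounds \<open>S\<close> in \<open>L\<^sub>p\<close>, hence in \<open>E\<close>. Conversely, the
  characteristic function of \<open>S\<close> is a product bounded away from 1, so that \<open>\<bar>S\<bar> \<ge> \<eta>\<close> on a set of
  measure at least \<open>\<delta>\<close>. This bounds the norm of \<open>S\<close> in \<open>E\<close> from below by symmetry
  (\<open>exists_lr_functions\<close>, \<open>lr_basis\<close>).

  Now let \<open>x k\<close> be a sequence in \<open>C\<^sub>F\<close> equivalent to the basis of \<open>\<ell>\<^sub>r\<close>, and let \<open>P\<close> be a coordinate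
  projection of finite rank. The maps \<open>x \<mapsto> P x\<close> and \<open>x \<mapsto> x P\<close> take values in Hilbert spaces. Since
  \<open>r < 2\<close>, flat combinations of the \<open>x k\<close> with suitable signs have \<open>\<ell>\<^sub>r\<close>-norm 1 and arbitrarily small
  images under both maps. As \<open>F\<close> is separable, \<open>y \<in> C\<^sub>F\<close> is the limit of its truncations \<open>P y P\<close>.
  Hence there are blocks of the sequence as close as desired to operators \<open>z j\<close> which live on
  disjoint sets of coordinates (\<open>almost_block\<close>). The singular values of \<open>\<Sum>j. c j *\<^sub>R z j\<close> are those
  of all \<open>c j *\<^sub>R z j\<close> together, and placing them on disjoint subsets of \<open>\<nat>\<close> yields a sequence which
  depends linearly on \<open>c\<close>. This embeds \<open>\<ell>\<^sub>r\<close> into \<open>F\<close> (\<open>lp_space_embeds\<close>, \<open>lp_space_embeds_F\<close>).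

  Singular values are handled through real approximation numbers, to which they are equivalent up
  to a dilation by 2 (\<open>operator_space_ideal\<close>). The norm of \<open>C\<^sub>F\<close> then becomes a quasinorm with
  constant 2, which suffices for the perturbation argument. The link is the variational
  description of the largest eigenvalue of \<open>x\<^sup>*x\<close> on an invariant subspace
  (\<open>exists_singular_vector\<close>). Operators in \<open>C\<^sub>F\<close> are compact since a separable \<open>F\<close> contains no
  nonzero constant sequence.
\<close>

section \<open>Symmetric sequence spaces\<close>

lemma rearrangement_cong:
  assumes "\<And>s. 0 \<le> s \<Longrightarrow>
    emeasure M {x \<in> space M. s < \<bar>f x\<bar>} = emeasure M {x \<in> space M. s < \<bar>g x\<bar>}"
  shows "rearrangement M f = rearrangement M g"
proof -
  have "emeasure M {x \<in> space M. s < ennreal \<bar>f x\<bar>} = emeasure M {x \<in> space M. s < ennreal \<bar>g x\<bar>}"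
    for s
  proof (cases s)
    case (real r)
    then show ?thesis
      using assms[of r] by (simp add: ennreal_less_iff)
  qed simp
  then show ?thesis
    by (simp add: rearrangement_def fun_eq_iff)
qed

lemma sum_fun_apply: "(\<Sum>i\<in>I. f i) x = (\<Sum>i\<in>I. f i x)"
  by (induction I rule: infinite_finite_induct) auto

lemma emeasure_count_space_bij:
  assumes "bij_betw h A B"
  shows "emeasure (count_space UNIV) A = emeasure (count_space UNIV) B"
  using bij_betw_finite[OF assms] bij_betw_same_card[OF assms]
  by (simp add: emeasure_count_space)

locale separable_seq_space =
  fixes F :: "(nat \<Rightarrow> real) set" and N :: "(nat \<Rightarrow> real) \<Rightarrow> real"
  assumes symmetric: "symmetric_sequence_space F N"
    and separable: "separable_normed F N"
begin

lemma banach: "banach_function_space (count_space UNIV) F N"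
  using symmetric by (simp add: symmetric_sequence_space_def symmetric_space_def)

lemma subspace_F: "subspace F"
  using banach by (simp add: banach_function_space_def)

lemma add_F: "f \<in> F \<Longrightarrow> g \<in> F \<Longrightarrow> f + g \<in> F"
  and diff_F: "f \<in> F \<Longrightarrow> g \<in> F \<Longrightarrow> f - g \<in> F"
  and scale_F: "f \<in> F \<Longrightarrow> c *\<^sub>R f \<in> F"
  and zero_F: "0 \<in> F"
  using subspace_F by (auto intro: subspace_add subspace_diff subspace_scale subspace_0)

lemma norm_nonneg: "f \<in> F \<Longrightarrow> 0 \<le> N f"
  and norm_eq_0: "f \<in> F \<Longrightarrow> N f = 0 \<longleftrightarrow> (\<forall>n. f n = 0)"
  and norm_scale: "f \<in> F \<Longrightarrow> N (c *\<^sub>R f) = \<bar>c\<bar> * N f"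
  and norm_add: "f \<in> F \<Longrightarrow> g \<in> F \<Longrightarrow> N (f + g) \<le> N f + N g"
  using banach by (auto simp: banach_function_space_def AE_count_space)

lemma complete_F:
  assumes "\<And>n. X n \<in> F" "\<And>e. e > 0 \<Longrightarrow> \<exists>K. \<forall>m\<ge>K. \<forall>n\<ge>K. N (X m - X n) < e"
  obtains f where "f \<in> F" "(\<lambda>n. N (X n - f)) \<longlonglongrightarrow> 0"
  using banach assms unfolding banach_function_space_def by blast

lemma norm_uminus: "f \<in> F \<Longrightarrow> N (- f) = N f"
  using norm_scale[of f "-1"] by simp

lemma norm_diff_triangle: "f \<in> F \<Longrightarrow> g \<in> F \<Longrightarrow> N f \<le> N g + N (f - g)"
  using norm_add[of g "f - g"] by (simp add: diff_F)

lemma lattice: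
  assumes "f \<in> F" "\<And>n. \<bar>g n\<bar> \<le> \<bar>f n\<bar>"
  shows "g \<in> F" "N g \<le> N f"
proof -
  have "\<forall>f\<in>F. \<forall>g\<in>borel_measurable (count_space UNIV).
      (AE x in count_space UNIV. \<bar>g x\<bar> \<le> \<bar>f x\<bar>) \<longrightarrow> g \<in> F \<and> N g \<le> N f"
    using symmetric unfolding symmetric_sequence_space_def symmetric_space_def by blast
  moreover have "AE x in count_space UNIV. \<bar>g x\<bar> \<le> \<bar>f x\<bar>"
    using assms(2) by simp
  ultimately show "g \<in> F" "N g \<le> N f"
    using assms(1) borel_measurable_count_space by blast+
qed

lemma equimeasurable:
  assumes "f \<in> F"
    and "\<And>s. 0 \<le> s \<Longrightarrow> emeasure (count_space UNIV) {n. s < \<bar>f n\<bar>} = emeasure (count_space UNIV) {n. s < \<bar>g n\<bar>}"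
  shows "g \<in> F" "N g = N f"
proof -
  have "rearrangement (count_space UNIV) g = rearrangement (count_space UNIV) f"
    using assms(2) by (intro rearrangement_cong) simp
  then show "g \<in> F" "N g = N f"
    using symmetric assms(1) unfolding symmetric_sequence_space_def symmetric_space_def
    by (metis borel_measurable_count_space)+
qed

lemma transplant:
  assumes "f \<in> F" "inj \<iota>" "\<And>n. g (\<iota> n) = f n" "\<And>i. i \<notin> range \<iota> \<Longrightarrow> g i = 0"
  shows "g \<in> F" "N g = N f"
proof -
  have "bij_betw \<iota> {n. s < \<bar>f n\<bar>} {n. s < \<bar>g n\<bar>}" if "0 \<le> s" for s
  proof -
    have "{n. s < \<bar>g n\<bar>} = \<iota> ` {n. s < \<bar>f n\<bar>}"
    proof (intro set_eqI iffI)
      fix i assume i: "i \<in> {n. s < \<bar>g n\<bar>}"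
      then have "i \<in> range \<iota>"
        using assms(4)[of i] that by fastforce
      then show "i \<in> \<iota> ` {n. s < \<bar>f n\<bar>}"
        using i assms(3) by auto
    qed (auto simp: assms(3))
    then show ?thesis
      using inj_on_subset[OF assms(2)] by (simp add: bij_betw_def)
  qed
  then show "g \<in> F" "N g = N f"
    using equimeasurable[OF assms(1)] emeasure_count_space_bij by blast+
qed

lemma dilation:
  assumes "f \<in> F"
  shows "(\<lambda>n. f (n div 2)) \<in> F" "N (\<lambda>n. f (n div 2)) \<le> 2 * N f"
proof -
  define g h where "g n = (if even n then f (n div 2) else 0)"
    and "h n = (if odd n then f (n div 2) else 0)" for n
  have range: "range (\<lambda>n. 2 * n) = {n::nat. even n}"
    by (auto elim!: evenE)
  have range': "range (\<lambda>n. Suc (2 * n)) = {n::nat. odd n}"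
    by (auto elim!: oddE)
  have g: "g \<in> F" "N g = N f"
    by (rule transplant[OF assms, of "\<lambda>n. 2 * n"], auto simp: range inj_def g_def)+
  have h: "h \<in> F" "N h = N f"
    by (rule transplant[OF assms, of "\<lambda>n. Suc (2 * n)"], auto simp: range' inj_def h_def)+
  have "(\<lambda>n. f (n div 2)) = g + h"
    by (auto simp: g_def h_def)
  then show "(\<lambda>n. f (n div 2)) \<in> F" "N (\<lambda>n. f (n div 2)) \<le> 2 * N f"
    using add_F[OF g(1) h(1)] norm_add[OF g(1) h(1)] g h by auto
qed

lemma unit_seq_F: "unit_seq k \<in> F" and norm_unit_seq: "N (unit_seq k) = 1"
proof -
  have 0: "unit_seq 0 \<in> F" "N (unit_seq 0) = 1"
    using symmetric by (auto simp: symmetric_sequence_space_def)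
  have "{n. s < \<bar>unit_seq j n\<bar>} = (if s < 1 then {j} else {})" if "0 \<le> s" for s j
    using that by (auto simp: unit_seq_def indicator_def)
  then have "emeasure (count_space UNIV) {n. s < \<bar>unit_seq 0 n\<bar>}
      = emeasure (count_space UNIV) {n. s < \<bar>unit_seq k n\<bar>}" if "0 \<le> s" for s
    using that by simp
  from equimeasurable[of "unit_seq 0" "unit_seq k", OF 0(1) this] 0(2) show "unit_seq k \<in> F" "N (unit_seq k) = 1"
    by (blast, metis)
qed

lemma coord_le:
  assumes "f \<in> F"
  shows "\<bar>f n\<bar> \<le> N f"
proof -
  have "N (f n *\<^sub>R unit_seq n) \<le> N f"
    by (rule lattice(2)[OF assms]) (simp add: scaleR_fun_def unit_seq_def indicator_def)
  then show ?thesis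
    by (metis norm_scale unit_seq_F norm_unit_seq mult.right_neutral)
qed

lemma sum_F: "(\<And>i. i \<in> I \<Longrightarrow> f i \<in> F) \<Longrightarrow> sum f I \<in> F"
  using subspace_F by (rule subspace_sum)

lemma norm_sum: "finite I \<Longrightarrow> (\<And>i. i \<in> I \<Longrightarrow> f i \<in> F) \<Longrightarrow> N (sum f I) \<le> (\<Sum>i\<in>I. N (f i))"
proof (induction rule: finite_induct)
  case empty
  have "N (0 *\<^sub>R 0) = 0"
    using norm_scale[OF zero_F, of 0] by (simp only: abs_zero mult_zero_left)
  then show ?case
    by (simp only: scaleR_zero_left sum.empty order.refl)
next
  case (insert i I)
  have "N (sum f (insert i I)) = N (f i + sum f I)"
    by (simp only: sum.insert[OF insert.hyps])
  also have "\<dots> \<le> N (f i) + N (sum f I)"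
    by (rule norm_add) (use insert.prems in \<open>auto intro: sum_F\<close>)
  also have "\<dots> \<le> N (f i) + (\<Sum>i\<in>I. N (f i))"
    using insert.IH insert.prems by (meson add_left_mono insertCI)
  also have "\<dots> = (\<Sum>i\<in>insert i I. N (f i))"
    using insert.hyps by simp
  finally show ?case .
qed

lemma finite_support:
  assumes "\<And>n. n \<ge> d \<Longrightarrow> f n = 0" "\<And>n. \<bar>f n\<bar> \<le> C"
  shows "f \<in> F" "N f \<le> real d * C"
proof -
  have eq: "f = (\<Sum>n<d. f n *\<^sub>R unit_seq n)"
  proof
    fix i
    have "(\<Sum>n<d. f n *\<^sub>R unit_seq n) i = (\<Sum>n<d. if n = i then f i else 0)"
      unfolding sum_fun_apply by (intro sum.cong) (auto simp: scaleR_fun_def unit_seq_def)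
    then show "f i = (\<Sum>n<d. f n *\<^sub>R unit_seq n) i"
      using assms(1)[of i] by (cases "i < d") auto
  qed
  show "f \<in> F"
    by (subst eq) (intro sum_F scale_F unit_seq_F)
  have "N f \<le> (\<Sum>n<d. N (f n *\<^sub>R unit_seq n))"
    by (subst eq) (intro norm_sum scale_F unit_seq_F, simp)
  also have "\<dots> \<le> (\<Sum>n<d. C)"
    by (intro sum_mono) (simp add: norm_scale unit_seq_F norm_unit_seq assms)
  finally show "N f \<le> real d * C"
    by simp
qed

lemma restrict:
  assumes "f \<in> F"
  shows "(\<lambda>n. if n \<in> A then f n else 0) \<in> F" "N (\<lambda>n. if n \<in> A then f n else 0) \<le> N f"
  by (rule lattice[OF assms], simp)+

text \<open>
  Separability enters only here. If the initial segments of \<open>f\<close> were not a Cauchy sequence, \<open>f\<close>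
  would have infinitely many disjoint finite pieces of norm at least \<open>e\<close>, and then the sums of
  subfamilies of these pieces would be an uncountable \<open>e\<close>-separated subset of \<open>F\<close>. So the initial
  segments converge, and their limit can only be \<open>f\<close>.
\<close>

lemma tails_tendsto_0:
  assumes f: "f \<in> F" and e: "e > 0"
  obtains K where "N (\<lambda>n. if n \<ge> K then f n else 0) < e"
proof -
  define X where "X m = (\<lambda>n. if n \<in> {..<m} then f n else 0)" for m :: nat
  have X: "X m \<in> F" for m
    unfolding X_def by (rule restrict[OF f])
  have Cauchy: "\<exists>K. \<forall>m\<ge>K. \<forall>n\<ge>K. N (X m - X n) < e" if e: "e > 0" for e
  proof (rule ccontr)
    assume neg: "\<nexists>K. \<forall>m\<ge>K. \<forall>n\<ge>K. N (X m - X n) < e"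
    have "\<exists>m n. K \<le> m \<and> m < n \<and> e \<le> N (X n - X m)" for K
    proof -
      obtain m n where mn: "m \<ge> K" "n \<ge> K" "\<not> N (X m - X n) < e"
        using neg by blast
      have "N (X m - X n) = N (X n - X m)"
        using norm_uminus[OF diff_F[OF X X], of n m] by simp
      moreover have "m \<noteq> n"
        using mn norm_eq_0[OF zero_F] e by auto
      ultimately show ?thesis
        using mn by (metis linorder_neqE_nat not_less)
    qed
    then obtain lo hi where lohi: "\<And>K. K \<le> lo K \<and> lo K < hi K \<and> e \<le> N (X (hi K) - X (lo K))"
      by metis
    define s where "s = rec_nat 0 (\<lambda>_. hi)"
    have s_Suc: "s (Suc j) = hi (s j)" for j
      by (simp add: s_def)
    have "strict_mono s"
      by (rule strict_mono_Suc_iff[THEN iffD2]) (metis lohi s_Suc le_less_trans)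
    have piece: "e \<le> N (\<lambda>n. if n \<in> {lo (s j)..<s (Suc j)} then f n else 0)" for j
    proof -
      have "X (hi (s j)) - X (lo (s j)) = (\<lambda>n. if n \<in> {lo (s j)..<s (Suc j)} then f n else 0)"
        using lohi[of "s j"] by (auto simp: X_def s_Suc fun_eq_iff)
      then show ?thesis
        using lohi[of "s j"] by simp
    qed
    define Y where "Y J = (\<lambda>n. if n \<in> (\<Union>j\<in>J. {lo (s j)..<s (Suc j)}) then f n else 0)" for J
    have Y: "Y J \<in> F" for J
      unfolding Y_def by (rule restrict[OF f])
    have unique: "i = j" if "n \<in> {lo (s i)..<s (Suc i)}" "n \<in> {lo (s j)..<s (Suc j)}" for i j n
    proof (rule ccontr)
      assume "i \<noteq> j"
      then consider "Suc i \<le> j" | "Suc j \<le> i"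
        by linarith
      then show False
        using that lohi[of "s i"] lohi[of "s j"] strict_mono_less_eq[OF \<open>strict_mono s\<close>]
        by cases (metis atLeastLessThan_iff leD le_trans less_le_trans)+
    qed
    have separated: "e \<le> N (Y I - Y J)" if "j \<in> I" "j \<notin> J" for I J j
    proof -
      have "N (\<lambda>n. if n \<in> {lo (s j)..<s (Suc j)} then f n else 0) \<le> N (Y I - Y J)"
      proof (rule lattice(2)[OF diff_F[OF Y Y]])
        fix n
        show "\<bar>if n \<in> {lo (s j)..<s (Suc j)} then f n else 0\<bar> \<le> \<bar>(Y I - Y J) n\<bar>"
        proof (cases "n \<in> {lo (s j)..<s (Suc j)}")
          case True
          then have "n \<notin> (\<Union>i\<in>J. {lo (s i)..<s (Suc i)})" "n \<in> (\<Union>i\<in>I. {lo (s i)..<s (Suc i)})"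
            using unique that by blast+
          then have "Y J n = 0" "Y I n = f n"
            unfolding Y_def by (simp_all only: if_False if_True)
          then show ?thesis
            by simp
        next
          case False
          then show ?thesis
            by (simp only: if_False abs_zero abs_ge_zero)
        qed
      qed
      with piece[of j] show ?thesis
        by linarith
    qed
    obtain D where D: "countable D" "D \<subseteq> F" "\<And>g e. g \<in> F \<Longrightarrow> e > 0 \<Longrightarrow> \<exists>d\<in>D. N (g - d) < e"
      using separable unfolding separable_normed_def by blast
    have "\<forall>J. \<exists>d\<in>D. N (Y J - d) < e / 2"
      using D(3)[OF Y, of "e / 2"] e by simp
    then obtain d where d: "\<And>J. d J \<in> D" "\<And>J. N (Y J - d J) < e / 2"
      by metis
    have "inj d"
    proof (rule injI, rule ccontr)
      fix I J assume eq: "d I = d J" and "I \<noteq> J"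
      have small: "N (Y I - Y J) < e" if "d I = d J" for I J
      proof -
        have dF: "d J \<in> F"
          using d(1) D(2) by blast
        have "N (Y I - Y J) \<le> N (Y I - d J) + N (d J - Y J)"
          using norm_add[OF diff_F[OF Y dF] diff_F[OF dF Y], of I J] by simp
        also have "N (d J - Y J) = N (Y J - d J)"
          using norm_uminus[OF diff_F[OF Y dF], of J] by simp
        finally show ?thesis
          using d(2)[of I, unfolded that] d(2)[of J] by linarith
      qed
      obtain j where "j \<in> I \<and> j \<notin> J \<or> j \<in> J \<and> j \<notin> I"
        using \<open>I \<noteq> J\<close> by blast
      then show False
        using separated[of j I J] separated[of j J I] small[of I J] small[of J I] eq by auto
    qed
    moreover have "countable (range d)"
      using D(1) d(1) by (meson countable_subset image_subsetI)
    ultimately have "countable (UNIV :: nat set set)"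
      using countable_image_inj_on by blast
    then have "\<exists>g :: nat \<Rightarrow> nat set. surj g"
      using uncountable_def by blast
    then show False
      using Cantors_theorem[of "UNIV :: nat set"] by (auto simp: Pow_UNIV)
  qed
  obtain g where g: "g \<in> F" "(\<lambda>m. N (X m - g)) \<longlonglongrightarrow> 0"
    using complete_F[of X, OF X Cauchy] by blast
  have "g = f"
  proof
    fix n
    have "(\<lambda>m. X m n - g n) \<longlonglongrightarrow> 0"
      by (rule Lim_null_comparison[OF _ g(2)])
        (use coord_le[OF diff_F[OF X g(1)]] in \<open>auto intro!: always_eventually\<close>)
    moreover have "\<forall>\<^sub>F m in sequentially. X m n - g n = f n - g n"
      by (rule eventually_mono[OF eventually_gt_at_top[of n]]) (simp add: X_def)
    ultimately have "(\<lambda>m::nat. f n - g n) \<longlonglongrightarrow> 0"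
      using tendsto_cong by fast
    then show "g n = f n"
      by (simp add: LIMSEQ_const_iff)
  qed
  with g(2) e obtain K where "N (X K - f) < e"
    by (metis (lifting) order_tendstoD(2) eventually_sequentially order_refl)
  moreover have "- (X K - f) = (\<lambda>n. if n \<ge> K then f n else 0)"
    by (auto simp: X_def fun_eq_iff)
  ultimately show ?thesis
    using that norm_uminus[OF diff_F[OF X f], of K] by metis
qed

lemma not_bounded_below:
  assumes "f \<in> F" "c > 0"
  obtains n where "\<bar>f n\<bar> < c"
proof (rule ccontr)
  assume "\<not> thesis"
  then have "c \<le> \<bar>f n\<bar>" for n
    using that by (meson not_less)
  then have const: "(\<lambda>n. c) \<in> F"
    using lattice(1)[OF assms(1), of "\<lambda>_. c"] assms(2) by simp
  obtain K where K: "N (\<lambda>n. if n \<ge> K then c else 0) < c"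
    using tails_tendsto_0[OF const assms(2)] by blast
  have "(\<lambda>n. if n \<ge> K then c else 0) \<in> F"
    using restrict(1)[OF const, of "{K..}"] by simp
  from coord_le[OF this, of K] K assms(2) show False
    by simp
qed

end

section \<open>Approximation numbers\<close>

definition rank_le :: "nat \<Rightarrow> ('a::real_normed_vector \<Rightarrow>\<^sub>L 'b::real_normed_vector) \<Rightarrow> bool"
  where "rank_le n k \<longleftrightarrow> (\<exists>B. finite B \<and> card B \<le> n \<and> range (blinfun_apply k) \<subseteq> span B)"

lemma linear_blinfun_apply: "linear (blinfun_apply x)"
  by (rule bounded_linear.linear) (rule blinfun.bounded_linear_right)

lemma rank_leI: "finite B \<Longrightarrow> card B \<le> n \<Longrightarrow> (\<And>u. blinfun_apply k u \<in> span B) \<Longrightarrow> rank_le n k"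
  unfolding rank_le_def by blast

lemma rank_leE:
  assumes "rank_le n k"
  obtains B where "finite B" "card B \<le> n" "\<And>u. blinfun_apply k u \<in> span B"
  using assms unfolding rank_le_def by blast

lemma rank_le_mono: "rank_le m k \<Longrightarrow> m \<le> n \<Longrightarrow> rank_le n k"
  unfolding rank_le_def using le_trans by blast

lemma rank_le_zero: "rank_le n 0"
  by (rule rank_leI[of "{}"]) auto

lemma rank_le_0_iff: "rank_le 0 k \<longleftrightarrow> k = 0"
proof
  assume "rank_le 0 k"
  then show "k = 0"
    by (elim rank_leE) (auto intro!: blinfun_eqI)
qed (simp add: rank_le_zero)

lemma rank_le_add:
  assumes "rank_le m k" "rank_le n l"
  shows "rank_le (m + n) (k + l)"
proof -
  obtain B C where B: "finite B" "card B \<le> m" "\<And>u. blinfun_apply k u \<in> span B"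
    and C: "finite C" "card C \<le> n" "\<And>u. blinfun_apply l u \<in> span C"
    using assms by (elim rank_leE) blast
  show ?thesis
  proof (rule rank_leI[of "B \<union> C"])
    show "card (B \<union> C) \<le> m + n"
      using card_Un_le[of B C] B(2) C(2) by linarith
    show "blinfun_apply (k + l) u \<in> span (B \<union> C)" for u
      using B(3)[of u] C(3)[of u] span_mono[of B "B \<union> C"] span_mono[of C "B \<union> C"]
      by (auto simp: blinfun.add_left intro!: span_add)
  qed (use B C in auto)
qed

lemma rank_le_scaleR:
  assumes "rank_le n k"
  shows "rank_le n (c *\<^sub>R k)"
proof -
  obtain B where B: "finite B" "card B \<le> n" "\<And>u. blinfun_apply k u \<in> span B"
    using assms by (elim rank_leE) blast
  show ?thesis
    by (rule rank_leI[of B]) (auto simp: B blinfun.scaleR_left intro: span_scale)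
qed

lemma rank_le_compose_right: "rank_le n k \<Longrightarrow> rank_le n (k o\<^sub>L x)"
  unfolding rank_le_def by force

lemma rank_le_compose_left:
  assumes "rank_le n k"
  shows "rank_le n (x o\<^sub>L k)"
proof -
  obtain B where B: "finite B" "card B \<le> n" "\<And>u. blinfun_apply k u \<in> span B"
    using assms by (elim rank_leE) blast
  have "span (blinfun_apply x ` B) = blinfun_apply x ` span B"
    by (rule linear_span_image) (rule linear_blinfun_apply)
  then show ?thesis
    using B card_image_le[OF B(1), of "blinfun_apply x"]
    by (intro rank_leI[of "blinfun_apply x ` B"]) auto
qed

text \<open>
  The approximants are real-linear and rank means real dimension, so that \<^typ>\<open>ell2\<close> can be treated
  as a real Hilbert space.
\<close>

definition approx_number :: "('a::real_normed_vector \<Rightarrow>\<^sub>L 'b::real_normed_vector) \<Rightarrow> nat \<Rightarrow> real"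
  where "approx_number x n = Inf {norm (x - k) | k. rank_le n k}"

lemma approx_number_le: "rank_le n k \<Longrightarrow> approx_number x n \<le> norm (x - k)"
  unfolding approx_number_def by (intro cInf_lower bdd_belowI[of _ 0]) auto

lemma approx_number_geI: "(\<And>k. rank_le n k \<Longrightarrow> s \<le> norm (x - k)) \<Longrightarrow> s \<le> approx_number x n"
  unfolding approx_number_def using rank_le_zero by (intro cInf_greatest) blast+

lemma approx_number_lessE:
  assumes "approx_number x n < s"
  obtains k where "rank_le n k" "norm (x - k) < s"
  using assms approx_number_geI[of n s x] by force

lemma approx_number_nonneg: "0 \<le> approx_number x n"
  by (rule approx_number_geI) simp

lemma approx_number_antimono: "m \<le> n \<Longrightarrow> approx_number x n \<le> approx_number x m"
  by (intro approx_number_geI approx_number_le) (rule rank_le_mono)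

lemma approx_number_0: "approx_number x 0 = norm x"
  using approx_number_le[OF rank_le_zero, of x 0]
  by (intro antisym approx_number_geI) (simp_all add: rank_le_0_iff)

lemma approx_number_le_norm: "approx_number x n \<le> norm x"
  using approx_number_le[OF rank_le_zero, of x n] by simp

lemma approx_number_eq_0: "rank_le d x \<Longrightarrow> d \<le> n \<Longrightarrow> approx_number x n = 0"
  using approx_number_le[of n x x] rank_le_mono[of d x n] approx_number_nonneg[of x n] by simp

lemma approx_number_add: "approx_number (x + y) (m + n) \<le> approx_number x m + approx_number y n"
proof (rule field_le_epsilon)
  fix e :: real assume e: "e > 0"
  obtain k l where kl: "rank_le m k" "norm (x - k) < approx_number x m + e / 2"
    "rank_le n l" "norm (y - l) < approx_number y n + e / 2"
    using e by (meson approx_number_lessE half_gt_zero less_add_same_cancel1)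
  have "approx_number (x + y) (m + n) \<le> norm (x + y - (k + l))"
    by (rule approx_number_le[OF rank_le_add[OF kl(1,3)]])
  also have "x + y - (k + l) = (x - k) + (y - l)"
    by simp
  also have "norm \<dots> \<le> norm (x - k) + norm (y - l)"
    by (rule norm_triangle_ineq)
  finally show "approx_number (x + y) (m + n) \<le> approx_number x m + approx_number y n + e"
    using kl(2,4) by linarith
qed

lemma approx_number_scaleR: "approx_number (c *\<^sub>R x) n = \<bar>c\<bar> * approx_number x n"
proof (cases "c = 0")
  case True
  then show ?thesis
    using approx_number_le_norm[of "0 :: 'a \<Rightarrow>\<^sub>L 'b" n] approx_number_nonneg[of "0 :: 'a \<Rightarrow>\<^sub>L 'b" n] by simp
next
  case False
  have le: "approx_number (c *\<^sub>R x) n \<le> \<bar>c\<bar> * approx_number x n" if "c \<noteq> 0" for c and x :: "'a \<Rightarrow>\<^sub>L 'b"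
  proof -
    have "approx_number (c *\<^sub>R x) n / \<bar>c\<bar> \<le> approx_number x n"
    proof (rule approx_number_geI)
      fix k :: "'a \<Rightarrow>\<^sub>L 'b" assume "rank_le n k"
      from approx_number_le[OF rank_le_scaleR[OF this], of "c *\<^sub>R x" c]
      have "approx_number (c *\<^sub>R x) n \<le> \<bar>c\<bar> * norm (x - k)"
        by (simp flip: scaleR_diff_right)
      then show "approx_number (c *\<^sub>R x) n / \<bar>c\<bar> \<le> norm (x - k)"
        using that by (simp add: field_simps)
    qed
    then show ?thesis
      using that by (simp add: field_simps)
  qed
  have "approx_number x n \<le> \<bar>1 / c\<bar> * approx_number (c *\<^sub>R x) n"
    using le[of "1 / c" "c *\<^sub>R x"] False by simp
  then have "\<bar>c\<bar> * approx_number x n \<le> approx_number (c *\<^sub>R x) n"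
    using False by (simp add: field_simps)
  with le[OF False, of x] show ?thesis
    by simp
qed

lemma approx_number_compose_left: "approx_number (x o\<^sub>L y) n \<le> norm x * approx_number y n"
proof (rule field_le_epsilon)
  fix e :: real assume e: "e > 0"
  have "approx_number y n < approx_number y n + e / (norm x + 1)"
    using e by (simp add: add_nonneg_pos)
  then obtain k where k: "rank_le n k" "norm (y - k) < approx_number y n + e / (norm x + 1)"
    by (rule approx_number_lessE)
  have "approx_number (x o\<^sub>L y) n \<le> norm ((x o\<^sub>L y) - (x o\<^sub>L k))"
    by (rule approx_number_le[OF rank_le_compose_left[OF k(1)]])
  also have "(x o\<^sub>L y) - (x o\<^sub>L k) = x o\<^sub>L (y - k)"
    by (rule blinfun_eqI) (simp add: blinfun.diff_left blinfun.diff_right)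
  also have "norm \<dots> \<le> norm x * norm (y - k)"
    by (rule norm_blinfun_compose)
  also have "\<dots> \<le> norm x * (approx_number y n + e / (norm x + 1))"
    using k(2) by (intro mult_left_mono) auto
  also have "\<dots> \<le> norm x * approx_number y n + e"
  proof -
    have "norm x * (e / (norm x + 1)) = e * (norm x / (norm x + 1))"
      by simp
    also have "\<dots> \<le> e * 1"
      using e by (intro mult_left_mono) (auto simp: add_nonneg_pos)
    finally show ?thesis
      by (simp add: distrib_left)
  qed
  finally show "approx_number (x o\<^sub>L y) n \<le> norm x * approx_number y n + e" .
qed

lemma approx_number_compose_right: "approx_number (x o\<^sub>L y) n \<le> approx_number x n * norm y"
proof (rule field_le_epsilon)
  fix e :: real assume e: "e > 0"
  have "approx_number x n < approx_number x n + e / (norm y + 1)"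
    using e by (simp add: add_nonneg_pos)
  then obtain k where k: "rank_le n k" "norm (x - k) < approx_number x n + e / (norm y + 1)"
    by (rule approx_number_lessE)
  have "approx_number (x o\<^sub>L y) n \<le> norm ((x o\<^sub>L y) - (k o\<^sub>L y))"
    by (rule approx_number_le[OF rank_le_compose_right[OF k(1)]])
  also have "(x o\<^sub>L y) - (k o\<^sub>L y) = (x - k) o\<^sub>L y"
    by (rule blinfun_eqI) (simp add: blinfun.diff_left)
  also have "norm \<dots> \<le> norm (x - k) * norm y"
    by (rule norm_blinfun_compose)
  also have "\<dots> \<le> (approx_number x n + e / (norm y + 1)) * norm y"
    using k(2) by (intro mult_right_mono) auto
  also have "\<dots> \<le> approx_number x n * norm y + e"
  proof -
    have "e / (norm y + 1) * norm y = e * (norm y / (norm y + 1))"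
      by simp
    also have "\<dots> \<le> e * 1"
      using e by (intro mult_left_mono) (auto simp: add_nonneg_pos)
    finally show ?thesis
      by (simp add: distrib_right)
  qed
  finally show "approx_number (x o\<^sub>L y) n \<le> approx_number x n * norm y + e" .
qed

text \<open>
  If \<open>x\<close> is bounded below by \<open>s\<close> on a subspace of dimension greater than \<open>n\<close>, then every \<open>k\<close> of rank
  at most \<open>n\<close> kills a nonzero vector \<open>u\<close> of that subspace, and \<open>norm (x - k) \<ge> s\<close> is seen at \<open>u\<close>.
\<close>

lemma approx_number_ge:
  assumes B: "finite B" "independent B" "n < card B"
    and bound: "\<And>u. u \<in> span B \<Longrightarrow> s * norm u \<le> norm (blinfun_apply x u)"
  shows "s \<le> approx_number x n"
proof (rule approx_number_geI)
  fix k :: "'a \<Rightarrow>\<^sub>L 'b" assume "rank_le n k"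
  then obtain C where C: "finite C" "card C \<le> n" "\<And>u. blinfun_apply k u \<in> span C"
    by (elim rank_leE) blast
  have lin: "linear (blinfun_apply k)"
    by (rule linear_blinfun_apply)
  have "\<exists>u\<in>span B. u \<noteq> 0 \<and> blinfun_apply k u = 0"
  proof (rule ccontr)
    assume *: "\<not> ?thesis"
    have inj: "inj_on (blinfun_apply k) (span B)"
      using * by (subst linear_injective_on_subspace_0[OF lin]) auto
    then have "independent (blinfun_apply k ` B)"
      by (intro linear_independent_injective_image[OF lin B(2)])
    moreover have "blinfun_apply k ` B \<subseteq> span C"
      using C(3) by blast
    ultimately have "card (blinfun_apply k ` B) \<le> card C"
      using independent_span_bound[OF C(1)] by blast
    moreover have "card (blinfun_apply k ` B) = card B"
      by (rule card_image) (rule inj_on_subset[OF inj span_superset])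
    ultimately show False
      using B(3) C(2) by linarith
  qed
  then obtain u where u: "u \<in> span B" "u \<noteq> 0" "blinfun_apply k u = 0"
    by blast
  have "s * norm u \<le> norm (blinfun_apply (x - k) u)"
    using bound[OF u(1)] u(3) by (simp add: blinfun.diff_left)
  also have "\<dots> \<le> norm (x - k) * norm u"
    by (rule norm_blinfun)
  finally show "s \<le> norm (x - k)"
    using u(2) by simp
qed

context separable_seq_space
begin

definition ideal :: "('a::real_normed_vector \<Rightarrow>\<^sub>L 'b::real_normed_vector) set"
  where "ideal = {x. approx_number x \<in> F}"

definition ideal_norm :: "('a::real_normed_vector \<Rightarrow>\<^sub>L 'b::real_normed_vector) \<Rightarrow> real"
  where "ideal_norm x = N (approx_number x)"

lemma ideal_norm_nonneg: "x \<in> ideal \<Longrightarrow> 0 \<le> ideal_norm x"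
  by (simp add: ideal_def ideal_norm_def norm_nonneg)

lemma norm_le_ideal_norm: "x \<in> ideal \<Longrightarrow> norm x \<le> ideal_norm x"
  using coord_le[of "approx_number x" 0] by (simp add: ideal_def ideal_norm_def approx_number_0)

lemma ideal_scaleR:
  assumes "x \<in> ideal"
  shows "c *\<^sub>R x \<in> ideal" "ideal_norm (c *\<^sub>R x) = \<bar>c\<bar> * ideal_norm x"
proof -
  have "approx_number (c *\<^sub>R x) = \<bar>c\<bar> *\<^sub>R approx_number x"
    by (simp add: fun_eq_iff scaleR_fun_def approx_number_scaleR)
  then show "c *\<^sub>R x \<in> ideal" "ideal_norm (c *\<^sub>R x) = \<bar>c\<bar> * ideal_norm x"
    using assms scale_F norm_scale by (auto simp: ideal_def ideal_norm_def)
qed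

lemma ideal_uminus:
  assumes "x \<in> ideal"
  shows "- x \<in> ideal" "ideal_norm (- x) = ideal_norm x"
  using ideal_scaleR[OF assms, of "-1"] by simp_all

text \<open>
  The dilation costs a factor 2, so that \<^term>\<open>ideal_norm\<close> is treated as a quasinorm only. This
  avoids the majorization argument behind the triangle inequality in an operator ideal.
\<close>

lemma ideal_add:
  assumes "x \<in> ideal" "y \<in> ideal"
  shows "x + y \<in> ideal" "ideal_norm (x + y) \<le> 2 * ideal_norm x + 2 * ideal_norm y"
proof -
  define f where "f = approx_number x + approx_number y"
  have xy: "approx_number x \<in> F" "approx_number y \<in> F"
    using assms by (auto simp: ideal_def)
  have f: "f \<in> F" "N f \<le> ideal_norm x + ideal_norm y"
    unfolding f_def ideal_norm_def by (rule add_F[OF xy], rule norm_add[OF xy])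
  have "\<bar>approx_number (x + y) n\<bar> \<le> \<bar>f (n div 2)\<bar>" for n
  proof -
    have "approx_number (x + y) n \<le> approx_number (x + y) (n div 2 + n div 2)"
      by (rule approx_number_antimono) linarith
    also have "\<dots> \<le> f (n div 2)"
      unfolding f_def plus_fun_apply by (rule approx_number_add)
    finally show ?thesis
      using approx_number_nonneg[of "x + y" n] by linarith
  qed
  then have "approx_number (x + y) \<in> F" "N (approx_number (x + y)) \<le> N (\<lambda>n. f (n div 2))"
    by (rule lattice[OF dilation(1)[OF f(1)]])+
  with dilation(2)[OF f(1)] f(2)
  show "x + y \<in> ideal" "ideal_norm (x + y) \<le> 2 * ideal_norm x + 2 * ideal_norm y"
    unfolding ideal_def ideal_norm_def by auto
qed

lemma ideal_diff:
  assumes "x \<in> ideal" "y \<in> ideal"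
  shows "x - y \<in> ideal" "ideal_norm (x - y) \<le> 2 * ideal_norm x + 2 * ideal_norm y"
  using ideal_add[OF assms(1) ideal_uminus(1)[OF assms(2)]] ideal_uminus(2)[OF assms(2)] by simp_all

lemma ideal_zero: "(0 :: 'a::real_normed_vector \<Rightarrow>\<^sub>L 'b::real_normed_vector) \<in> ideal"
  and ideal_norm_zero: "ideal_norm (0 :: 'a \<Rightarrow>\<^sub>L 'b) = 0"
proof -
  have "approx_number (0 :: 'a \<Rightarrow>\<^sub>L 'b) = 0"
    using approx_number_eq_0[OF rank_le_zero] by (auto simp: fun_eq_iff)
  then show "(0 :: 'a \<Rightarrow>\<^sub>L 'b) \<in> ideal" "ideal_norm (0 :: 'a \<Rightarrow>\<^sub>L 'b) = 0"
    using zero_F norm_eq_0[OF zero_F] by (simp_all add: ideal_def ideal_norm_def)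
qed

lemma ideal_sum: "(\<And>i. i \<in> I \<Longrightarrow> x i \<in> ideal) \<Longrightarrow> sum x I \<in> ideal"
  by (induction I rule: infinite_finite_induct) (auto simp: ideal_zero ideal_add)

text \<open>
  Iterating the quasinorm inequality from the front doubles the constant at each step. The
  weights \<open>2 ^ Suc j\<close> do no harm when the summands decrease fast enough.
\<close>

lemma ideal_norm_sum:
  assumes "\<And>j. j < n \<Longrightarrow> x j \<in> ideal"
  shows "ideal_norm (\<Sum>j<n. x j) \<le> (\<Sum>j<n. 2 ^ Suc j * ideal_norm (x j))"
  using assms
proof (induction n arbitrary: x)
  case 0
  then show ?case
    by (simp add: ideal_norm_zero)
next
  case (Suc n)
  have "ideal_norm (\<Sum>j<Suc n. x j) = ideal_norm (x 0 + (\<Sum>j<n. x (Suc j)))"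
    by (simp only: sum.lessThan_Suc_shift)
  also have "\<dots> \<le> 2 * ideal_norm (x 0) + 2 * ideal_norm (\<Sum>j<n. x (Suc j))"
    by (intro ideal_add ideal_sum Suc.prems) auto
  also have "\<dots> \<le> 2 * ideal_norm (x 0) + 2 * (\<Sum>j<n. 2 ^ Suc j * ideal_norm (x (Suc j)))"
    by (intro add_left_mono mult_left_mono Suc.IH Suc.prems) auto
  also have "\<dots> = (\<Sum>j<Suc n. 2 ^ Suc j * ideal_norm (x j))"
    by (simp only: sum.lessThan_Suc_shift sum_distrib_left) (simp add: mult.assoc)
  finally show ?case .
qed

lemma ideal_finite_rank:
  assumes "rank_le d x"
  shows "x \<in> ideal" "ideal_norm x \<le> real d * norm x"
proof -
  have "\<bar>approx_number x n\<bar> \<le> norm x" for n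
    using approx_number_nonneg[of x n] approx_number_le_norm[of x n] by linarith
  then show "x \<in> ideal" "ideal_norm x \<le> real d * norm x"
    unfolding ideal_def ideal_norm_def
    using finite_support[of d "approx_number x" "norm x"] approx_number_eq_0[OF assms] by auto
qed

lemma ideal_approx_number_tendsto_0:
  assumes "x \<in> ideal" "e > 0"
  obtains n where "approx_number x n < e"
  using not_bounded_below[of "approx_number x" e] assms approx_number_nonneg[of x]
  by (auto simp: ideal_def)

text \<open>
  The norm is small if the approximation numbers are dominated by those of a fixed element of the
  ideal and the operator norm is small: truncate where the tail of the dominating sequence is small.
\<close>

lemma ideal_norm_small:
  fixes x :: "'a::real_normed_vector \<Rightarrow>\<^sub>L 'b::real_normed_vector"
  assumes x: "x \<in> ideal" and e: "e > 0"
  obtains d where "d > 0"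
    "\<And>y :: 'a \<Rightarrow>\<^sub>L 'b. (\<And>n. approx_number y n \<le> approx_number x n) \<Longrightarrow> norm y < d \<Longrightarrow> y \<in> ideal \<and> ideal_norm y < e"
proof -
  have xF: "approx_number x \<in> F"
    using x by (simp add: ideal_def)
  obtain K where K: "N (\<lambda>n. if n \<ge> K then approx_number x n else 0) < e / 2"
    using tails_tendsto_0[OF xF, of "e / 2"] e by auto
  define d where "d = e / (2 * (real K + 1))"
  have d: "d > 0"
    using e by (simp add: d_def)
  have *: "y \<in> ideal \<and> ideal_norm y < e"
    if dom: "\<And>n. approx_number y n \<le> approx_number x n" and small: "norm y < d"
    for y :: "'a \<Rightarrow>\<^sub>L 'b"
  proof -
    define g h where "g n = (if n < K then approx_number y n else 0)"
      and "h n = (if n \<ge> K then approx_number x n else 0)" for n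
    have le: "0 \<le> approx_number y n" "approx_number y n \<le> d" "0 \<le> approx_number x n" for n
      using approx_number_nonneg approx_number_le_norm[of y n] small by (auto intro: order.trans less_imp_le)
    have g: "g \<in> F" "N g \<le> real K * d"
      by (rule finite_support[of K g d]; use le(1,2) d in \<open>simp add: g_def\<close>)+
    have h: "h \<in> F"
      using restrict(1)[OF xF, of "{K..}"] unfolding h_def by simp
    have dom': "\<bar>approx_number y n\<bar> \<le> \<bar>(g + h) n\<bar>" for n
      using le(1)[of n] dom[of n] by (simp add: g_def h_def)
    have "real K * d \<le> e / 2"
      using e by (simp add: d_def field_simps)
    moreover have "N h < e / 2"
      unfolding h_def by (rule K)
    ultimately have "N (g + h) < e"
      using norm_add[OF g(1) h] g(2) by linarith
    with lattice[OF add_F[OF g(1) h], of "approx_number y", OF dom'] show ?thesis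
      unfolding ideal_def ideal_norm_def by auto
  qed
  show ?thesis
    by (rule that[OF d *])
qed

end

section \<open>Coordinate projections and adjoints\<close>

lemma summable_coord_if_lt: "summable (\<lambda>n. (cmod (if n < N then a n else 0))\<^sup>2)" for N :: nat
  by (rule summable_finite[of "{..<N}"]) auto

lemma summable_coord_if_eq: "summable (\<lambda>n. (cmod (if n = m then c else 0))\<^sup>2)" for m :: nat
  by (rule summable_finite[of "{m}"]) auto

lift_definition trunc :: "nat \<Rightarrow> ell2 \<Rightarrow> ell2" is "\<lambda>N a n. if n < N then a n else 0"
  using summable_coord_if_lt by simp

lift_definition ket :: "nat \<Rightarrow> complex \<Rightarrow> ell2" is "\<lambda>m c n. if n = m then c else 0"
  using summable_coord_if_eq by simp

lemma coord_trunc [simp]: "coord (trunc N u) n = (if n < N then coord u n else 0)"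
  by transfer simp

lemma coord_ket [simp]: "coord (ket m c) n = (if n = m then c else 0)"
  by transfer simp

lemma coord_sum: "coord (\<Sum>i\<in>I. u i) n = (\<Sum>i\<in>I. coord (u i) n)"
  by (induction I rule: infinite_finite_induct) auto

lemma inner_trunc: "trunc N u \<bullet> v = u \<bullet> trunc N v"
  unfolding inner_ell2_def by (rule arg_cong[where f = suminf]) auto

lemma trunc_trunc: "trunc M (trunc N u) = trunc (min M N) u"
  by (rule ell2_eqI) simp

lemma trunc_idem [simp]: "trunc N (trunc N u) = trunc N u"
  by (simp add: trunc_trunc)

lemma linear_trunc: "linear (trunc N)"
  by (rule linearI) (auto intro!: ell2_eqI)

lemma norm_trunc_Pythagoras: "(norm (trunc N u))\<^sup>2 + (norm (u - trunc N u))\<^sup>2 = (norm u)\<^sup>2"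
proof -
  have "trunc N u \<bullet> (u - trunc N u) = 0"
    by (simp add: inner_diff_right inner_trunc)
  then show ?thesis
    by (simp add: power2_norm_eq_inner inner_diff_left inner_diff_right inner_commute)
qed

lemma norm_trunc_le: "norm (trunc N u) \<le> norm u"
  and norm_diff_trunc_le: "norm (u - trunc N u) \<le> norm u"
  using norm_trunc_Pythagoras[of N u] by (smt (verit) power2_le_imp_le norm_ge_zero zero_le_power2)+

lemma trunc_eq_sum_ket: "trunc N u = (\<Sum>n<N. ket n (coord u n))"
proof (rule ell2_eqI)
  fix m
  have "(\<Sum>n<N. coord (ket n (coord u n)) m) = (\<Sum>n<N. if m = n then coord u m else 0)"
    by (rule sum.cong) auto
  then show "coord (trunc N u) m = coord (\<Sum>n<N. ket n (coord u n)) m"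
    by (simp add: coord_sum)
qed

lemma ket_eq: "ket n c = Re c *\<^sub>R ket n 1 + Im c *\<^sub>R ket n \<i>"
  by (rule ell2_eqI) (auto simp: complex_eq_iff)

lemma norm_ket: "norm (ket n c) = cmod c"
proof -
  have "(norm (ket n c))\<^sup>2 = (\<Sum>m. if m = n then (cmod c)\<^sup>2 else 0)"
    unfolding norm_ell2_square by (rule arg_cong[where f = suminf]) auto
  also have "\<dots> = (cmod c)\<^sup>2"
    by (subst suminf_finite[of "{n}"]) auto
  finally show ?thesis
    by simp
qed

lemma trunc_tendsto: "(\<lambda>N. trunc N u) \<longlonglongrightarrow> u"
proof -
  have sq: "(norm (trunc N u))\<^sup>2 = (\<Sum>n<N. (cmod (coord u n))\<^sup>2)" for N
  proof -
    have "(norm (trunc N u))\<^sup>2 = (\<Sum>n. if n \<in> {..<N} then (cmod (coord u n))\<^sup>2 else 0)"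
      unfolding norm_ell2_square by (rule arg_cong[where f = suminf]) auto
    also have "\<dots> = (\<Sum>n<N. (cmod (coord u n))\<^sup>2)"
      by (subst suminf_finite[of "{..<N}"]) auto
    finally show ?thesis .
  qed
  have "(\<lambda>N. \<Sum>n<N. (cmod (coord u n))\<^sup>2) \<longlonglongrightarrow> (norm u)\<^sup>2"
    unfolding norm_ell2_square by (rule summable_LIMSEQ[OF summable_coord])
  then have "(\<lambda>N. (norm u)\<^sup>2 - (norm (trunc N u))\<^sup>2) \<longlonglongrightarrow> (norm u)\<^sup>2 - (norm u)\<^sup>2"
    unfolding sq by (intro tendsto_intros)
  moreover have "(norm u)\<^sup>2 - (norm (trunc N u))\<^sup>2 = (norm (trunc N u - u))\<^sup>2" for N
    using norm_trunc_Pythagoras[of N u] by (simp add: norm_minus_commute)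
  ultimately have "(\<lambda>N. (norm (trunc N u - u))\<^sup>2) \<longlonglongrightarrow> 0"
    by simp
  then have "(\<lambda>N. sqrt ((norm (trunc N u - u))\<^sup>2)) \<longlonglongrightarrow> sqrt 0"
    by (rule tendsto_real_sqrt)
  then have "(\<lambda>N. norm (trunc N u - u)) \<longlonglongrightarrow> 0"
    by simp
  then show ?thesis
    using LIM_zero_iff tendsto_norm_zero_iff by blast
qed

definition cut :: "nat \<Rightarrow> ell2 \<Rightarrow>\<^sub>L ell2"
  where "cut N = Blinfun (trunc N)"

lemma cut_apply [simp]: "blinfun_apply (cut N) u = trunc N u"
proof -
  have "bounded_linear (trunc N)"
    using linear_trunc norm_trunc_le by (intro bounded_linear_intro[of _ 1]) (auto simp: linear_add linear_scale)
  then show ?thesis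
    by (simp add: cut_def bounded_linear_Blinfun_apply)
qed

lemma norm_cut_le: "norm (cut N) \<le> 1"
  by (rule norm_blinfun_bound) (auto simp: norm_trunc_le)

lemma rank_le_cut: "rank_le (2 * N) (cut N)"
proof (rule rank_leI)
  let ?B = "(\<lambda>n. ket n 1) ` {..<N} \<union> (\<lambda>n. ket n \<i>) ` {..<N}"
  show "card ?B \<le> 2 * N"
    using card_Un_le[of "(\<lambda>n. ket n 1) ` {..<N}" "(\<lambda>n. ket n \<i>) ` {..<N}"]
      card_image_le[of "{..<N}" "\<lambda>n. ket n 1"] card_image_le[of "{..<N}" "\<lambda>n. ket n \<i>"] by simp
  show "blinfun_apply (cut N) u \<in> span ?B" for u
    unfolding cut_apply trunc_eq_sum_ket
    by (intro span_sum, subst ket_eq) (intro span_add span_scale span_base; simp)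
qed simp

text \<open>
  The Riesz representation theorem: the coordinates of the representing vector are the values of
  the functional at the unit vectors and their multiples by \<open>\<i>\<close>. Testing the functional on the
  truncations of this vector shows that it is square-summable.
\<close>

lemma riesz:
  fixes \<phi> :: "ell2 \<Rightarrow> real"
  assumes "bounded_linear \<phi>"
  obtains v where "\<And>u. \<phi> u = u \<bullet> v"
proof -
  interpret bounded_linear \<phi> by fact
  define a where "a n = Complex (\<phi> (ket n 1)) (\<phi> (ket n \<i>))" for n
  have \<phi>_ket: "\<phi> (ket n c) = c \<bullet> a n" for n c
    by (subst ket_eq) (simp add: add scale a_def inner_complex_def)
  obtain K where K: "\<And>u. \<bar>\<phi> u\<bar> \<le> norm u * K"
    using bounded by auto
  have "(\<Sum>n<k. (cmod (a n))\<^sup>2) \<le> K\<^sup>2" for k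
  proof -
    define w where "w = (\<Sum>n<k. ket n (a n))"
    define A where "A = (\<Sum>n<k. (cmod (a n))\<^sup>2)"
    have "A \<ge> 0"
      unfolding A_def by (rule sum_nonneg) simp
    have coord_w: "coord w m = (if m < k then a m else 0)" for m
    proof -
      have "coord w m = (\<Sum>n<k. if m = n then a m else 0)"
        unfolding w_def coord_sum by (rule sum.cong) auto
      then show ?thesis
        by simp
    qed
    have "(norm w)\<^sup>2 = (\<Sum>n. if n \<in> {..<k} then (cmod (a n))\<^sup>2 else 0)"
      unfolding norm_ell2_square by (rule arg_cong[where f = suminf]) (auto simp: coord_w)
    also have "\<dots> = A"
      unfolding A_def by (subst suminf_finite[of "{..<k}"]) auto
    finally have norm_w: "norm w = sqrt A"
      using \<open>A \<ge> 0\<close> by (metis norm_ge_zero real_sqrt_unique)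
    have "\<phi> w = A"
      unfolding w_def A_def sum \<phi>_ket by (simp add: power2_norm_eq_inner)
    then have "A \<le> sqrt A * K"
      using K[of w] norm_w by simp
    then have "sqrt A * sqrt A \<le> sqrt A * K"
      using \<open>A \<ge> 0\<close> by simp
    then have "sqrt A \<le> \<bar>K\<bar>"
    proof (cases "A = 0")
      case False
      then have "sqrt A > 0"
        using \<open>A \<ge> 0\<close> by simp
      with \<open>sqrt A * sqrt A \<le> sqrt A * K\<close> have "sqrt A \<le> K"
        by (metis mult_le_cancel_left_pos)
      then show ?thesis
        by simp
    qed simp
    then have "(sqrt A)\<^sup>2 \<le> \<bar>K\<bar>\<^sup>2"
      using \<open>A \<ge> 0\<close> by (intro power_mono) auto
    then show ?thesis
      using \<open>A \<ge> 0\<close> by (simp add: A_def)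
  qed
  then have "summable (\<lambda>n. (cmod (a n))\<^sup>2)"
    by (intro summableI_nonneg_bounded[where x = "K\<^sup>2"]) auto
  then have coord: "coord (Abs_ell2 a) = a"
    by (simp add: Abs_ell2_inverse)
  have "\<phi> u = u \<bullet> Abs_ell2 a" for u
  proof (rule LIMSEQ_unique)
    show "(\<lambda>N. \<phi> (trunc N u)) \<longlonglongrightarrow> \<phi> u"
      by (rule tendsto[OF trunc_tendsto])
    have "\<phi> (trunc N u) = (\<Sum>n<N. coord u n \<bullet> coord (Abs_ell2 a) n)" for N
      unfolding trunc_eq_sum_ket sum \<phi>_ket coord ..
    then show "(\<lambda>N. \<phi> (trunc N u)) \<longlonglongrightarrow> u \<bullet> Abs_ell2 a"
      unfolding inner_ell2_def by (simp add: summable_LIMSEQ[OF summable_coord_inner])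
  qed
  then show ?thesis
    by (rule that)
qed

lemma inner_adjoint: "blinfun_apply x u \<bullet> v = u \<bullet> adjoint (blinfun_apply x) v"
  for x :: "ell2 \<Rightarrow>\<^sub>L ell2"
proof -
  have "\<exists>w. \<forall>u. blinfun_apply x u \<bullet> v = u \<bullet> w" for v
  proof -
    have "bounded_linear (\<lambda>u. blinfun_apply x u \<bullet> v)"
      by (intro bounded_linear_intros)
    then show ?thesis
      by (metis riesz)
  qed
  then obtain g where "\<forall>u v. blinfun_apply x u \<bullet> v = u \<bullet> g v"
    by metis
  then show ?thesis
    using adjoint_unique by metis
qed

definition adj :: "(ell2 \<Rightarrow>\<^sub>L ell2) \<Rightarrow> ell2 \<Rightarrow>\<^sub>L ell2"
  where "adj x = Blinfun (adjoint (blinfun_apply x))"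

lemma blinfun_apply_adj: "blinfun_apply (adj x) = adjoint (blinfun_apply x)"
proof -
  let ?g = "adjoint (blinfun_apply x)"
  have "bounded_linear ?g"
  proof (rule bounded_linear_intro[of _ "norm x"])
    show "?g (v + w) = ?g v + ?g w" for v w
      by (subst vector_eq_ldot[symmetric]) (simp add: inner_add_right flip: inner_adjoint)
    show "?g (r *\<^sub>R v) = r *\<^sub>R ?g v" for r v
      by (subst vector_eq_ldot[symmetric]) (simp flip: inner_adjoint)
    show "norm (?g v) \<le> norm v * norm x" for v
    proof (cases "?g v = 0")
      case False
      have "norm (?g v) * norm (?g v) = blinfun_apply x (?g v) \<bullet> v"
        by (simp add: inner_adjoint flip: power2_norm_eq_inner power2_eq_square)
      also have "\<dots> \<le> norm (blinfun_apply x (?g v)) * norm v"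
        by (rule norm_cauchy_schwarz)
      also have "\<dots> \<le> norm x * norm (?g v) * norm v"
        by (intro mult_right_mono norm_blinfun) simp
      finally have "norm (?g v) * norm (?g v) \<le> norm (?g v) * (norm v * norm x)"
        by (simp add: ac_simps)
      then show ?thesis
        using False by (simp add: mult_le_cancel_left)
    qed simp
  qed
  then show ?thesis
    by (simp add: adj_def bounded_linear_Blinfun_apply)
qed

lemma inner_adj: "blinfun_apply x u \<bullet> v = u \<bullet> blinfun_apply (adj x) v"
  unfolding blinfun_apply_adj by (rule inner_adjoint)

lemma inner_adj': "u \<bullet> blinfun_apply x v = blinfun_apply (adj x) u \<bullet> v"
  by (metis inner_adj inner_commute)

lemma adj_eqI: "(\<And>u v. blinfun_apply x u \<bullet> v = u \<bullet> blinfun_apply y v) \<Longrightarrow> adj x = y"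
  using adjoint_unique[of "blinfun_apply x" "blinfun_apply y"]
  by (intro blinfun_eqI) (simp add: blinfun_apply_adj)

lemma adj_adj: "adj (adj x) = x"
  by (rule adj_eqI) (metis inner_adj inner_commute)

lemma adj_add: "adj (x + y) = adj x + adj y"
  by (rule adj_eqI) (simp add: blinfun.add_left inner_add_left inner_add_right inner_adj)

lemma adj_scaleR: "adj (c *\<^sub>R x) = c *\<^sub>R adj x"
  by (rule adj_eqI) (simp add: blinfun.scaleR_left inner_adj)

lemma adj_compose: "adj (x o\<^sub>L y) = adj y o\<^sub>L adj x"
  by (rule adj_eqI) (simp add: inner_adj)

lemma adj_cut: "adj (cut N) = cut N"
  by (rule adj_eqI) (simp add: inner_trunc)

lemma norm_adj: "norm (adj x) = norm x"
proof -
  have le: "norm (adj x) \<le> norm x" for x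
  proof (rule norm_blinfun_bound)
    fix v
    let ?g = "blinfun_apply (adj x) v"
    have "norm ?g * norm ?g = blinfun_apply x ?g \<bullet> v"
      by (simp add: inner_adj flip: power2_norm_eq_inner power2_eq_square)
    also have "\<dots> \<le> norm (blinfun_apply x ?g) * norm v"
      by (rule norm_cauchy_schwarz)
    also have "\<dots> \<le> norm x * norm ?g * norm v"
      by (intro mult_right_mono norm_blinfun) simp
    finally have "norm ?g * norm ?g \<le> norm ?g * (norm x * norm v)"
      by (simp add: ac_simps)
    then show "norm ?g \<le> norm x * norm v"
      by (cases "?g = 0") (simp_all add: mult_le_cancel_left)
  qed simp
  from le[of x] le[of "adj x"] show ?thesis
    by (simp add: adj_adj)
qed

lemma norm_compose_cut_le:
  "norm (x o\<^sub>L cut N) \<le> (\<Sum>n<N. norm (blinfun_apply x (ket n 1)) + norm (blinfun_apply x (ket n \<i>)))"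
proof (rule norm_blinfun_bound)
  fix u
  have le: "norm (blinfun_apply x (ket n (coord u n)))
      \<le> (norm (blinfun_apply x (ket n 1)) + norm (blinfun_apply x (ket n \<i>))) * norm u" for n
  proof -
    have "norm (blinfun_apply x (ket n (coord u n)))
        = norm (Re (coord u n) *\<^sub>R blinfun_apply x (ket n 1) + Im (coord u n) *\<^sub>R blinfun_apply x (ket n \<i>))"
      by (subst ket_eq) (simp add: blinfun.add_right blinfun.scaleR_right)
    also have "\<dots> \<le> \<bar>Re (coord u n)\<bar> * norm (blinfun_apply x (ket n 1))
        + \<bar>Im (coord u n)\<bar> * norm (blinfun_apply x (ket n \<i>))"
      using norm_triangle_ineq[of "Re (coord u n) *\<^sub>R blinfun_apply x (ket n 1)"
          "Im (coord u n) *\<^sub>R blinfun_apply x (ket n \<i>)"] by simp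
    also have "\<dots> \<le> norm u * norm (blinfun_apply x (ket n 1)) + norm u * norm (blinfun_apply x (ket n \<i>))"
      using order.trans[OF abs_Re_le_cmod coord_le_norm] order.trans[OF abs_Im_le_cmod coord_le_norm]
      by (intro add_mono mult_right_mono) auto
    finally show ?thesis
      by (simp add: algebra_simps)
  qed
  have "norm (blinfun_apply (x o\<^sub>L cut N) u) = norm (\<Sum>n<N. blinfun_apply x (ket n (coord u n)))"
    by (simp add: trunc_eq_sum_ket blinfun.sum_right)
  also have "\<dots> \<le> (\<Sum>n<N. norm (blinfun_apply x (ket n (coord u n))))"
    by (rule norm_sum)
  also have "\<dots> \<le> (\<Sum>n<N. (norm (blinfun_apply x (ket n 1)) + norm (blinfun_apply x (ket n \<i>))) * norm u)"
    by (rule sum_mono) (rule le)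
  finally show "norm (blinfun_apply (x o\<^sub>L cut N) u)
      \<le> (\<Sum>n<N. norm (blinfun_apply x (ket n 1)) + norm (blinfun_apply x (ket n \<i>))) * norm u"
    by (simp add: sum_distrib_right)
qed (simp add: sum_nonneg)

lemma norm_cut_compose: "norm (cut N o\<^sub>L x) = norm (adj x o\<^sub>L cut N)"
  using norm_adj[of "cut N o\<^sub>L x"] by (simp add: adj_compose adj_cut)

section \<open>Orthogonal projections onto finite-dimensional subspaces\<close>

definition project :: "ell2 set \<Rightarrow> ell2 \<Rightarrow>\<^sub>L ell2"
  where "project C = Blinfun (\<lambda>u. \<Sum>c\<in>C. (u \<bullet> c / (c \<bullet> c)) *\<^sub>R c)"

lemma project_apply: "blinfun_apply (project C) u = (\<Sum>c\<in>C. (u \<bullet> c / (c \<bullet> c)) *\<^sub>R c)"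
proof -
  have "bounded_linear (\<lambda>u. \<Sum>c\<in>C. (u \<bullet> c / (c \<bullet> c)) *\<^sub>R c)"
    by (intro bounded_linear_sum bounded_linear_compose[OF bounded_linear_scaleR_left]
        bounded_linear_compose[OF bounded_linear_divide] bounded_linear_inner_left)
  then show ?thesis
    by (simp add: project_def bounded_linear_Blinfun_apply)
qed

lemma project_in_span: "blinfun_apply (project C) u \<in> span C"
  unfolding project_apply by (intro span_sum span_scale span_base)

lemma diff_project_orthogonal:
  assumes "finite C" "pairwise orthogonal C" "w \<in> span C"
  shows "(u - blinfun_apply (project C) u) \<bullet> w = 0"
  using assms(3)
proof (induction rule: span_induct_alt)
  case (step a c w)
  have "blinfun_apply (project C) u \<bullet> c = (\<Sum>d\<in>C. if d = c then u \<bullet> c else 0)"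
    unfolding project_apply inner_sum_left
    using assms(2) step.hyps by (intro sum.cong) (auto simp: pairwise_def orthogonal_def)
  also have "\<dots> = u \<bullet> c"
    using assms(1) step.hyps by simp
  finally show ?case
    using step by (simp add: inner_add_right inner_diff_left)
qed simp

lemma norm_diff_project_le:
  assumes "finite C" "pairwise orthogonal C"
  shows "norm (u - blinfun_apply (project C) u) \<le> norm u"
proof -
  let ?p = "blinfun_apply (project C) u"
  have "(u - ?p) \<bullet> ?p = 0"
    by (rule diff_project_orthogonal[OF assms project_in_span])
  then have "(norm ((u - ?p) + ?p))\<^sup>2 = (norm (u - ?p))\<^sup>2 + (norm ?p)\<^sup>2"
    by (intro norm_add_Pythagorean) (simp add: orthogonal_def)
  then have "(norm (u - ?p))\<^sup>2 \<le> (norm u)\<^sup>2"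
    by simp
  then show ?thesis
    by (rule power2_le_imp_le) simp
qed

lemma project_eq:
  assumes "finite C" "pairwise orthogonal C" "u \<in> span C"
  shows "blinfun_apply (project C) u = u"
proof -
  have "u - blinfun_apply (project C) u \<in> span C"
    by (intro span_diff assms(3) project_in_span)
  from diff_project_orthogonal[OF assms(1,2) this, of u] show ?thesis
    by simp
qed

lemma orthogonal_basis:
  fixes B :: "'a::real_inner set"
  assumes "finite B" "independent B"
  obtains C where "finite C" "pairwise orthogonal C" "0 \<notin> C" "card C = card B" "span C = span B"
proof -
  obtain D where D: "finite D" "card D \<le> card B" "span D = span B" "pairwise orthogonal D"
    using basis_orthogonal[OF assms(1)] by blast
  define C where "C = D - {0}"
  have C: "finite C" "pairwise orthogonal C" "0 \<notin> C" "card C \<le> card B" "span C = span B"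
    using D card_Diff1_le[of D 0] by (auto simp: C_def pairwise_def span_delete_0)
  moreover have "card B \<le> card C"
    using independent_span_bound[OF C(1) assms(2)] C(5) span_superset by blast
  ultimately show ?thesis
    using that by fastforce
qed

text \<open>
  An operator of finite rank is \<open>k u = (\<Sum>c\<in>C. (u \<bullet> k\<^sup>* c) / (c \<bullet> c) *\<^sub>R c)\<close>, so that truncating it
  on either side moves finitely many vectors only, \<open>c\<close> on the left and \<open>k\<^sup>* c\<close> on the right.
\<close>

lemma finite_rank_cut_tendsto:
  assumes "rank_le n k"
  shows "(\<lambda>N. norm (k - (cut N o\<^sub>L k))) \<longlonglongrightarrow> 0" "(\<lambda>N. norm (k - (k o\<^sub>L cut N))) \<longlonglongrightarrow> 0"
proof -
  obtain B where B: "finite B" "\<And>u. blinfun_apply k u \<in> span B"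
    using assms by (elim rank_leE) blast
  obtain C where C: "finite C" "span C = span B" "pairwise orthogonal C"
    using basis_orthogonal[OF B(1)] by blast
  have k: "blinfun_apply k u = (\<Sum>c\<in>C. (blinfun_apply k u \<bullet> c / (c \<bullet> c)) *\<^sub>R c)" for u
    using project_eq[OF C(1,3), of "blinfun_apply k u"] B(2) by (simp add: C(2) project_apply)
  define L where "L N = (\<Sum>c\<in>C. norm k * norm c / (c \<bullet> c) * norm (c - trunc N c))" for N
  define R where "R N = (\<Sum>c\<in>C. norm (blinfun_apply (adj k) c - trunc N (blinfun_apply (adj k) c)) / (c \<bullet> c) * norm c)" for N
  have diff: "(\<lambda>N. norm (u - trunc N u)) \<longlonglongrightarrow> 0" for u
    using tendsto_norm[OF tendsto_diff[OF tendsto_const[of u] trunc_tendsto[of u]]] by simp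
  have "L \<longlonglongrightarrow> (\<Sum>c\<in>C. norm k * norm c / (c \<bullet> c) * 0)"
    unfolding L_def by (intro tendsto_intros diff)
  then have L: "L \<longlonglongrightarrow> 0"
    by simp
  have "R \<longlonglongrightarrow> (\<Sum>c\<in>C. 0 * inverse (c \<bullet> c) * norm c)"
    unfolding R_def divide_inverse by (intro tendsto_intros diff)
  then have R: "R \<longlonglongrightarrow> 0"
    by simp
  have "norm (k - (cut N o\<^sub>L k)) \<le> L N" for N
  proof (rule norm_blinfun_bound)
    fix u
    have "blinfun_apply (k - (cut N o\<^sub>L k)) u = blinfun_apply k u - trunc N (blinfun_apply k u)"
      by (simp add: blinfun.diff_left)
    also have "\<dots> = (\<Sum>c\<in>C. (blinfun_apply k u \<bullet> c / (c \<bullet> c)) *\<^sub>R (c - trunc N c))"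
      by (subst (1 2) k) (simp add: linear_sum[OF linear_trunc] linear_scale[OF linear_trunc]
          scaleR_diff_right sum_subtractf)
    also have "norm \<dots> \<le> (\<Sum>c\<in>C. \<bar>blinfun_apply k u \<bullet> c\<bar> / (c \<bullet> c) * norm (c - trunc N c))"
      by (rule order.trans[OF norm_sum]) simp
    also have "\<dots> \<le> (\<Sum>c\<in>C. (norm k * norm u * norm c) / (c \<bullet> c) * norm (c - trunc N c))"
      by (intro sum_mono mult_right_mono divide_right_mono order.trans[OF Cauchy_Schwarz_ineq2] norm_blinfun) auto
    finally show "norm (blinfun_apply (k - (cut N o\<^sub>L k)) u) \<le> L N * norm u"
      by (simp add: L_def sum_distrib_left sum_distrib_right mult_ac)
  qed (simp add: L_def sum_nonneg)
  then show "(\<lambda>N. norm (k - (cut N o\<^sub>L k))) \<longlonglongrightarrow> 0"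
    by (intro Lim_null_comparison[OF _ L]) auto
  have "norm (k - (k o\<^sub>L cut N)) \<le> R N" for N
  proof (rule norm_blinfun_bound)
    fix u
    have eq: "blinfun_apply k (u - trunc N u) \<bullet> c
        = u \<bullet> (blinfun_apply (adj k) c - trunc N (blinfun_apply (adj k) c))" for c
      by (simp add: inner_adj inner_diff_left inner_diff_right inner_trunc)
    have "blinfun_apply (k - (k o\<^sub>L cut N)) u = blinfun_apply k (u - trunc N u)"
      by (simp add: blinfun.diff_left blinfun.diff_right)
    also have "\<dots> = (\<Sum>c\<in>C. (u \<bullet> (blinfun_apply (adj k) c - trunc N (blinfun_apply (adj k) c)) / (c \<bullet> c)) *\<^sub>R c)"
      by (subst k) (simp add: eq)
    also have "norm \<dots> \<le> (\<Sum>c\<in>C. \<bar>u \<bullet> (blinfun_apply (adj k) c - trunc N (blinfun_apply (adj k) c))\<bar> / (c \<bullet> c) * norm c)"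
      by (rule order.trans[OF norm_sum]) simp
    also have "\<dots> \<le> (\<Sum>c\<in>C. (norm u * norm (blinfun_apply (adj k) c - trunc N (blinfun_apply (adj k) c))) / (c \<bullet> c) * norm c)"
      by (intro sum_mono mult_right_mono divide_right_mono Cauchy_Schwarz_ineq2) auto
    finally show "norm (blinfun_apply (k - (k o\<^sub>L cut N)) u) \<le> R N * norm u"
      by (simp add: R_def sum_distrib_left sum_distrib_right mult_ac)
  qed (simp add: R_def sum_nonneg)
  then show "(\<lambda>N. norm (k - (k o\<^sub>L cut N))) \<longlonglongrightarrow> 0"
    by (intro Lim_null_comparison[OF _ R]) auto
qed

section \<open>Compact operators and the spectral theorem\<close>

lemma compact_operator_subset:
  assumes "compact K" "blinfun_apply x ` cball 0 1 \<subseteq> K"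
  shows "compact_operator x"
proof -
  have "closure (blinfun_apply x ` cball 0 1) \<subseteq> K"
    using assms by (intro closure_minimal compact_imp_closed)
  then show ?thesis
    unfolding compact_operator_def
    using compact_Int_closed[OF assms(1) closed_closure] by (metis inf.absorb2)
qed

lemma in_closure_image_cball:
  "norm u \<le> 1 \<Longrightarrow> blinfun_apply x u \<in> closure (blinfun_apply x ` cball 0 1)"
  by (rule subsetD[OF closure_subset]) simp

lemma compact_operator_zero: "compact_operator 0"
  by (rule compact_operator_subset[of "{0}"]) auto

lemma compact_operator_add:
  assumes "compact_operator x" "compact_operator y"
  shows "compact_operator (x + y)"
proof (rule compact_operator_subset)
  show "compact {a + b | a b. a \<in> closure (blinfun_apply x ` cball 0 1) \<and> b \<in> closure (blinfun_apply y ` cball 0 1)}"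
    using assms unfolding compact_operator_def by (rule compact_sums)
  show "blinfun_apply (x + y) ` cball 0 1 \<subseteq> {a + b | a b. a \<in> closure (blinfun_apply x ` cball 0 1) \<and> b \<in> closure (blinfun_apply y ` cball 0 1)}"
    by (auto simp: blinfun.add_left) (blast intro: in_closure_image_cball)
qed

lemma compact_operator_scaleR:
  assumes "compact_operator x"
  shows "compact_operator (c *\<^sub>R x)"
proof (rule compact_operator_subset)
  show "compact ((*\<^sub>R) c ` closure (blinfun_apply x ` cball 0 1))"
    using assms unfolding compact_operator_def by (rule compact_scaling)
  show "blinfun_apply (c *\<^sub>R x) ` cball 0 1 \<subseteq> (*\<^sub>R) c ` closure (blinfun_apply x ` cball 0 1)"
    by (auto simp: blinfun.scaleR_left intro!: in_closure_image_cball imageI)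
qed

lemma compact_operator_compose_left:
  assumes "compact_operator x"
  shows "compact_operator (y o\<^sub>L x)"
proof (rule compact_operator_subset)
  show "compact (blinfun_apply y ` closure (blinfun_apply x ` cball 0 1))"
    using assms unfolding compact_operator_def
    by (intro compact_continuous_image) (auto intro!: continuous_intros)
  show "blinfun_apply (y o\<^sub>L x) ` cball 0 1 \<subseteq> blinfun_apply y ` closure (blinfun_apply x ` cball 0 1)"
    by (auto intro!: in_closure_image_cball imageI)
qed

lemma compact_operator_compose_contraction:
  assumes "compact_operator x" "norm y \<le> 1"
  shows "compact_operator (x o\<^sub>L y)"
proof (rule compact_operator_subset)
  show "compact (closure (blinfun_apply x ` cball 0 1))"
    using assms unfolding compact_operator_def by simp
  have "norm (blinfun_apply y u) \<le> 1" if "norm u \<le> 1" for u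
    using order.trans[OF norm_blinfun[of y u]] mult_mono[OF assms(2), of "norm u" 1] that by simp
  then show "blinfun_apply (x o\<^sub>L y) ` cball 0 1 \<subseteq> closure (blinfun_apply x ` cball 0 1)"
    by (auto intro!: in_closure_image_cball)
qed

lemma compact_operator_sum:
  "(\<And>i. i \<in> I \<Longrightarrow> compact_operator (x i)) \<Longrightarrow> compact_operator (sum x I)"
  by (induction I rule: infinite_finite_induct) (auto simp: compact_operator_zero compact_operator_add)

lemma compact_operator_limit:
  assumes "\<And>e. e > 0 \<Longrightarrow> \<exists>k. compact_operator k \<and> norm (x - k) < e"
  shows "compact_operator x"
  unfolding compact_operator_def compact_eq_totally_bounded
proof (intro conjI allI impI)
  show "complete (closure (blinfun_apply x ` cball 0 1))"
    by (simp add: complete_eq_closed)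
  fix e :: real assume "e > 0"
  then obtain k where k: "compact_operator k" "norm (x - k) < e / 3"
    using assms[of "e / 3"] by auto
  obtain K where K: "finite K" "closure (blinfun_apply k ` cball 0 1) \<subseteq> (\<Union>w\<in>K. ball w (e / 3))"
    using k(1) \<open>e > 0\<close> unfolding compact_operator_def compact_eq_totally_bounded
    by (meson divide_pos_pos zero_less_numeral)
  have "blinfun_apply x u \<in> (\<Union>w\<in>K. cball w (2 * e / 3))" if u: "norm u \<le> 1" for u
  proof -
    have "blinfun_apply k u \<in> closure (blinfun_apply k ` cball 0 1)"
      using u by (rule in_closure_image_cball)
    then obtain w where w: "w \<in> K" "dist w (blinfun_apply k u) < e / 3"
      using K(2) by auto
    have "dist (blinfun_apply k u) (blinfun_apply x u) \<le> norm (x - k) * norm u"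
      using norm_blinfun[of "x - k" u] by (simp add: dist_norm norm_minus_commute blinfun.diff_left)
    also have "\<dots> \<le> norm (x - k)"
      using u by (simp add: mult_left_le)
    finally have "dist w (blinfun_apply x u) \<le> 2 * e / 3"
      using w(2) k(2) dist_triangle[of w "blinfun_apply x u" "blinfun_apply k u"] by linarith
    then show ?thesis
      using w(1) by auto
  qed
  then have "blinfun_apply x ` cball 0 1 \<subseteq> (\<Union>w\<in>K. cball w (2 * e / 3))"
    by auto
  then have "closure (blinfun_apply x ` cball 0 1) \<subseteq> (\<Union>w\<in>K. cball w (2 * e / 3))"
    using K(1) by (intro closure_minimal closed_UN) auto
  also have "\<dots> \<subseteq> (\<Union>w\<in>K. ball w e)"
    using \<open>e > 0\<close> by fastforce
  finally show "\<exists>K. finite K \<and> closure (blinfun_apply x ` cball 0 1) \<subseteq> (\<Union>w\<in>K. ball w e)"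
    using K(1) by blast
qed

lemma singular_space_iff: "u \<in> singular_space x t \<longleftrightarrow> blinfun_apply (adj x) (blinfun_apply x u) = t\<^sup>2 *\<^sub>R u"
  by (simp add: singular_space_def blinfun_apply_adj)

lemma singular_space_inner:
  assumes "u \<in> singular_space x t"
  shows "blinfun_apply x u \<bullet> blinfun_apply x v = t\<^sup>2 * (u \<bullet> v)"
  using assms by (simp add: inner_adj' singular_space_iff)

definition upper_space :: "(ell2 \<Rightarrow>\<^sub>L ell2) \<Rightarrow> real \<Rightarrow> ell2 set"
  where "upper_space x s = (\<Union>t\<in>{s<..}. singular_space x t)"

text \<open>Eigenvectors for different eigenvalues are orthogonal, and so are their images.\<close>

lemma norm_ge_on_upper_space:
  assumes s: "0 \<le> s" and u: "u \<in> span (upper_space x s)"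
  shows "s * norm u \<le> norm (blinfun_apply x u)"
proof -
  have "\<exists>T f. finite T \<and> T \<subseteq> {s<..} \<and> (\<forall>t\<in>T. f t \<in> singular_space x t) \<and> u = sum f T"
    using u
  proof (induction rule: span_induct_alt)
    case base
    show ?case
      by (rule exI[of _ "{}"]) simp
  next
    case (step c v w)
    obtain t0 where t0: "t0 > s" "v \<in> singular_space x t0"
      using step.hyps by (auto simp: upper_space_def)
    obtain T f where T: "finite T" "T \<subseteq> {s<..}" "\<forall>t\<in>T. f t \<in> singular_space x t" "w = sum f T"
      using step.IH by blast
    define g where "g t = (if t = t0 then c *\<^sub>R v else 0) + (if t \<in> T then f t else 0)" for t
    have "sum g (insert t0 T) = c *\<^sub>R v + w"
      using T(1) by (simp add: g_def sum.distrib T(4) sum.If_cases Int_absorb1 subset_insertI)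
    moreover have "\<forall>t\<in>insert t0 T. g t \<in> singular_space x t"
      using T(3) t0(2) by (auto simp: g_def singular_space_iff blinfun.add_right blinfun.scaleR_right
          scaleR_add_right)
    ultimately show ?case
      using T(1,2) t0(1) by (intro exI[of _ "insert t0 T"] exI[of _ g]) auto
  qed
  then obtain T f where T: "finite T" "T \<subseteq> {s<..}" "\<And>t. t \<in> T \<Longrightarrow> f t \<in> singular_space x t" "u = sum f T"
    by blast
  have orth: "f t \<bullet> f t' = 0" if "t \<in> T" "t' \<in> T" "t \<noteq> t'" for t t'
  proof -
    have "t\<^sup>2 * (f t \<bullet> f t') = t'\<^sup>2 * (f t \<bullet> f t')"
      using singular_space_inner[OF T(3)[OF that(1)], of "f t'"]
        singular_space_inner[OF T(3)[OF that(2)], of "f t"] by (metis inner_commute)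
    moreover have "0 \<le> t" "0 \<le> t'"
      using that T(2) s by force+
    then have "t\<^sup>2 \<noteq> t'\<^sup>2"
      using that(3) by (simp add: power2_eq_iff_nonneg)
    ultimately show ?thesis
      by simp
  qed
  have u2: "(norm u)\<^sup>2 = (\<Sum>t\<in>T. (norm (f t))\<^sup>2)"
    unfolding T(4) using orth by (intro norm_sum_Pythagorean[OF T(1)]) (auto simp: pairwise_def orthogonal_def)
  have "(norm (blinfun_apply x u))\<^sup>2 = (\<Sum>t\<in>T. (norm (blinfun_apply x (f t)))\<^sup>2)"
    unfolding T(4) blinfun.sum_right using orth
    by (intro norm_sum_Pythagorean[OF T(1)]) (auto simp: pairwise_def orthogonal_def singular_space_inner[OF T(3)])
  also have "\<dots> = (\<Sum>t\<in>T. t\<^sup>2 * (norm (f t))\<^sup>2)"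
    by (rule sum.cong) (simp_all add: power2_norm_eq_inner singular_space_inner[OF T(3)])
  also have "\<dots> \<ge> (\<Sum>t\<in>T. s\<^sup>2 * (norm (f t))\<^sup>2)"
    using T(2) s by (intro sum_mono mult_right_mono power_mono) auto
  finally have "(s * norm u)\<^sup>2 \<le> (norm (blinfun_apply x u))\<^sup>2"
    by (simp add: u2 power_mult_distrib sum_distrib_left)
  then show ?thesis
    by (rule power2_le_imp_le) simp
qed

text \<open>
  The variational half of the spectral theorem. Let \<open>T\<close> be the supremum of \<open>norm (x v)\<close> over unit
  vectors \<open>v\<close> of an \<open>x\<^sup>*x\<close>-invariant closed subspace \<open>W\<close>. Along a maximizing sequence
  \<open>x\<^sup>*x v - T\<^sup>2 v \<longlongrightarrow> 0\<close>, and by compactness \<open>x\<^sup>*x v\<close> converges along a subsequence. If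
  \<open>T > 0\<close>, then \<open>v\<close> itself converges along it, to an eigenvector of \<open>x\<^sup>*x\<close> for the eigenvalue \<open>T\<^sup>2\<close>.
\<close>

lemma exists_singular_vector:
  assumes x: "compact_operator x" and s: "0 \<le> s"
    and W: "subspace W" "closed W" "\<And>v. v \<in> W \<Longrightarrow> blinfun_apply (adj x) (blinfun_apply x v) \<in> W"
    and v0: "v0 \<in> W" "s * norm v0 < norm (blinfun_apply x v0)"
  obtains t u where "t > s" "u \<in> W" "u \<noteq> 0" "u \<in> singular_space x t"
proof -
  let ?A = "\<lambda>v. blinfun_apply (adj x) (blinfun_apply x v)"
  define Q where "Q = (\<lambda>v. norm (blinfun_apply x v)) ` (W \<inter> cball 0 1)"
  define T where "T = Sup Q"
  have bdd: "bdd_above Q"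
  proof (rule bdd_aboveI)
    fix q assume "q \<in> Q"
    then obtain v where "norm v \<le> 1" "q = norm (blinfun_apply x v)"
      by (auto simp: Q_def)
    then show "q \<le> norm x"
      using norm_blinfun[of x v] mult_left_le[of "norm v" "norm x"] by simp
  qed
  have T_unit: "norm (blinfun_apply x v) \<le> T" if "v \<in> W" "norm v \<le> 1" for v
    unfolding T_def using that by (intro cSup_upper[OF _ bdd]) (auto simp: Q_def)
  have T_le: "norm (blinfun_apply x v) \<le> T * norm v" if "v \<in> W" for v
  proof (cases "v = 0")
    case False
    have "norm (blinfun_apply x (v /\<^sub>R norm v)) \<le> T"
      using that False by (intro T_unit subspace_scale[OF W(1)]) auto
    then show ?thesis
      using False by (simp add: blinfun.scaleR_right field_simps)
  qed simp
  have v0_nz: "v0 \<noteq> 0"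
    using v0(2) by auto
  have "T > s"
    using T_le[OF v0(1)] v0(2) v0_nz by (smt (verit) mult_right_less_imp_less norm_ge_zero)
  then have "T > 0"
    using s by simp
  have "Q \<noteq> {}"
    using subspace_0[OF W(1)] by (auto simp: Q_def)
  have "\<exists>v\<in>W. norm v \<le> 1 \<and> T - 1 / real (Suc n) < norm (blinfun_apply x v)" for n
  proof -
    have "\<exists>q\<in>Q. T - 1 / real (Suc n) < q"
      unfolding less_cSup_iff[OF \<open>Q \<noteq> {}\<close> bdd, symmetric] T_def[symmetric] by simp
    then show ?thesis
      by (auto simp: Q_def)
  qed
  then obtain v where v: "\<And>n. v n \<in> W" "\<And>n. norm (v n) \<le> 1"
    "\<And>n. T - 1 / real (Suc n) < norm (blinfun_apply x (v n))"
    by metis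
  have norm_xv: "(\<lambda>n. norm (blinfun_apply x (v n))) \<longlonglongrightarrow> T"
  proof (rule tendsto_sandwich)
    show "(\<lambda>n. T - 1 / real (Suc n)) \<longlonglongrightarrow> T"
      using tendsto_diff[OF tendsto_const[of T] LIMSEQ_inverse_real_of_nat] by (simp add: inverse_eq_divide)
    show "(\<lambda>n. T) \<longlonglongrightarrow> T"
      by simp
  qed (use v(3) T_unit[OF v(1,2)] in \<open>auto intro!: always_eventually less_imp_le\<close>)
  have defect: "(\<lambda>n. ?A (v n) - T\<^sup>2 *\<^sub>R v n) \<longlonglongrightarrow> 0"
  proof -
    have "(norm (?A (v n) - T\<^sup>2 *\<^sub>R v n))\<^sup>2 \<le> T\<^sup>2 * (T\<^sup>2 - (norm (blinfun_apply x (v n)))\<^sup>2)" for n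
    proof -
      let ?v = "v n"
      have "norm (?A ?v) * norm (?A ?v) = blinfun_apply x (?A ?v) \<bullet> blinfun_apply x ?v"
        by (simp add: inner_adj flip: power2_norm_eq_inner power2_eq_square)
      also have "\<dots> \<le> norm (blinfun_apply x (?A ?v)) * norm (blinfun_apply x ?v)"
        by (rule norm_cauchy_schwarz)
      also have "\<dots> \<le> T * norm (?A ?v) * norm (blinfun_apply x ?v)"
        by (intro mult_right_mono T_le W(3) v(1)) simp
      finally have "norm (?A ?v) * norm (?A ?v) \<le> norm (?A ?v) * (T * norm (blinfun_apply x ?v))"
        by (simp add: ac_simps)
      then have "norm (?A ?v) \<le> T * norm (blinfun_apply x ?v)"
        using \<open>T > 0\<close> by (cases "?A ?v = 0") (simp_all add: mult_le_cancel_left)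
      then have 1: "(norm (?A ?v))\<^sup>2 \<le> T\<^sup>2 * (norm (blinfun_apply x ?v))\<^sup>2"
        by (metis norm_ge_zero power_mono power_mult_distrib)
      have 2: "?A ?v \<bullet> ?v = (norm (blinfun_apply x ?v))\<^sup>2"
        by (simp add: power2_norm_eq_inner flip: inner_adj')
      have "(norm (?A ?v - T\<^sup>2 *\<^sub>R ?v))\<^sup>2
          = (norm (?A ?v))\<^sup>2 - 2 * T\<^sup>2 * (?A ?v \<bullet> ?v) + T\<^sup>2 * T\<^sup>2 * (norm ?v)\<^sup>2"
        by (simp add: power2_norm_eq_inner inner_diff_left inner_diff_right inner_commute algebra_simps)
      also have "\<dots> \<le> T\<^sup>2 * (norm (blinfun_apply x ?v))\<^sup>2 - 2 * T\<^sup>2 * (norm (blinfun_apply x ?v))\<^sup>2 + T\<^sup>2 * T\<^sup>2 * 1"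
        unfolding 2 using v(2)[of n] by (intro add_mono diff_mono mult_left_mono 1) (auto simp: power_le_one)
      finally show ?thesis
        by (simp add: algebra_simps)
    qed
    then have le: "\<forall>\<^sub>F n in sequentially. (norm (?A (v n) - T\<^sup>2 *\<^sub>R v n))\<^sup>2
        \<le> T\<^sup>2 * (T\<^sup>2 - (norm (blinfun_apply x (v n)))\<^sup>2)"
      by (rule always_eventually[OF allI])
    have "(\<lambda>n. T\<^sup>2 * (T\<^sup>2 - (norm (blinfun_apply x (v n)))\<^sup>2)) \<longlonglongrightarrow> T\<^sup>2 * (T\<^sup>2 - T\<^sup>2)"
      by (intro tendsto_intros norm_xv)
    then have "(\<lambda>n. T\<^sup>2 * (T\<^sup>2 - (norm (blinfun_apply x (v n)))\<^sup>2)) \<longlonglongrightarrow> 0"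
      by simp
    from tendsto_sandwich[OF _ le tendsto_const this]
    have "(\<lambda>n. (norm (?A (v n) - T\<^sup>2 *\<^sub>R v n))\<^sup>2) \<longlonglongrightarrow> 0"
      by simp
    then have "(\<lambda>n. sqrt ((norm (?A (v n) - T\<^sup>2 *\<^sub>R v n))\<^sup>2)) \<longlonglongrightarrow> sqrt 0"
      by (rule tendsto_real_sqrt)
    then show ?thesis
      by (simp add: tendsto_norm_zero_iff)
  qed
  have "\<forall>n. blinfun_apply x (v n) \<in> closure (blinfun_apply x ` cball 0 1)"
    using in_closure_image_cball[OF v(2)] by blast
  then obtain r w where r: "strict_mono r" "((\<lambda>n. blinfun_apply x (v n)) \<circ> r) \<longlonglongrightarrow> w"
    using x unfolding compact_operator_def compact_def by meson
  define u where "u = blinfun_apply (adj x) w /\<^sub>R T\<^sup>2"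
  have vu: "(\<lambda>n. v (r n)) \<longlonglongrightarrow> u"
  proof -
    have "(\<lambda>n. (?A (v (r n)) - (?A (v (r n)) - T\<^sup>2 *\<^sub>R v (r n))) /\<^sub>R T\<^sup>2) \<longlonglongrightarrow> (blinfun_apply (adj x) w - 0) /\<^sub>R T\<^sup>2"
      using r(2) LIMSEQ_subseq_LIMSEQ[OF defect r(1)] by (intro tendsto_intros) (simp_all add: o_def)
    then show ?thesis
      using \<open>T > 0\<close> by (simp add: u_def)
  qed
  have "u \<in> W"
    using closed_sequentially[OF W(2) _ vu] v(1) by blast
  moreover have "norm (blinfun_apply x u) = T"
  proof (rule LIMSEQ_unique)
    show "(\<lambda>n. norm (blinfun_apply x (v (r n)))) \<longlonglongrightarrow> norm (blinfun_apply x u)"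
      by (intro tendsto_intros vu)
    show "(\<lambda>n. norm (blinfun_apply x (v (r n)))) \<longlonglongrightarrow> T"
      using LIMSEQ_subseq_LIMSEQ[OF norm_xv r(1)] by (simp add: o_def)
  qed
  then have "u \<noteq> 0"
    using \<open>T > 0\<close> by auto
  moreover have "?A u - T\<^sup>2 *\<^sub>R u = 0"
  proof (rule LIMSEQ_unique)
    show "(\<lambda>n. ?A (v (r n)) - T\<^sup>2 *\<^sub>R v (r n)) \<longlonglongrightarrow> ?A u - T\<^sup>2 *\<^sub>R u"
      by (intro tendsto_intros vu)
    show "(\<lambda>n. ?A (v (r n)) - T\<^sup>2 *\<^sub>R v (r n)) \<longlonglongrightarrow> 0"
      using LIMSEQ_subseq_LIMSEQ[OF defect r(1)] by (simp add: o_def)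
  qed
  then have "u \<in> singular_space x T"
    by (simp add: singular_space_iff)
  ultimately show ?thesis
    using that \<open>T > s\<close> by blast
qed

lemma upper_space_basis:
  obtains B where "B \<subseteq> upper_space x s" "independent B" "upper_space x s \<subseteq> span B"
  using maximal_independent_subset by blast

lemma approx_number_le_of_upper_space:
  assumes x: "compact_operator x" and s: "0 \<le> s"
    and B: "finite B" "upper_space x s \<subseteq> span B"
  shows "approx_number x (card B) \<le> s"
proof -
  obtain B1 where B1: "B1 \<subseteq> upper_space x s" "independent B1" "upper_space x s \<subseteq> span B1"
    by (rule upper_space_basis)
  have B1_card: "finite B1" "card B1 \<le> card B"
    using independent_span_bound[OF B(1) B1(2)] B1(1) B(2) by auto
  obtain C where C: "finite C" "card C \<le> card B1" "span C = span B1" "pairwise orthogonal C"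
    using basis_orthogonal[OF B1_card(1)] by blast
  have upper_C: "upper_space x s \<subseteq> span C"
    using B1(3) C(3) by simp
  let ?A = "\<lambda>v. blinfun_apply (adj x) (blinfun_apply x v)"
  have A_C: "?A u \<in> span C" if "u \<in> span C" for u
    using that unfolding C(3)
  proof (induction rule: span_induct_alt)
    case (step c v w)
    then obtain t where "v \<in> singular_space x t"
      using B1(1) by (auto simp: upper_space_def)
    moreover have "v \<in> span B1"
      using step.hyps by (rule span_base)
    ultimately show ?case
      using step.IH by (simp add: blinfun.add_right blinfun.scaleR_right singular_space_iff span_add span_scale)
  qed (simp add: span_0)
  define W where "W = {v. \<forall>g\<in>span C. v \<bullet> g = 0}"
  have W: "subspace W" "closed W"
  proof -
    show "subspace W"
      by (rule subspaceI) (simp_all only: W_def mem_Collect_eq inner_add_left inner_scaleR_left inner_zero_left, simp_all)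
    have "W = (\<Inter>g\<in>span C. {v. v \<bullet> g = 0})"
      by (auto simp: W_def)
    moreover have "closed {v. v \<bullet> g = 0}" for g :: ell2
      by (intro closed_Collect_eq continuous_intros)
    ultimately show "closed W"
      by (simp add: closed_INT)
  qed
  have A_W: "?A v \<in> W" if "v \<in> W" for v
  proof -
    have "?A v \<bullet> g = v \<bullet> ?A g" for g
      by (metis inner_adj inner_adj')
    then show ?thesis
      using that A_C by (auto simp: W_def)
  qed
  have bound: "norm (blinfun_apply x v) \<le> s * norm v" if v: "v \<in> W" for v
  proof (rule ccontr)
    assume "\<not> ?thesis"
    then have less: "s * norm v < norm (blinfun_apply x v)"
      by simp
    obtain t u where u: "t > s" "u \<in> W" "u \<noteq> 0" "u \<in> singular_space x t"
      by (rule exists_singular_vector[OF x s W A_W v less])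
    then have "u \<in> span C"
      using upper_C by (auto simp: upper_space_def)
    then have "u \<bullet> u = 0"
      using u(2) by (auto simp: W_def)
    then show False
      using u(3) by simp
  qed
  have "norm (x - (x o\<^sub>L project C)) \<le> s"
  proof (rule norm_blinfun_bound[OF s])
    fix u
    let ?w = "u - blinfun_apply (project C) u"
    have "?w \<in> W"
      using diff_project_orthogonal[OF C(1,4)] by (auto simp: W_def)
    have "norm (blinfun_apply (x - (x o\<^sub>L project C)) u) = norm (blinfun_apply x ?w)"
      by (simp add: blinfun.diff_left blinfun.diff_right)
    also have "\<dots> \<le> s * norm ?w"
      by (rule bound[OF \<open>?w \<in> W\<close>])
    also have "\<dots> \<le> s * norm u"
      by (intro mult_left_mono norm_diff_project_le C(1,4) s)
    finally show "norm (blinfun_apply (x - (x o\<^sub>L project C)) u) \<le> s * norm u" .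
  qed
  moreover have "rank_le (card B) (x o\<^sub>L project C)"
    using C(1,2) B1_card(2) by (intro rank_le_compose_left rank_leI[of C]) (auto intro: project_in_span)
  ultimately show ?thesis
    using approx_number_le order.trans by blast
qed

text \<open>
  The Bernstein numbers of a compact operator equal its approximation numbers: if the span of the
  eigenvectors for eigenvalues above \<open>s\<close> has dimension at most \<open>n\<close>, then projecting it away
  approximates \<open>x\<close> up to \<open>s\<close>, and otherwise \<open>x\<close> is bounded below by \<open>s\<close> on that span.
\<close>

lemma upper_space_dichotomy:
  assumes x: "compact_operator x" and s: "0 \<le> s"
  obtains B where "finite B" "card B \<le> n" "upper_space x s \<subseteq> span B" "B \<subseteq> upper_space x s"
  | B where "finite B" "independent B" "card B = Suc n" "B \<subseteq> upper_space x s"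
proof -
  obtain B where B: "B \<subseteq> upper_space x s" "independent B" "upper_space x s \<subseteq> span B"
    by (rule upper_space_basis)
  show ?thesis
  proof (cases "finite B \<and> card B \<le> n")
    case True
    then show ?thesis
      using B that(1) by blast
  next
    case False
    then obtain D where "finite D" "card D = Suc n" "D \<subseteq> B"
      by (metis infinite_arbitrarily_large not_less_eq_eq obtain_subset_with_card_n)
    then show ?thesis
      using B that(2) independent_mono by blast
  qed
qed

text \<open>In other words, \<open>s\<close> is at most the \<open>n\<close>-th Bernstein number of \<open>x\<close>, counted from 1.\<close>

definition bernstein :: "(ell2 \<Rightarrow>\<^sub>L ell2) \<Rightarrow> real \<Rightarrow> nat \<Rightarrow> bool"
  where "bernstein x s n \<longleftrightarrow> (\<exists>B. finite B \<and> independent B \<and> card B = n \<and>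
    (\<forall>u\<in>span B. s * norm u \<le> norm (blinfun_apply x u)))"

lemma bernstein_0: "bernstein x s 0"
  unfolding bernstein_def by (rule exI[of _ "{}"]) (auto simp: independent_empty)

lemma approx_number_ge_bernstein: "bernstein x s (Suc n) \<Longrightarrow> s \<le> approx_number x n"
  unfolding bernstein_def using approx_number_ge by (metis lessI)

lemma bernstein_of_approx_number:
  assumes "compact_operator x" "0 \<le> s" "s < approx_number x n"
  shows "bernstein x s (Suc n)"
proof (rule upper_space_dichotomy[OF assms(1,2)])
  fix B assume "finite B" "card B \<le> n" "upper_space x s \<subseteq> span B"
  then have "approx_number x n \<le> s"
    using approx_number_le_of_upper_space[OF assms(1,2)] approx_number_antimono order.trans by blast
  then show ?thesis
    using assms(3) by simp
next
  fix B assume B: "finite B" "independent B" "card B = Suc n" "B \<subseteq> upper_space x s"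
  have "\<forall>u\<in>span B. s * norm u \<le> norm (blinfun_apply x u)"
    using norm_ge_on_upper_space[OF assms(2)] span_mono[OF B(4)] by blast
  with B(1-3) show ?thesis
    unfolding bernstein_def by blast
qed

section \<open>Singular values and approximation numbers\<close>

lemma complex_linear_zero: "complex_linear 0"
  by (auto simp: complex_linear_def intro!: ell2_eqI)

lemma essential_norm_nonneg: "0 \<le> essential_norm x"
  unfolding essential_norm_def
  by (rule cInf_greatest) (use complex_linear_zero compact_operator_zero in \<open>blast, force\<close>)

lemma essential_norm_le_norm: "essential_norm x \<le> norm x"
  unfolding essential_norm_def
proof (rule cInf_lower)
  show "norm x \<in> {norm (x - k) | k. complex_linear k \<and> compact_operator k}"
    using complex_linear_zero compact_operator_zero by (intro CollectI exI[of _ 0]) simp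
qed (rule bdd_belowI[of _ 0], force)

lemma compact_if_essential_norm_0:
  assumes "essential_norm x = 0"
  shows "compact_operator x"
proof (rule compact_operator_limit)
  fix e :: real assume "e > 0"
  have "{norm (x - k) | k. complex_linear k \<and> compact_operator k} \<noteq> {}"
    using complex_linear_zero compact_operator_zero by blast
  from cInf_lessD[OF this, of e] show "\<exists>k. compact_operator k \<and> norm (x - k) < e"
    using assms \<open>e > 0\<close> unfolding essential_norm_def by auto
qed

lemma cspan_subset_span: "cspan B \<subseteq> span (B \<union> (*\<^sub>C) \<i> ` B)"
proof
  fix u assume "u \<in> cspan B"
  then show "u \<in> span (B \<union> (*\<^sub>C) \<i> ` B)"
  proof (induction rule: complex.span_induct_alt)
    case (step c v w)
    have "c *\<^sub>C v = Re c *\<^sub>R v + Im c *\<^sub>R (\<i> *\<^sub>C v)"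
      by (rule ell2_eqI) (simp add: complex_eq_iff)
    moreover have "v \<in> span (B \<union> (*\<^sub>C) \<i> ` B)" "\<i> *\<^sub>C v \<in> span (B \<union> (*\<^sub>C) \<i> ` B)"
      using step.hyps by (auto intro: span_base)
    ultimately show ?case
      using step.IH by (simp add: span_add span_scale)
  qed (rule span_0)
qed

lemma span_subset_cspan: "span B \<subseteq> cspan B"
proof (rule span_minimal)
  show "subspace (cspan B)"
    unfolding subspace_def scaleR_ell2_def
    by (auto intro: complex.span_zero complex.span_add complex.span_scale)
qed (rule complex.span_superset)

text \<open>
  Multiplicities count complex dimensions, and \<^const>\<open>approx_number\<close> counts real ones. This is the
  reason for the factor 2, which is harmless because of the dilation bound in \<open>F\<close>.
\<close>

lemma essential_norm_le_singular_value: "essential_norm x \<le> singular_value x n"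
  and approx_number_le_singular_value:
    "essential_norm x = 0 \<Longrightarrow> approx_number x (2 * n) \<le> singular_value x n"
  and singular_value_le_approx_number:
    "essential_norm x = 0 \<Longrightarrow> singular_value x n \<le> approx_number x n"
proof -
  define S where "S = {s. essential_norm x \<le> s \<and>
    (\<exists>B. finite B \<and> card B \<le> n \<and> (\<forall>t>s. singular_space x t \<subseteq> cspan B))}"
  have sv: "singular_value x n = Inf S"
    by (simp add: singular_value_def S_def)
  have "singular_space x t \<subseteq> cspan {}" if "t > norm x" for t
  proof
    fix u assume u: "u \<in> singular_space x t"
    have "t\<^sup>2 * (norm u)\<^sup>2 = (norm (blinfun_apply x u))\<^sup>2"
      using singular_space_inner[OF u, of u] by (simp add: power2_norm_eq_inner)
    then have "(t * norm u)\<^sup>2 \<le> (norm x * norm u)\<^sup>2"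
      unfolding power_mult_distrib[of t] by (simp add: norm_blinfun power_mono)
    then have "t * norm u \<le> norm x * norm u"
      by (rule power2_le_imp_le) simp
    then have "u = 0"
      using that by (metis mult_le_cancel_right norm_le_zero_iff not_less)
    then show "u \<in> cspan {}"
      by simp
  qed
  then have "norm x \<in> S"
    unfolding S_def using essential_norm_le_norm
    by (intro CollectI conjI exI[of _ "{}"] allI impI) simp_all
  then have "S \<noteq> {}"
    by blast
  have bdd: "bdd_below S"
    by (rule bdd_belowI[of _ "essential_norm x"]) (simp add: S_def)
  show "essential_norm x \<le> singular_value x n"
    unfolding sv by (rule cInf_greatest[OF \<open>S \<noteq> {}\<close>]) (simp add: S_def)
  assume ess: "essential_norm x = 0"
  note compact = compact_if_essential_norm_0[OF ess]
  show "approx_number x (2 * n) \<le> singular_value x n"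
    unfolding sv
  proof (rule cInf_greatest[OF \<open>S \<noteq> {}\<close>])
    fix s assume "s \<in> S"
    then obtain B where s: "0 \<le> s" and B: "finite B" "card B \<le> n" "\<And>t. t > s \<Longrightarrow> singular_space x t \<subseteq> cspan B"
      by (auto simp: S_def ess)
    let ?B = "B \<union> (*\<^sub>C) \<i> ` B"
    have "upper_space x s \<subseteq> span ?B"
      using B(3) cspan_subset_span by (fastforce simp: upper_space_def)
    then have "approx_number x (card ?B) \<le> s"
      using B(1) by (intro approx_number_le_of_upper_space compact s) auto
    moreover have "card ?B \<le> 2 * n"
      using card_Un_le[of B "(*\<^sub>C) \<i> ` B"] card_image_le[OF B(1), of "(*\<^sub>C) \<i>"] B(2) by linarith
    ultimately show "approx_number x (2 * n) \<le> s"
      using approx_number_antimono order.trans by blast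
  qed
  show "singular_value x n \<le> approx_number x n"
  proof (rule field_le_epsilon)
    fix e :: real assume "e > 0"
    define s where "s = approx_number x n + e"
    have s: "0 \<le> s" "approx_number x n < s"
      using approx_number_nonneg[of x n] \<open>e > 0\<close> by (auto simp: s_def)
    have "s \<in> S"
    proof (rule upper_space_dichotomy[OF compact s(1), of n])
      fix B assume B: "finite B" "card B \<le> n" "upper_space x s \<subseteq> span B"
      have "singular_space x t \<subseteq> cspan B" if "t > s" for t
        using that B(3) span_subset_cspan by (fastforce simp: upper_space_def)
      then show ?thesis
        using B(1,2) s(1) by (auto simp: S_def ess)
    next
      fix B assume B: "finite B" "independent B" "card B = Suc n" "B \<subseteq> upper_space x s"
      have "s \<le> approx_number x n"
        using norm_ge_on_upper_space[OF s(1)] span_mono[OF B(4)] B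
        by (intro approx_number_ge_bernstein) (auto simp: bernstein_def)
      then show ?thesis
        using s(2) by simp
    qed
    then show "singular_value x n \<le> approx_number x n + e"
      unfolding sv s_def by (intro cInf_lower bdd)
  qed
qed

context separable_seq_space
begin

lemma operator_space_compact:
  assumes "x \<in> operator_space F"
  shows "essential_norm x = 0" "compact_operator x"
proof -
  show "essential_norm x = 0"
  proof (rule ccontr)
    assume "essential_norm x \<noteq> 0"
    then have "essential_norm x > 0"
      using essential_norm_nonneg[of x] by simp
    moreover have "singular_value x \<in> F"
      using assms by (simp add: operator_space_def)
    ultimately obtain n where "\<bar>singular_value x n\<bar> < essential_norm x"
      using not_bounded_below[of "singular_value x" "essential_norm x"] by blast
    then show False
      using essential_norm_le_singular_value[of x n] by linarith
  qed
  then show "compact_operator x"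
    by (rule compact_if_essential_norm_0)
qed

lemma operator_space_ideal:
  assumes "x \<in> operator_space F"
  shows "x \<in> ideal" "operator_space_norm N x \<le> ideal_norm x"
    "ideal_norm x \<le> 2 * operator_space_norm N x"
proof -
  note ess = operator_space_compact(1)[OF assms]
  have sv: "singular_value x \<in> F"
    using assms by (simp add: operator_space_def)
  have nonneg: "0 \<le> singular_value x n" for n
    using essential_norm_le_singular_value[of x n] ess by simp
  have "\<bar>approx_number x n\<bar> \<le> \<bar>singular_value x (n div 2)\<bar>" for n
    using approx_number_antimono[of "2 * (n div 2)" n x] approx_number_le_singular_value[OF ess, of "n div 2"]
      approx_number_nonneg[of x n] by linarith
  from lattice[OF dilation(1)[OF sv], of "approx_number x", OF this] dilation(2)[OF sv]
  show x: "x \<in> ideal" and "ideal_norm x \<le> 2 * operator_space_norm N x"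
    unfolding ideal_def ideal_norm_def operator_space_norm_def by auto
  have "\<bar>singular_value x n\<bar> \<le> \<bar>approx_number x n\<bar>" for n
    using singular_value_le_approx_number[OF ess, of n] nonneg[of n] by linarith
  from lattice(2)[of "approx_number x" "singular_value x", OF _ this] x
  show "operator_space_norm N x \<le> ideal_norm x"
    unfolding ideal_def ideal_norm_def operator_space_norm_def by blast
qed

end

section \<open>Approximation numbers of block-diagonal operators\<close>

lemma bernstein_localize:
  assumes p: "linear p" "\<And>u. norm (p u) \<le> norm u" "\<And>u. blinfun_apply x (p u) = blinfun_apply x u"
    and s: "s > 0" and x: "bernstein x s n"
  obtains C where "finite C" "pairwise orthogonal C" "0 \<notin> C" "card C = n" "span C \<subseteq> range p"
    "\<And>w. w \<in> span C \<Longrightarrow> s * norm w \<le> norm (blinfun_apply x w)"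
proof -
  obtain B where B: "finite B" "independent B" "card B = n"
    "\<And>u. u \<in> span B \<Longrightarrow> s * norm u \<le> norm (blinfun_apply x u)"
    using x unfolding bernstein_def by blast
  have inj: "inj_on p (span B)"
    unfolding linear_injective_on_subspace_0[OF p(1) subspace_span]
  proof (intro ballI impI)
    fix u assume u: "u \<in> span B" "p u = 0"
    then have "blinfun_apply x u = 0"
      using p(3)[of u] by simp
    then have "s * norm u \<le> 0"
      using B(4)[OF u(1)] by simp
    then show "u = 0"
      using s by (simp add: mult_le_0_iff)
  qed
  have pB: "finite (p ` B)" "independent (p ` B)"
    using B(1,2) linear_independent_injective_image[OF p(1) B(2) inj] by auto
  obtain C where C: "finite C" "pairwise orthogonal C" "0 \<notin> C" "card C = card (p ` B)" "span C = span (p ` B)"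
    by (rule orthogonal_basis[OF pB])
  have card: "card C = n"
    using C(4) card_image[OF inj_on_subset[OF inj span_superset]] B(3) by simp
  have span: "span C = p ` span B"
    using C(5) linear_span_image[OF p(1)] by simp
  show ?thesis
  proof (rule that[OF C(1-3) card])
    show "span C \<subseteq> range p"
      using span by auto
    fix w assume "w \<in> span C"
    then obtain u where u: "u \<in> span B" "w = p u"
      using span by auto
    have "s * norm w \<le> s * norm u"
      unfolding u(2) using s p(2) by simp
    also have "\<dots> \<le> norm (blinfun_apply x u)"
      by (rule B(4)[OF u(1)])
    finally show "s * norm w \<le> norm (blinfun_apply x w)"
      unfolding u(2) p(3) .
  qed
qed

text \<open>
  Bernstein numbers and approximation numbers both behave additively here. Subspaces on which \<open>x\<close>
  and \<open>y\<close> are bounded below can be moved into the range and the kernel of \<^term>\<open>cut N\<close>, where they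
  and their images are orthogonal. Approximants of \<open>x\<close> and \<open>y\<close> can be compressed to these spaces, and
  the norm of a block-diagonal operator is the maximum of the norms of its blocks.
\<close>

locale two_blocks =
  fixes x y :: "ell2 \<Rightarrow>\<^sub>L ell2" and N :: nat
  assumes x_trunc: "\<And>u. blinfun_apply x (trunc N u) = blinfun_apply x u"
    and trunc_x: "\<And>u. trunc N (blinfun_apply x u) = blinfun_apply x u"
    and y_trunc: "\<And>u. blinfun_apply y (trunc N u) = 0"
    and trunc_y: "\<And>u. trunc N (blinfun_apply y u) = 0"
begin

lemma norm_apply_square:
  "(norm (blinfun_apply (x + y) u))\<^sup>2 = (norm (blinfun_apply x u))\<^sup>2 + (norm (blinfun_apply y u))\<^sup>2"
proof -
  have "blinfun_apply x u \<bullet> blinfun_apply y u = 0"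
    by (metis trunc_x trunc_y inner_trunc inner_zero_right)
  then show ?thesis
    unfolding blinfun.add_left by (intro norm_add_Pythagorean) (simp add: orthogonal_def)
qed

lemma bernstein_add:
  assumes s: "s > 0" and "bernstein x s m" "bernstein y s n"
  shows "bernstein (x + y) s (m + n)"
proof -
  obtain C where C: "finite C" "pairwise orthogonal C" "0 \<notin> C" "card C = m" "span C \<subseteq> range (trunc N)"
    "\<And>w. w \<in> span C \<Longrightarrow> s * norm w \<le> norm (blinfun_apply x w)"
    using bernstein_localize[OF linear_trunc norm_trunc_le x_trunc s assms(2)] by blast
  have lin: "linear (\<lambda>u. u - trunc N u)"
    by (intro linear_compose_sub linear_trunc linear_id[unfolded id_def])
  have y_diff: "blinfun_apply y (u - trunc N u) = blinfun_apply y u" for u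
    by (simp add: blinfun.diff_right y_trunc)
  obtain D where D: "finite D" "pairwise orthogonal D" "0 \<notin> D" "card D = n" "span D \<subseteq> range (\<lambda>u. u - trunc N u)"
    "\<And>w. w \<in> span D \<Longrightarrow> s * norm w \<le> norm (blinfun_apply y w)"
    using bernstein_localize[OF lin norm_diff_trunc_le y_diff s assms(3)] by blast
  have trunc_C: "trunc N c = c" if "c \<in> span C" for c
    using that C(5) by auto
  have trunc_D: "trunc N d = 0" if "d \<in> span D" for d
    using that D(5) by (auto simp: linear_diff[OF linear_trunc])
  have orth: "c \<bullet> d = 0" if "c \<in> span C" "d \<in> span D" for c d
    by (metis trunc_C[OF that(1)] trunc_D[OF that(2)] inner_trunc inner_zero_right)
  have orth': "d \<bullet> c = 0" if "c \<in> span C" "d \<in> span D" for c d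
    using orth[OF that] by (simp add: inner_commute)
  have disjoint: "C \<inter> D = {}"
  proof (rule ccontr)
    assume "C \<inter> D \<noteq> {}"
    then obtain c where "c \<in> C" "c \<in> D"
      by blast
    then have "c \<bullet> c = 0"
      by (intro orth span_base)
    then show False
      using C(3) \<open>c \<in> C\<close> by simp
  qed
  have "pairwise orthogonal (C \<union> D)"
    using C(2) D(2) orth[OF span_base span_base] orth'[OF span_base span_base]
    by (auto simp: pairwise_def orthogonal_def)
  then have indep: "independent (C \<union> D)"
    using C(3) D(3) by (intro pairwise_orthogonal_independent) auto
  have "s * norm u \<le> norm (blinfun_apply (x + y) u)" if u: "u \<in> span (C \<union> D)" for u
  proof -
    obtain c d where cd: "c \<in> span C" "d \<in> span D" "u = c + d"
      using u unfolding span_Un by blast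
    have "blinfun_apply x d = 0"
      using x_trunc[of d] trunc_D[OF cd(2)] by simp
    moreover have "blinfun_apply y c = 0"
      using y_trunc[of c] trunc_C[OF cd(1)] by simp
    ultimately have xy: "blinfun_apply x u = blinfun_apply x c" "blinfun_apply y u = blinfun_apply y d"
      using cd(3) by (simp_all add: blinfun.add_right)
    have "(s * norm u)\<^sup>2 = (s * norm c)\<^sup>2 + (s * norm d)\<^sup>2"
      unfolding cd(3) power_mult_distrib
      using norm_add_Pythagorean[of c d] orth[OF cd(1,2)] by (simp add: orthogonal_def algebra_simps)
    also have "\<dots> \<le> (norm (blinfun_apply x c))\<^sup>2 + (norm (blinfun_apply y d))\<^sup>2"
      using s C(6)[OF cd(1)] D(6)[OF cd(2)] by (intro add_mono power_mono) auto
    also have "\<dots> = (norm (blinfun_apply (x + y) u))\<^sup>2"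
      unfolding norm_apply_square xy ..
    finally show ?thesis
      by (rule power2_le_imp_le) simp
  qed
  moreover have "card (C \<union> D) = m + n"
    using card_Un_disjoint[OF C(1) D(1) disjoint] C(4) D(4) by simp
  ultimately show ?thesis
    unfolding bernstein_def using C(1) D(1) indep by blast
qed

lemma approx_number_add_le:
  assumes "approx_number x p \<le> s" "approx_number y q \<le> s"
  shows "approx_number (x + y) (p + q) \<le> s"
proof (rule field_le_epsilon)
  fix e :: real assume e: "e > 0"
  obtain k where k: "rank_le p k" "norm (x - k) < s + e"
    using approx_number_lessE[of x p "s + e"] assms(1) e by force
  obtain l where l: "rank_le q l" "norm (y - l) < s + e"
    using approx_number_lessE[of y q "s + e"] assms(2) e by force
  define k' where "k' = cut N o\<^sub>L (k o\<^sub>L cut N)"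
  define R where "R = id_blinfun - cut N"
  have R: "blinfun_apply R u = u - trunc N u" for u
    by (simp add: R_def blinfun.diff_left)
  define l' where "l' = R o\<^sub>L (l o\<^sub>L R)"
  have rank: "rank_le (p + q) (k' + l')"
    unfolding k'_def l'_def
    by (intro rank_le_add rank_le_compose_left rank_le_compose_right k(1) l(1))
  have nonneg: "0 \<le> s + e"
    using k(2) norm_ge_zero[of "x - k"] by linarith
  have "norm (x + y - (k' + l')) \<le> s + e"
  proof (rule norm_blinfun_bound[OF nonneg])
    fix u
    let ?a = "blinfun_apply (x - k) (trunc N u)"
    let ?b = "blinfun_apply (y - l) (u - trunc N u)"
    have "blinfun_apply (x + y - (k' + l')) u
        = (blinfun_apply x u - blinfun_apply k' u) + (blinfun_apply y u - blinfun_apply l' u)"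
      by (simp add: blinfun.diff_left blinfun.add_left)
    also have "blinfun_apply x u - blinfun_apply k' u = trunc N ?a"
      by (simp add: k'_def blinfun.diff_left x_trunc trunc_x linear_diff[OF linear_trunc])
    also have "blinfun_apply y u - blinfun_apply l' u = ?b - trunc N ?b"
      by (simp add: l'_def R blinfun.diff_left blinfun.diff_right y_trunc trunc_y
          linear_diff[OF linear_trunc] linear_add[OF linear_trunc])
    finally have eq: "blinfun_apply (x + y - (k' + l')) u = trunc N ?a + (?b - trunc N ?b)" .
    have "trunc N ?a \<bullet> (?b - trunc N ?b) = 0"
      by (simp add: inner_diff_right inner_trunc)
    then have "(norm (blinfun_apply (x + y - (k' + l')) u))\<^sup>2 = (norm (trunc N ?a))\<^sup>2 + (norm (?b - trunc N ?b))\<^sup>2"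
      unfolding eq by (intro norm_add_Pythagorean) (simp add: orthogonal_def)
    also have "\<dots> \<le> ((s + e) * norm (trunc N u))\<^sup>2 + ((s + e) * norm (u - trunc N u))\<^sup>2"
    proof (intro add_mono power_mono)
      show "norm (trunc N ?a) \<le> (s + e) * norm (trunc N u)"
        using norm_trunc_le[of N ?a] norm_blinfun[of "x - k" "trunc N u"]
          mult_right_mono[OF less_imp_le[OF k(2)], of "norm (trunc N u)"] by simp
      show "norm (?b - trunc N ?b) \<le> (s + e) * norm (u - trunc N u)"
        using norm_diff_trunc_le[of ?b N] norm_blinfun[of "y - l" "u - trunc N u"]
          mult_right_mono[OF less_imp_le[OF l(2)], of "norm (u - trunc N u)"] by simp
    qed auto
    also have "\<dots> = ((s + e) * norm u)\<^sup>2"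
      unfolding power_mult_distrib distrib_left[symmetric] norm_trunc_Pythagoras ..
    finally show "norm (blinfun_apply (x + y - (k' + l')) u) \<le> (s + e) * norm u"
      by (rule power2_le_imp_le) (use nonneg in simp)
  qed
  then show "approx_number (x + y) (p + q) \<le> s + e"
    using approx_number_le[OF rank, of "x + y"] by linarith
qed

end

lemma approx_number_superlevel:
  assumes "rank_le d x" "0 \<le> s"
  obtains p where "{i. s < approx_number x i} = {..<p}"
proof
  let ?p = "LEAST i. approx_number x i \<le> s"
  have "approx_number x d \<le> s"
    using approx_number_eq_0[OF assms(1) order.refl] assms(2) by simp
  then have p: "approx_number x ?p \<le> s"
    by (rule LeastI)
  show "{i. s < approx_number x i} = {..<?p}"
  proof (intro set_eqI iffI)
    fix i assume "i \<in> {i. s < approx_number x i}"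
    then show "i \<in> {..<?p}"
      using p approx_number_antimono[of ?p i x] by force
  next
    fix i assume "i \<in> {..<?p}"
    then show "i \<in> {i. s < approx_number x i}"
      using not_less_Least[of i "\<lambda>i. approx_number x i \<le> s"] by simp
  qed
qed

lemma (in two_blocks) card_superlevel_add:
  assumes "compact_operator x" "compact_operator y" "rank_le d x" "rank_le d' y" "0 \<le> s"
  shows "card {i. s < approx_number (x + y) i}
    = card {i. s < approx_number x i} + card {i. s < approx_number y i}"
proof -
  obtain p where p: "{i. s < approx_number x i} = {..<p}"
    using approx_number_superlevel[OF assms(3,5)] by blast
  obtain q where q: "{i. s < approx_number y i} = {..<q}"
    using approx_number_superlevel[OF assms(4,5)] by blast
  have "{i. s < approx_number (x + y) i} = {..<p + q}"
  proof (intro set_eqI iffI)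
    fix i assume i: "i \<in> {i. s < approx_number (x + y) i}"
    have "p \<notin> {i. s < approx_number x i}" "q \<notin> {i. s < approx_number y i}"
      by (simp_all only: p q lessThan_iff less_irrefl not_False_eq_True)
    then have "approx_number (x + y) (p + q) \<le> s"
      by (intro approx_number_add_le) simp_all
    then show "i \<in> {..<p + q}"
      using i approx_number_antimono[of "p + q" i "x + y"] by force
  next
    fix i assume i: "i \<in> {..<p + q}"
    have xp: "s < approx_number x (p - 1)" if "p > 0"
    proof -
      have "p - 1 \<in> {i. s < approx_number x i}"
        unfolding p using that by simp
      then show ?thesis
        by simp
    qed
    have yq: "s < approx_number y (q - 1)" if "q > 0"
    proof -
      have "q - 1 \<in> {i. s < approx_number y i}"
        unfolding q using that by simp
      then show ?thesis
        by simp
    qed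
    define a b where "a = (if p > 0 then approx_number x (p - 1) else s + 1)"
      and "b = (if q > 0 then approx_number y (q - 1) else s + 1)"
    have "s < min a b"
      using xp yq by (auto simp: a_def b_def)
    then obtain s' where s': "s < s'" "s' < min a b"
      using dense by blast
    have "bernstein x s' p"
    proof (cases p)
      case (Suc p')
      then show ?thesis
        using s' assms(5) by (intro bernstein_of_approx_number[OF assms(1), of s' p', folded Suc]) (auto simp: a_def)
    qed (simp add: bernstein_0)
    moreover have "bernstein y s' q"
    proof (cases q)
      case (Suc q')
      then show ?thesis
        using s' assms(5) by (intro bernstein_of_approx_number[OF assms(2), of s' q', folded Suc]) (auto simp: b_def)
    qed (simp add: bernstein_0)
    moreover have "Suc (p + q - 1) = p + q"
      using i by simp
    ultimately have "bernstein (x + y) s' (Suc (p + q - 1))"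
      using bernstein_add[of s' p q] s'(1) assms(5) by simp
    then have "s' \<le> approx_number (x + y) (p + q - 1)"
      by (rule approx_number_ge_bernstein)
    also have "\<dots> \<le> approx_number (x + y) i"
      using i by (intro approx_number_antimono) simp
    finally show "i \<in> {i. s < approx_number (x + y) i}"
      using s'(1) by simp
  qed
  then show ?thesis
    by (simp add: p q)
qed

locale block_diagonal =
  fixes z :: "nat \<Rightarrow> ell2 \<Rightarrow>\<^sub>L ell2" and M :: "nat \<Rightarrow> nat"
  assumes mono_M: "mono M"
    and compact_z: "\<And>j. compact_operator (z j)"
    and z_trunc: "\<And>j u. blinfun_apply (z j) (trunc (M (Suc j)) u) = blinfun_apply (z j) u"
    and trunc_z: "\<And>j u. trunc (M (Suc j)) (blinfun_apply (z j) u) = blinfun_apply (z j) u"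
    and z_trunc0: "\<And>j u. blinfun_apply (z j) (trunc (M j) u) = 0"
    and trunc0_z: "\<And>j u. trunc (M j) (blinfun_apply (z j) u) = 0"
begin

lemma rank_le_of_trunc:
  assumes "\<And>u. trunc k (blinfun_apply x u) = blinfun_apply x u"
  shows "rank_le (2 * k) x"
proof -
  have "x = cut k o\<^sub>L x"
    by (rule blinfun_eqI) (simp add: assms)
  then show ?thesis
    using rank_le_compose_right[OF rank_le_cut] by metis
qed

lemma rank_z: "rank_le (2 * M (Suc j)) (z j)"
  by (rule rank_le_of_trunc[OF trunc_z])

lemma partial_sum_trunc:
  shows "blinfun_apply (\<Sum>j<n. c j *\<^sub>R z j) (trunc (M n) u) = blinfun_apply (\<Sum>j<n. c j *\<^sub>R z j) u"
    and "trunc (M n) (blinfun_apply (\<Sum>j<n. c j *\<^sub>R z j) u) = blinfun_apply (\<Sum>j<n. c j *\<^sub>R z j) u"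
proof -
  have M: "M (Suc j) \<le> M n" if "j < n" for j
    using mono_M that by (simp add: monoD)
  have 1: "blinfun_apply (z j) (trunc (M n) u) = blinfun_apply (z j) u" if "j < n" for j
    using z_trunc[of j "trunc (M n) u"] z_trunc[of j u] M[OF that] by (simp add: trunc_trunc min_absorb1)
  have 2: "trunc (M n) (blinfun_apply (z j) u) = blinfun_apply (z j) u" if "j < n" for j
    using trunc_z[of j u] M[OF that] trunc_trunc[of "M n" "M (Suc j)" "blinfun_apply (z j) u"]
    by (simp add: min_absorb2)
  show "blinfun_apply (\<Sum>j<n. c j *\<^sub>R z j) (trunc (M n) u) = blinfun_apply (\<Sum>j<n. c j *\<^sub>R z j) u"
    by (simp add: blinfun.sum_left blinfun.scaleR_left 1)
  show "trunc (M n) (blinfun_apply (\<Sum>j<n. c j *\<^sub>R z j) u) = blinfun_apply (\<Sum>j<n. c j *\<^sub>R z j) u"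
    by (simp add: blinfun.sum_left blinfun.scaleR_left linear_sum[OF linear_trunc] linear_scale[OF linear_trunc] 2)
qed

lemma rank_partial_sum: "rank_le (2 * M n) (\<Sum>j<n. c j *\<^sub>R z j)"
  by (rule rank_le_of_trunc[OF partial_sum_trunc(2)])

lemma card_superlevel_sum:
  assumes "0 \<le> s"
  shows "card {i. s < approx_number (\<Sum>j<n. c j *\<^sub>R z j) i}
    = (\<Sum>j<n. card {i. s < approx_number (c j *\<^sub>R z j) i})"
proof (induction n)
  case 0
  have "approx_number (0 :: ell2 \<Rightarrow>\<^sub>L ell2) i = 0" for i
    using approx_number_eq_0[OF rank_le_zero, of 0 i] by simp
  then show ?case
    using assms by simp
next
  case (Suc n)
  interpret two_blocks "\<Sum>j<n. c j *\<^sub>R z j" "c n *\<^sub>R z n" "M n"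
    by unfold_locales (simp_all add: partial_sum_trunc blinfun.scaleR_left z_trunc0 trunc0_z
        linear_scale[OF linear_trunc])
  show ?case
    using card_superlevel_add[OF _ _ rank_partial_sum rank_le_scaleR[OF rank_z] assms] Suc
    by (simp add: compact_operator_sum compact_operator_scaleR compact_z)
qed

text \<open>
  The decreasing rearrangement of the approximation numbers of a block-diagonal operator does not
  depend linearly on the coefficients of the blocks. Keeping a separate infinite set of positions
  for each block makes the arrangement linear.
\<close>

definition layout :: "(nat \<Rightarrow> real) \<Rightarrow> nat \<Rightarrow> real"
  where "layout c = (\<lambda>i. case prod_decode i of (j, m) \<Rightarrow> c j * approx_number (z j) m)"

lemma layout_add: "layout (c + d) = layout c + layout d"
  by (auto simp: layout_def fun_eq_iff algebra_simps split: prod.split)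

lemma layout_scaleR: "layout (a *\<^sub>R c) = a *\<^sub>R layout c"
  by (auto simp: layout_def fun_eq_iff scaleR_fun_def split: prod.split)

end

locale block_diagonal_ideal = block_diagonal + separable_seq_space
begin

lemma layout_finite:
  assumes c: "\<And>j. j \<ge> n \<Longrightarrow> c j = 0"
  shows "layout c \<in> F" "N (layout c) = ideal_norm (\<Sum>j<n. c j *\<^sub>R z j)"
proof -
  let ?Z = "\<Sum>j<n. c j *\<^sub>R z j"
  have Z: "approx_number ?Z \<in> F"
    using ideal_finite_rank(1)[OF rank_partial_sum] by (simp add: ideal_def)
  have "emeasure (count_space UNIV) {i. s < \<bar>approx_number ?Z i\<bar>}
      = emeasure (count_space UNIV) {i. s < \<bar>layout c i\<bar>}" if s: "0 \<le> s" for s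
  proof -
    let ?S = "\<lambda>j. {i. s < approx_number (c j *\<^sub>R z j) i}"
    have fin: "finite (?S j)" for j
      using approx_number_superlevel[OF rank_le_scaleR[OF rank_z] s] by (metis finite_lessThan)
    have finZ: "finite {i. s < approx_number ?Z i}"
      using approx_number_superlevel[OF rank_partial_sum s] by (metis finite_lessThan)
    have eq: "{i. s < \<bar>layout c i\<bar>} = prod_encode ` Sigma {..<n} ?S"
    proof (intro set_eqI iffI)
      fix i assume i: "i \<in> {i. s < \<bar>layout c i\<bar>}"
      obtain j m where jm: "prod_decode i = (j, m)"
        by fastforce
      have "s < \<bar>c j\<bar> * approx_number (z j) m"
        using i jm by (simp add: layout_def abs_mult approx_number_nonneg)
      moreover from this have "j < n"
        using c[of j] s by (cases "j < n") auto
      ultimately have "prod_decode i \<in> Sigma {..<n} ?S"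
        by (simp add: jm approx_number_scaleR)
      then show "i \<in> prod_encode ` Sigma {..<n} ?S"
        by (metis image_eqI prod_decode_inverse)
    qed (auto simp: layout_def abs_mult approx_number_nonneg approx_number_scaleR)
    have "card {i. s < \<bar>layout c i\<bar>} = (\<Sum>j<n. card (?S j))"
      unfolding eq by (subst card_image[OF inj_prod_encode]) (simp add: fin)
    moreover have "finite {i. s < \<bar>layout c i\<bar>}"
      unfolding eq using fin by simp
    ultimately show ?thesis
      using finZ card_superlevel_sum[OF s, of c n]
      by (simp add: emeasure_count_space approx_number_nonneg)
  qed
  from equimeasurable[of "approx_number ?Z" "layout c", OF Z this]
  show "layout c \<in> F" "N (layout c) = ideal_norm ?Z"
    by (simp_all add: ideal_norm_def)
qed

text \<open>
  Finitely supported coefficients suffice: for any sequence in \<open>\<ell>\<^sub>r\<close>, the layouts of its initial segments form a Cauchy sequence in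
  \<open>F\<close>, whose limit can only be the pointwise one.
\<close>

lemma lp_space_embeds:
  assumes r: "r > 0" and ab: "a > 0"
    and bounds: "\<And>n c. a * (\<Sum>j<n. \<bar>c j\<bar> powr r) powr (1 / r) \<le> ideal_norm (\<Sum>j<n. c j *\<^sub>R z j)"
      "\<And>n c. ideal_norm (\<Sum>j<n. c j *\<^sub>R z j) \<le> b * (\<Sum>j<n. \<bar>c j\<bar> powr r) powr (1 / r)"
  shows "isomorphically_embeds (lp_space r) (lp_norm r) F N"
proof -
  define init where "init n c = (\<lambda>j. if j < n then c j else 0)" for n and c :: "nat \<Rightarrow> real"
  have init: "layout (init n c) \<in> F" "N (layout (init n c)) = ideal_norm (\<Sum>j<n. c j *\<^sub>R z j)" for n c
  proof -
    have "(\<Sum>j<n. init n c j *\<^sub>R z j) = (\<Sum>j<n. c j *\<^sub>R z j)"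
      by (rule sum.cong) (auto simp: init_def)
    then show "layout (init n c) \<in> F" "N (layout (init n c)) = ideal_norm (\<Sum>j<n. c j *\<^sub>R z j)"
      using layout_finite[of n "init n c"] by (simp_all add: init_def)
  qed
  have main: "layout c \<in> F \<and> a * lp_norm r c \<le> N (layout c) \<and> N (layout c) \<le> b * lp_norm r c"
    if c: "c \<in> lp_space r" for c
  proof -
    define p where "p j = \<bar>c j\<bar> powr r" for j
    have summable: "summable p"
      using c by (simp add: Lp_space_def p_def[abs_def] integrable_count_space_nat_iff)
    have lp_norm: "lp_norm r c = (\<Sum>j. p j) powr (1 / r)"
      using c by (simp add: Lp_space_def Lp_norm_def p_def[abs_def] integral_count_space_nat)
    have p_nonneg: "0 \<le> p j" for j
      by (simp add: p_def)
    have diff_le: "N (layout (init n c) - layout (init m c)) \<le> b * (\<Sum>j\<in>{m..<n}. p j) powr (1 / r)"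
      if "m \<le> n" for m n
    proof -
      define d where "d j = (if m \<le> j then c j else 0)" for j
      have "layout (init n c) - layout (init m c) = layout (init n d)"
        using that by (auto simp: layout_def init_def d_def fun_eq_iff split: prod.split)
      moreover have "(\<Sum>j<n. \<bar>d j\<bar> powr r) = (\<Sum>j\<in>{m..<n}. p j)"
        using r by (intro sum.mono_neutral_cong_right) (auto simp: d_def p_def)
      ultimately show ?thesis
        using init(2)[of n d] bounds(2)[of d n] by simp
    qed
    have Cauchy: "\<exists>K. \<forall>m\<ge>K. \<forall>n\<ge>K. N (layout (init m c) - layout (init n c)) < e" if e: "e > 0" for e
    proof -
      define e' where "e' = (e / (\<bar>b\<bar> + 1)) powr r"
      have "e' > 0"
        using e by (simp add: e'_def)
      then obtain K where K: "\<And>m n. m \<ge> K \<Longrightarrow> norm (sum p {m..<n}) < e'"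
        using summable unfolding summable_Cauchy by blast
      have less: "N (layout (init n c) - layout (init m c)) < e" if "K \<le> m" "m \<le> n" for m n
      proof -
        have "sum p {m..<n} < e'" "0 \<le> sum p {m..<n}"
          using K[OF that(1), of n] sum_nonneg[of "{m..<n}" p] p_nonneg by auto
        then have "(sum p {m..<n}) powr (1 / r) < e' powr (1 / r)"
          using r by (intro powr_less_mono2) auto
        also have "e' powr (1 / r) = e / (\<bar>b\<bar> + 1)"
          using r e by (simp add: e'_def powr_powr)
        finally have small: "(sum p {m..<n}) powr (1 / r) < e / (\<bar>b\<bar> + 1)" .
        have "N (layout (init n c) - layout (init m c)) \<le> (\<bar>b\<bar> + 1) * (sum p {m..<n}) powr (1 / r)"
          by (rule order.trans[OF diff_le[OF that(2)]]) (intro mult_right_mono, auto)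
        also have "\<dots> < (\<bar>b\<bar> + 1) * (e / (\<bar>b\<bar> + 1))"
          by (intro mult_strict_left_mono small) simp
        finally show ?thesis
          by simp
      qed
      have sym: "N (layout (init n c) - layout (init m c)) = N (layout (init m c) - layout (init n c))" for m n
        using norm_uminus[OF diff_F[OF init(1) init(1)], of n c m c] by (metis minus_diff_eq)
      show ?thesis
        by (metis less sym nat_le_linear)
    qed
    obtain g where g: "g \<in> F" "(\<lambda>n. N (layout (init n c) - g)) \<longlonglongrightarrow> 0"
      using complete_F[of "\<lambda>n. layout (init n c)", OF init(1) Cauchy] by blast
    have "g = layout c"
    proof
      fix i
      have "\<bar>layout (init n c) i - g i\<bar> \<le> N (layout (init n c) - g)" for n
        using coord_le[OF diff_F[OF init(1) g(1)], of n c i] by simp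
      then have "(\<lambda>n. layout (init n c) i - g i) \<longlonglongrightarrow> 0"
        by (intro Lim_null_comparison[OF _ g(2)] always_eventually allI) (simp only: real_norm_def)
      moreover have "\<forall>\<^sub>F n in sequentially. layout (init n c) i - g i = layout c i - g i"
        by (rule eventually_mono[OF eventually_gt_at_top[of "fst (prod_decode i)"]])
          (auto simp: layout_def init_def split: prod.split)
      ultimately have "(\<lambda>n::nat. layout c i - g i) \<longlonglongrightarrow> 0"
        using tendsto_cong by fast
      then show "g i = layout c i"
        by (simp add: LIMSEQ_const_iff)
    qed
    then have F: "layout c \<in> F" and lim: "(\<lambda>n. N (layout (init n c) - layout c)) \<longlonglongrightarrow> 0"
      using g by simp_all
    have close: "\<bar>N (layout (init n c)) - N (layout c)\<bar> \<le> N (layout (init n c) - layout c)" for n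
      using norm_diff_triangle[OF init(1) F, of n c] norm_diff_triangle[OF F init(1), of n c]
        norm_uminus[OF diff_F[OF init(1) F], of n c] unfolding minus_diff_eq by linarith
    have "(\<lambda>n. N (layout (init n c)) - N (layout c)) \<longlonglongrightarrow> 0"
      by (intro Lim_null_comparison[OF _ lim] always_eventually allI) (simp only: real_norm_def close)
    then have norm_lim: "(\<lambda>n. N (layout (init n c))) \<longlonglongrightarrow> N (layout c)"
      by (rule LIM_zero_cancel)
    have sums: "(\<lambda>n. (\<Sum>j<n. p j) powr (1 / r)) \<longlonglongrightarrow> lp_norm r c"
      unfolding lp_norm using r p_nonneg
      by (intro tendsto_powr' summable_LIMSEQ summable tendsto_const) (auto intro!: always_eventually sum_nonneg)
    have "a * lp_norm r c \<le> N (layout c)"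
      by (rule LIMSEQ_le[OF tendsto_mult[OF tendsto_const sums] norm_lim])
        (use bounds(1)[of c] in \<open>simp add: init(2) p_def\<close>)
    moreover have "N (layout c) \<le> b * lp_norm r c"
      by (rule LIMSEQ_le[OF norm_lim tendsto_mult[OF tendsto_const sums]])
        (use bounds(2)[of c] in \<open>simp add: init(2) p_def\<close>)
    ultimately show ?thesis
      using F by blast
  qed
  show ?thesis
    unfolding isomorphically_embeds_def
    using main layout_add layout_scaleR ab by (intro exI[of _ layout]) blast
qed

end

section \<open>Selecting almost block-diagonal blocks\<close>

definition cocut :: "nat \<Rightarrow> ell2 \<Rightarrow>\<^sub>L ell2"
  where "cocut N = id_blinfun - cut N"

lemma cocut_apply [simp]: "blinfun_apply (cocut N) u = u - trunc N u"
  by (simp add: cocut_def blinfun.diff_left)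

lemma norm_cocut_le: "norm (cocut N) \<le> 1"
  by (rule norm_blinfun_bound) (auto simp: norm_diff_trunc_le)

lemma norm_compose_contraction_left:
  assumes "norm y \<le> 1"
  shows "norm (y o\<^sub>L x) \<le> norm x"
  using norm_blinfun_compose[of y x] mult_right_mono[OF assms, of "norm x"] by simp

lemma norm_compose_contraction_right:
  assumes "norm y \<le> 1"
  shows "norm (x o\<^sub>L y) \<le> norm x"
  using norm_blinfun_compose[of x y] mult_left_mono[OF assms, of "norm x"] by simp

lemma approx_number_compose_contraction_left:
  assumes "norm y \<le> 1"
  shows "approx_number (y o\<^sub>L x) n \<le> approx_number x n"
  using approx_number_compose_left[of y x n] mult_right_mono[OF assms approx_number_nonneg[of x n]] by simp

lemma approx_number_compose_contraction_right:
  assumes "norm y \<le> 1"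
  shows "approx_number (x o\<^sub>L y) n \<le> approx_number x n"
  using approx_number_compose_right[of x y n] mult_left_mono[OF assms approx_number_nonneg[of x n]] by simp

context separable_seq_space
begin

lemma cocut_compose_tendsto:
  fixes x :: "ell2 \<Rightarrow>\<^sub>L ell2"
  assumes x: "x \<in> ideal" and e: "e > 0"
  shows "\<forall>\<^sub>F N in sequentially. norm (cocut N o\<^sub>L x) < e \<and> norm (x o\<^sub>L cocut N) < e"
proof -
  obtain n where "approx_number x n < e / 2"
    using ideal_approx_number_tendsto_0[OF x, of "e / 2"] e by auto
  then obtain k where k: "rank_le n k" "norm (x - k) < e / 2"
    by (rule approx_number_lessE)
  have "\<forall>\<^sub>F N in sequentially. norm (k - (cut N o\<^sub>L k)) < e / 2"
    "\<forall>\<^sub>F N in sequentially. norm (k - (k o\<^sub>L cut N)) < e / 2"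
    by (rule order_tendstoD(2)[OF finite_rank_cut_tendsto(1)[OF k(1)]], use e in simp,
        rule order_tendstoD(2)[OF finite_rank_cut_tendsto(2)[OF k(1)]], use e in simp)
  then show ?thesis
  proof eventually_elim
    case (elim N)
    have "cocut N o\<^sub>L x = (cocut N o\<^sub>L (x - k)) + (k - (cut N o\<^sub>L k))"
      by (rule blinfun_eqI) (simp add: blinfun.diff_left blinfun.add_left linear_diff[OF linear_trunc])
    then have "norm (cocut N o\<^sub>L x) \<le> norm (cocut N o\<^sub>L (x - k)) + norm (k - (cut N o\<^sub>L k))"
      by (metis norm_triangle_ineq)
    moreover have "x o\<^sub>L cocut N = ((x - k) o\<^sub>L cocut N) + (k - (k o\<^sub>L cut N))"
      by (rule blinfun_eqI) (simp add: blinfun.diff_left blinfun.add_left blinfun.diff_right)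
    then have "norm (x o\<^sub>L cocut N) \<le> norm ((x - k) o\<^sub>L cocut N) + norm (k - (k o\<^sub>L cut N))"
      by (metis norm_triangle_ineq)
    ultimately show ?case
      using norm_compose_contraction_left[OF norm_cocut_le, of N "x - k"]
        norm_compose_contraction_right[OF norm_cocut_le, of "x - k" N] k(2) elim by linarith
  qed
qed

lemma ideal_cut_approx:
  fixes x :: "ell2 \<Rightarrow>\<^sub>L ell2"
  assumes x: "x \<in> ideal" and e: "e > 0"
  shows "\<forall>\<^sub>F N in sequentially. ideal_norm (x - (cut N o\<^sub>L (x o\<^sub>L cut N))) < e"
proof -
  obtain d where d: "d > 0" "\<And>y :: ell2 \<Rightarrow>\<^sub>L ell2. (\<And>n. approx_number y n \<le> approx_number x n) \<Longrightarrow> norm y < d \<Longrightarrow>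
      y \<in> ideal \<and> ideal_norm y < e / 4"
    using ideal_norm_small[OF x, of "e / 4"] e by auto
  show ?thesis
    using cocut_compose_tendsto[OF x d(1)]
  proof eventually_elim
    case (elim N)
    have 1: "cocut N o\<^sub>L x \<in> ideal \<and> ideal_norm (cocut N o\<^sub>L x) < e / 4"
      using elim by (intro d(2) approx_number_compose_contraction_left norm_cocut_le) simp
    have 2: "cut N o\<^sub>L (x o\<^sub>L cocut N) \<in> ideal \<and> ideal_norm (cut N o\<^sub>L (x o\<^sub>L cocut N)) < e / 4"
      using elim norm_compose_contraction_left[OF norm_cut_le, of N "x o\<^sub>L cocut N"]
      by (intro d(2) order.trans[OF approx_number_compose_contraction_left[OF norm_cut_le]]
          approx_number_compose_contraction_right norm_cocut_le) simp
    have "x - (cut N o\<^sub>L (x o\<^sub>L cut N)) = (cocut N o\<^sub>L x) + (cut N o\<^sub>L (x o\<^sub>L cocut N))"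
      by (rule blinfun_eqI) (simp add: blinfun.diff_left blinfun.add_left blinfun.diff_right linear_diff[OF linear_trunc])
    then show ?case
      using ideal_add(2)[OF conjunct1[OF 1] conjunct1[OF 2]] 1 2 by simp
  qed
qed

end

text \<open>
  The squared Hilbert--Schmidt norms of \<open>x P\<close> and \<open>P x\<close>, for the coordinate projection \<open>P\<close>, add up
  to \<open>frame_energy N x\<close>. By the parallelogram law, signs can be chosen one after the
  other so that the energy of a sum is at most the sum of the energies.
\<close>

definition frame_energy :: "nat \<Rightarrow> (ell2 \<Rightarrow>\<^sub>L ell2) \<Rightarrow> real"
  where "frame_energy N x = (\<Sum>n<N. (norm (blinfun_apply x (ket n 1)))\<^sup>2 + (norm (blinfun_apply x (ket n \<i>)))\<^sup>2
    + (norm (blinfun_apply (adj x) (ket n 1)))\<^sup>2 + (norm (blinfun_apply (adj x) (ket n \<i>)))\<^sup>2)"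

lemma frame_energy_scaleR: "frame_energy N (c *\<^sub>R x) = c\<^sup>2 * frame_energy N x"
  by (simp add: frame_energy_def adj_scaleR blinfun.scaleR_left power_mult_distrib sum_distrib_left distrib_left)

lemma parallelogram: "(norm (a + b))\<^sup>2 + (norm (a - b))\<^sup>2 = 2 * (norm a)\<^sup>2 + 2 * (norm b)\<^sup>2"
  for a b :: "'a::real_inner"
  by (simp add: power2_norm_eq_inner inner_add_left inner_add_right inner_diff_left inner_diff_right)

lemma adj_diff: "adj (x - y) = adj x - adj y"
  using adj_add[of x "(-1) *\<^sub>R y"] adj_scaleR[of "-1" y] by simp

lemma frame_energy_parallelogram:
  "frame_energy N (x + y) + frame_energy N (x - y) = 2 * frame_energy N x + 2 * frame_energy N y"
proof -
  have "frame_energy N (x + y) + frame_energy N (x - y) = (\<Sum>n<N.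
      2 * ((norm (blinfun_apply x (ket n 1)))\<^sup>2 + (norm (blinfun_apply x (ket n \<i>)))\<^sup>2
        + (norm (blinfun_apply (adj x) (ket n 1)))\<^sup>2 + (norm (blinfun_apply (adj x) (ket n \<i>)))\<^sup>2)
      + 2 * ((norm (blinfun_apply y (ket n 1)))\<^sup>2 + (norm (blinfun_apply y (ket n \<i>)))\<^sup>2
        + (norm (blinfun_apply (adj y) (ket n 1)))\<^sup>2 + (norm (blinfun_apply (adj y) (ket n \<i>)))\<^sup>2))"
    unfolding frame_energy_def sum.distrib[symmetric] adj_add adj_diff blinfun.add_left blinfun.diff_left
    by (rule sum.cong[OF refl]) (use parallelogram in \<open>smt (verit)\<close>)
  also have "\<dots> = 2 * frame_energy N x + 2 * frame_energy N y"
    unfolding frame_energy_def by (simp add: sum.distrib distrib_left flip: sum_distrib_left)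
  finally show ?thesis .
qed

lemma frame_energy_le: "frame_energy N x \<le> 4 * real N * (norm x)\<^sup>2"
proof -
  have *: "(norm (blinfun_apply y (ket n c)))\<^sup>2 \<le> (norm x)\<^sup>2" if "cmod c = 1" "norm y = norm x" for y n c
    using norm_blinfun[of y "ket n c"] that by (intro power_mono) (auto simp: norm_ket)
  have "frame_energy N x \<le> (\<Sum>n<N. (norm x)\<^sup>2 + (norm x)\<^sup>2 + (norm x)\<^sup>2 + (norm x)\<^sup>2)"
    unfolding frame_energy_def by (intro sum_mono add_mono *) (auto simp: norm_adj)
  then show ?thesis
    by simp
qed

lemma frame_energy_signs:
  obtains \<epsilon> :: "nat \<Rightarrow> real" where "\<And>k. \<bar>\<epsilon> k\<bar> = 1"
    "frame_energy N (\<Sum>k<n. \<epsilon> k *\<^sub>R x k) \<le> (\<Sum>k<n. frame_energy N (x k))"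
proof -
  have "\<exists>\<epsilon> :: nat \<Rightarrow> real. (\<forall>k. \<bar>\<epsilon> k\<bar> = 1) \<and>
      frame_energy N (\<Sum>k<n. \<epsilon> k *\<^sub>R x k) \<le> (\<Sum>k<n. frame_energy N (x k))"
  proof (induction n)
    case 0
    have "frame_energy N 0 = 0"
      using frame_energy_scaleR[of N 0 0] by simp
    then show ?case
      by (intro exI[of _ "\<lambda>_. 1"]) simp
  next
    case (Suc n)
    then obtain \<epsilon> :: "nat \<Rightarrow> real" where \<epsilon>: "\<And>k. \<bar>\<epsilon> k\<bar> = 1"
      "frame_energy N (\<Sum>k<n. \<epsilon> k *\<^sub>R x k) \<le> (\<Sum>k<n. frame_energy N (x k))"
      by blast
    let ?s = "\<Sum>k<n. \<epsilon> k *\<^sub>R x k"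
    have "\<exists>\<sigma>. \<bar>\<sigma>\<bar> = 1 \<and> frame_energy N (?s + \<sigma> *\<^sub>R x n) \<le> frame_energy N ?s + frame_energy N (x n)"
    proof (cases "frame_energy N (?s + x n) \<le> frame_energy N ?s + frame_energy N (x n)")
      case True
      then show ?thesis
        by (intro exI[of _ 1]) simp
    next
      case False
      then have "frame_energy N (?s - x n) \<le> frame_energy N ?s + frame_energy N (x n)"
        using frame_energy_parallelogram[of N ?s "x n"] by linarith
      then show ?thesis
        by (intro exI[of _ "-1"]) simp
    qed
    then obtain \<sigma> where \<sigma>: "\<bar>\<sigma>\<bar> = 1" "frame_energy N (?s + \<sigma> *\<^sub>R x n) \<le> frame_energy N ?s + frame_energy N (x n)"
      by blast
    have "(\<Sum>k<n. (\<epsilon>(n := \<sigma>)) k *\<^sub>R x k) = ?s"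
      by (rule sum.cong) auto
    then have "(\<Sum>k<Suc n. (\<epsilon>(n := \<sigma>)) k *\<^sub>R x k) = ?s + \<sigma> *\<^sub>R x n"
      by simp
    then show ?case
      using \<epsilon> \<sigma> by (intro exI[of _ "\<epsilon>(n := \<sigma>)"]) auto
  qed
  then show ?thesis
    using that by blast
qed

lemma le_of_sum_squares_le:
  fixes a b c d q :: real
  assumes "a\<^sup>2 + b\<^sup>2 + c\<^sup>2 + d\<^sup>2 \<le> q\<^sup>2" "0 \<le> q"
  shows "a \<le> q \<and> b \<le> q \<and> c \<le> q \<and> d \<le> q"
proof -
  have "0 \<le> a\<^sup>2" "0 \<le> b\<^sup>2" "0 \<le> c\<^sup>2" "0 \<le> d\<^sup>2"
    by simp_all
  then have "a\<^sup>2 \<le> q\<^sup>2" "b\<^sup>2 \<le> q\<^sup>2" "c\<^sup>2 \<le> q\<^sup>2" "d\<^sup>2 \<le> q\<^sup>2"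
    using assms(1) by linarith+
  then show ?thesis
    using assms(2) power2_le_imp_le by blast
qed

lemma norm_cut_le_frame_energy:
  assumes "frame_energy N x \<le> q\<^sup>2" "q \<ge> 0"
  shows "norm (x o\<^sub>L cut N) \<le> 2 * real N * q" "norm (cut N o\<^sub>L x) \<le> 2 * real N * q"
proof -
  have le: "norm (blinfun_apply x (ket n 1)) \<le> q \<and> norm (blinfun_apply x (ket n \<i>)) \<le> q
      \<and> norm (blinfun_apply (adj x) (ket n 1)) \<le> q \<and> norm (blinfun_apply (adj x) (ket n \<i>)) \<le> q" if "n < N" for n
  proof -
    define t where "t n = (norm (blinfun_apply x (ket n 1)))\<^sup>2 + (norm (blinfun_apply x (ket n \<i>)))\<^sup>2
      + (norm (blinfun_apply (adj x) (ket n 1)))\<^sup>2 + (norm (blinfun_apply (adj x) (ket n \<i>)))\<^sup>2" for n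
    have "t n \<le> (\<Sum>n<N. t n)"
      using that by (intro member_le_sum) (auto simp: t_def)
    then have "t n \<le> q\<^sup>2"
      using assms(1) by (simp add: frame_energy_def t_def)
    then show ?thesis
      unfolding t_def by (rule le_of_sum_squares_le[OF _ assms(2)])
  qed
  have "norm (x o\<^sub>L cut N) \<le> (\<Sum>n<N. q + q)"
    by (rule order.trans[OF norm_compose_cut_le]) (intro sum_mono add_mono; use le in simp)
  then show "norm (x o\<^sub>L cut N) \<le> 2 * real N * q"
    by simp
  have "norm (adj x o\<^sub>L cut N) \<le> (\<Sum>n<N. q + q)"
    by (rule order.trans[OF norm_compose_cut_le]) (intro sum_mono add_mono; use le in simp)
  then show "norm (cut N o\<^sub>L x) \<le> 2 * real N * q"
    by (simp add: norm_cut_compose)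
qed

locale lr_sequence = separable_seq_space +
  fixes x :: "nat \<Rightarrow> ell2 \<Rightarrow>\<^sub>L ell2" and r a b :: real
  assumes r: "1 < r" "r < 2" and a: "a > 0"
    and sum_ideal: "\<And>n c. (\<Sum>k<n. c k *\<^sub>R x k) \<in> ideal"
    and sum_compact: "\<And>n c. compact_operator (\<Sum>k<n. c k *\<^sub>R x k)"
    and lower: "\<And>n c. a * (\<Sum>k<n. \<bar>c k\<bar> powr r) powr (1 / r) \<le> ideal_norm (\<Sum>k<n. c k *\<^sub>R x k)"
    and upper: "\<And>n c. ideal_norm (\<Sum>k<n. c k *\<^sub>R x k) \<le> b * (\<Sum>k<n. \<bar>c k\<bar> powr r) powr (1 / r)"
begin

lemma norm_x_le: "norm (x k) \<le> b"
proof -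
  define c where "c j = (if j = k then 1 else 0 :: real)" for j
  have "(\<Sum>j<Suc k. c j *\<^sub>R x j) = x k" "(\<Sum>j<Suc k. \<bar>c j\<bar> powr r) = 1"
    by (simp_all add: c_def)
  then show ?thesis
    using sum_ideal[of c "Suc k"] upper[where n = "Suc k" and c = c] norm_le_ideal_norm[of "x k"] by simp
qed

text \<open>
  A block with \<open>L\<close> coefficients \<open>\<plusminus> L powr (- 1 / r)\<close> has \<open>\<ell>\<^sub>r\<close>-norm 1. With the right signs its
  energy is at most a multiple of \<open>L powr (1 - 2 / r)\<close>, which tends to 0 since \<open>r < 2\<close>.
\<close>

lemma flat_block:
  assumes d: "d > 0"
  shows "\<exists>c L. (\<forall>k<m. c k = 0) \<and> (\<Sum>k<m + L. \<bar>c k\<bar> powr r) = 1 \<and> L > 0 \<and>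
    norm ((\<Sum>k<m + L. c k *\<^sub>R x k) o\<^sub>L cut K) < d \<and> norm (cut K o\<^sub>L (\<Sum>k<m + L. c k *\<^sub>R x k)) < d"
proof -
  define q where "q = d / (2 * real K + 1)"
  have q: "q > 0" "2 * real K * q < d"
    using d by (simp_all add: q_def field_simps)
  have "(\<lambda>L. real L powr (1 - 2 / r) * (4 * real K * b\<^sup>2)) \<longlonglongrightarrow> 0 * (4 * real K * b\<^sup>2)"
    using r by (intro tendsto_mult tendsto_const tendsto_neg_powr filterlim_real_sequentially) (simp add: field_simps)
  then have "\<forall>\<^sub>F L in sequentially. real L powr (1 - 2 / r) * (4 * real K * b\<^sup>2) < q\<^sup>2"
    using q(1) by (intro order_tendstoD(2)[where y = 0]) auto
  then have "\<forall>\<^sub>F L in sequentially. L > 0 \<and> real L powr (1 - 2 / r) * (4 * real K * b\<^sup>2) < q\<^sup>2"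
    using eventually_gt_at_top[of 0] by eventually_elim simp
  then obtain L where L: "L > 0" "real L powr (1 - 2 / r) * (4 * real K * b\<^sup>2) < q\<^sup>2"
    using eventually_happens trivial_limit_sequentially by blast
  obtain \<epsilon> :: "nat \<Rightarrow> real" where \<epsilon>: "\<And>k. \<bar>\<epsilon> k\<bar> = 1"
    "frame_energy K (\<Sum>k<L. \<epsilon> k *\<^sub>R x (m + k)) \<le> (\<Sum>k<L. frame_energy K (x (m + k)))"
    using frame_energy_signs[of K "\<lambda>k. x (m + k)" L] by blast
  define t where "t = real L powr (- 1 / r)"
  define c where "c k = (if k < m then 0 else t * \<epsilon> (k - m))" for k
  have split: "(\<Sum>k<m + L. f k) = (\<Sum>k<m. f k) + (\<Sum>k<L. f (m + k))" for f :: "nat \<Rightarrow> 'z::comm_monoid_add"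
    by (induction L) (simp_all add: add.assoc)
  have y: "(\<Sum>k<m + L. c k *\<^sub>R x k) = t *\<^sub>R (\<Sum>k<L. \<epsilon> k *\<^sub>R x (m + k))"
    by (simp add: split c_def scaleR_sum_right)
  have "(\<Sum>k<m + L. \<bar>c k\<bar> powr r) = real L * t powr r"
    using r by (simp add: split c_def abs_mult \<epsilon>(1) powr_mult t_def)
  also have "t powr r = real L powr (- 1)"
    using r by (simp add: t_def powr_powr)
  also have "real L * real L powr (- 1) = 1"
    using L(1) by (simp add: powr_minus)
  finally have norm1: "(\<Sum>k<m + L. \<bar>c k\<bar> powr r) = 1" .
  have "(\<Sum>k<L. frame_energy K (x (m + k))) \<le> (\<Sum>k<L. 4 * real K * b\<^sup>2)"
    using norm_x_le by (intro sum_mono order.trans[OF frame_energy_le] mult_left_mono power_mono) auto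
  then have "frame_energy K (\<Sum>k<m + L. c k *\<^sub>R x k) \<le> t\<^sup>2 * (real L * (4 * real K * b\<^sup>2))"
    unfolding y frame_energy_scaleR using \<epsilon>(2) by (intro mult_left_mono) auto
  also have "t\<^sup>2 * (real L * (4 * real K * b\<^sup>2)) = real L powr (1 - 2 / r) * (4 * real K * b\<^sup>2)"
  proof -
    have "t\<^sup>2 = real L powr (- 2 / r)"
      using L(1) by (simp add: t_def powr_powr flip: powr_numeral)
    then have "t\<^sup>2 * real L = real L powr (1 - 2 / r)"
      using L(1) by (simp add: powr_diff powr_minus field_simps)
    then show ?thesis
      by (simp add: mult.assoc[symmetric])
  qed
  also have "\<dots> \<le> q\<^sup>2"
    using L(2) by simp
  finally have "frame_energy K (\<Sum>k<m + L. c k *\<^sub>R x k) \<le> q\<^sup>2" .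
  note le = norm_cut_le_frame_energy[OF this less_imp_le[OF q(1)]]
  show ?thesis
  proof (intro exI conjI allI impI)
    show "c k = 0" if "k < m" for k
      using that by (simp add: c_def)
    show "norm ((\<Sum>k<m + L. c k *\<^sub>R x k) o\<^sub>L cut K) < d"
      by (rule le_less_trans[OF le(1) q(2)])
    show "norm (cut K o\<^sub>L (\<Sum>k<m + L. c k *\<^sub>R x k)) < d"
      by (rule le_less_trans[OF le(2) q(2)])
  qed (fact norm1 L(1))+
qed

lemma almost_block:
  assumes d: "d > 0"
  shows "\<exists>m' K' c. m < m' \<and> K < K' \<and> (\<forall>k<m. c k = 0) \<and> (\<Sum>k<m'. \<bar>c k\<bar> powr r) = 1 \<and>
    ideal_norm ((\<Sum>k<m'. c k *\<^sub>R x k)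
      - (cut K' o\<^sub>L (cocut K o\<^sub>L (\<Sum>k<m'. c k *\<^sub>R x k) o\<^sub>L cocut K) o\<^sub>L cut K')) < d"
proof -
  define d' where "d' = d / (4 * (12 * real K + 1))"
  have d': "d' > 0" "real (4 * K) * (3 * d') < d / 4"
    using d by (simp_all add: d'_def field_simps)
  obtain c L where c: "\<forall>k<m. c k = 0" "(\<Sum>k<m + L. \<bar>c k\<bar> powr r) = 1" "L > 0"
    "norm ((\<Sum>k<m + L. c k *\<^sub>R x k) o\<^sub>L cut K) < d'" "norm (cut K o\<^sub>L (\<Sum>k<m + L. c k *\<^sub>R x k)) < d'"
    using flat_block[OF d'(1), of m K] by (elim exE conjE) (rule that)
  define y where "y = (\<Sum>k<m + L. c k *\<^sub>R x k)"
  define w where "w = (cut K o\<^sub>L y) + (cocut K o\<^sub>L (y o\<^sub>L cut K))"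
  have y: "y \<in> ideal"
    unfolding y_def by (rule sum_ideal)
  have y_w: "y - w = cocut K o\<^sub>L y o\<^sub>L cocut K"
    unfolding w_def by (rule blinfun_eqI)
      (simp add: blinfun.diff_left blinfun.add_left blinfun.diff_right linear_diff[OF linear_trunc])
  have "rank_le (2 * K + 2 * K) w"
    unfolding w_def by (intro rank_le_add rank_le_compose_left rank_le_compose_right rank_le_cut)
  then have rank: "rank_le (4 * K) w"
    by simp
  have "norm w \<le> norm (cut K o\<^sub>L y) + norm (y o\<^sub>L cut K)"
    unfolding w_def
    by (rule order.trans[OF norm_triangle_ineq]) (intro add_left_mono norm_compose_contraction_left norm_cocut_le)
  then have "norm w \<le> 3 * d'"
    using c(4,5) d'(1) unfolding y_def by linarith
  then have "real (4 * K) * norm w \<le> real (4 * K) * (3 * d')"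
    by (rule mult_left_mono) simp
  then have w: "w \<in> ideal" "ideal_norm w < d / 4"
    using ideal_finite_rank[OF rank] d'(2) by (simp, linarith)
  have yw: "y - w \<in> ideal"
    by (rule ideal_diff(1)[OF y w(1)])
  have "\<forall>\<^sub>F K' in sequentially. ideal_norm ((y - w) - (cut K' o\<^sub>L ((y - w) o\<^sub>L cut K'))) < d / 4 \<and> K < K'"
    using ideal_cut_approx[OF yw, of "d / 4"] eventually_gt_at_top[of K] d by (intro eventually_conj) auto
  then obtain K' where K': "ideal_norm ((y - w) - (cut K' o\<^sub>L ((y - w) o\<^sub>L cut K'))) < d / 4" "K < K'"
    using eventually_happens trivial_limit_sequentially by blast
  have assoc: "cut K' o\<^sub>L (cocut K o\<^sub>L y o\<^sub>L cocut K) o\<^sub>L cut K' = cut K' o\<^sub>L ((y - w) o\<^sub>L cut K')"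
    unfolding y_w by (rule blinfun_eqI) simp
  have "(y - w) - (cut K' o\<^sub>L ((y - w) o\<^sub>L cut K')) \<in> ideal"
    by (intro ideal_diff(1) yw ideal_finite_rank(1)[of "2 * K'"] rank_le_compose_right rank_le_cut)
  from ideal_add(2)[OF w(1) this]
  have "ideal_norm (y - (cut K' o\<^sub>L (cocut K o\<^sub>L y o\<^sub>L cocut K) o\<^sub>L cut K')) < d"
    unfolding assoc using w(2) K'(1) by simp
  then show ?thesis
    using c K'(2) unfolding y_def by (intro exI[of _ "m + L"] exI[of _ K'] exI[of _ c]) auto
qed

text \<open>
  Successive almost blocks, with errors decreasing geometrically, span \<open>\<ell>\<^sub>r\<close> because blocks of an
  \<open>\<ell>\<^sub>r\<close>-basis do. The errors are so small that the exactly block-diagonal operators do as well.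
\<close>

lemma lp_space_embeds_F: "isomorphically_embeds (lp_space r) (lp_norm r) F N"
proof -
  \<comment> \<open>the powers of 4 absorb the weights \<open>2 ^ Suc j\<close> of the sum, and \<open>a / 4\<close> leaves half of the lower
    bound after the quasinorm inequality has doubled the error\<close>
  define \<delta> where "\<delta> j = a / 4 / 4 ^ Suc j" for j :: nat
  have \<delta>: "\<delta> j > 0" for j
    using a by (simp add: \<delta>_def)
  define piece where "piece M' M y = cut M' o\<^sub>L (cocut M o\<^sub>L y o\<^sub>L cocut M) o\<^sub>L cut M'" for M' M y
  define Q where "Q j m M m' M' c \<longleftrightarrow> m < m' \<and> M < M' \<and> (\<forall>k<m. c k = 0) \<and> (\<Sum>k<m'. \<bar>c k\<bar> powr r) = 1 \<and>
      ideal_norm ((\<Sum>k<m'. c k *\<^sub>R x k) - piece M' M (\<Sum>k<m'. c k *\<^sub>R x k)) < \<delta> j" for j m M m' M' c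
  have "\<exists>m' M' c. Q j m M m' M' c" for j m M
    using almost_block[OF \<delta>, of m M j] by (simp only: Q_def piece_def)
  then obtain fm fM fc where step: "\<And>j m M. Q j m M (fm j m M) (fM j m M) (fc j m M)"
    by metis
  define st where "st = rec_nat (0, 0) (\<lambda>j (m, M). (fm j m M, fM j m M))"
  define m M where "m j = fst (st j)" and "M j = snd (st j)" for j
  define c where "c j = fc j (m j) (M j)" for j
  have m_Suc: "m (Suc j) = fm j (m j) (M j)" and M_Suc: "M (Suc j) = fM j (m j) (M j)" for j
    by (simp_all add: m_def M_def st_def split: prod.split)
  define y where "y j = (\<Sum>k<m (Suc j). c j k *\<^sub>R x k)" for j
  define z where "z j = piece (M (Suc j)) (M j) (y j)" for j
  have mono: "m j < m (Suc j)" "M j < M (Suc j)" and c: "k < m j \<Longrightarrow> c j k = 0"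
      "(\<Sum>k<m (Suc j). \<bar>c j k\<bar> powr r) = 1" and close: "ideal_norm (y j - z j) < \<delta> j" for j k
    using step[of j "m j" "M j"]
    unfolding Q_def m_Suc[symmetric] M_Suc[symmetric] c_def[symmetric] y_def[symmetric] z_def[symmetric]
    by simp_all
  have y: "y j \<in> ideal" for j
    unfolding y_def by (rule sum_ideal)
  have z_apply: "blinfun_apply (z j) u = trunc (M (Suc j)) (blinfun_apply (y j) (trunc (M (Suc j)) u - trunc (M j) u)
      - trunc (M j) (blinfun_apply (y j) (trunc (M (Suc j)) u - trunc (M j) u)))" for j u
    using mono(2)[of j] by (simp add: z_def piece_def trunc_trunc min_absorb1)
  have z: "z j \<in> ideal" for j
    unfolding z_def piece_def
    by (intro ideal_finite_rank(1)[of "2 * M (Suc j)"] rank_le_compose_right rank_le_cut)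
  interpret block_diagonal_ideal z M F N
  proof unfold_locales
    show "mono M"
      using mono(2) by (intro incseq_SucI) (simp add: less_imp_le)
    show "compact_operator (z j)" for j
      unfolding z_def piece_def y_def
      by (intro compact_operator_compose_left compact_operator_compose_contraction sum_compact norm_cut_le norm_cocut_le)
    show "blinfun_apply (z j) (trunc (M (Suc j)) u) = blinfun_apply (z j) u" for j u
      using mono(2)[of j] by (simp add: z_apply trunc_trunc min_absorb1)
    show "trunc (M (Suc j)) (blinfun_apply (z j) u) = blinfun_apply (z j) u" for j u
      by (simp add: z_apply)
    show "blinfun_apply (z j) (trunc (M j) u) = 0" for j u
      using mono(2)[of j] by (simp add: z_apply trunc_trunc min_absorb2 linear_0[OF linear_trunc])
    show "trunc (M j) (blinfun_apply (z j) u) = 0" for j u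
      using mono(2)[of j] by (simp add: z_apply trunc_trunc min_absorb1 min_absorb2
          linear_diff[OF linear_trunc] linear_0[OF linear_trunc])
  qed
  have combine: "\<exists>\<beta>. (\<Sum>k<m n. \<beta> k *\<^sub>R x k) = (\<Sum>j<n. e j *\<^sub>R y j) \<and>
      (\<Sum>k<m n. \<bar>\<beta> k\<bar> powr r) = (\<Sum>j<n. \<bar>e j\<bar> powr r)" for n and e :: "nat \<Rightarrow> real"
  proof (induction n)
    case 0
    show ?case
      by (simp add: m_def st_def)
  next
    case (Suc n)
    then obtain \<beta> where \<beta>: "(\<Sum>k<m n. \<beta> k *\<^sub>R x k) = (\<Sum>j<n. e j *\<^sub>R y j)"
      "(\<Sum>k<m n. \<bar>\<beta> k\<bar> powr r) = (\<Sum>j<n. \<bar>e j\<bar> powr r)"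
      by blast
    define \<beta>' where "\<beta>' k = (if k < m n then \<beta> k else e n * c n k)" for k
    have split: "(\<Sum>k<m (Suc n). f k) = (\<Sum>k<m n. f k) + (\<Sum>k\<in>{m n..<m (Suc n)}. f k)"
      for f :: "nat \<Rightarrow> 'z::comm_monoid_add"
      using sum.union_disjoint[of "{..<m n}" "{m n..<m (Suc n)}" f] mono(1)[of n]
      by (simp add: ivl_disj_un ivl_disj_int less_imp_le)
    have "y n = (\<Sum>k\<in>{m n..<m (Suc n)}. c n k *\<^sub>R x k)"
      unfolding y_def split by (simp add: c(1))
    then have "(\<Sum>k<m (Suc n). \<beta>' k *\<^sub>R x k) = (\<Sum>j<Suc n. e j *\<^sub>R y j)"
      unfolding split using \<beta>(1) by (simp add: \<beta>'_def scaleR_sum_right)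
    moreover have "(\<Sum>k\<in>{m n..<m (Suc n)}. \<bar>c n k\<bar> powr r) = 1"
      using c(2)[of n] unfolding split by (simp add: c(1))
    then have "(\<Sum>k<m (Suc n). \<bar>\<beta>' k\<bar> powr r) = (\<Sum>j<Suc n. \<bar>e j\<bar> powr r)"
      unfolding split using \<beta>(2) by (simp add: \<beta>'_def abs_mult powr_mult flip: sum_distrib_left)
    ultimately show ?case
      by blast
  qed
  have Y: "a * (\<Sum>j<n. \<bar>e j\<bar> powr r) powr (1 / r) \<le> ideal_norm (\<Sum>j<n. e j *\<^sub>R y j)"
    "ideal_norm (\<Sum>j<n. e j *\<^sub>R y j) \<le> b * (\<Sum>j<n. \<bar>e j\<bar> powr r) powr (1 / r)" for n e
  proof -
    obtain \<beta> where \<beta>: "(\<Sum>k<m n. \<beta> k *\<^sub>R x k) = (\<Sum>j<n. e j *\<^sub>R y j)"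
      "(\<Sum>k<m n. \<bar>\<beta> k\<bar> powr r) = (\<Sum>j<n. \<bar>e j\<bar> powr r)"
      using combine[of n e] by blast
    show "a * (\<Sum>j<n. \<bar>e j\<bar> powr r) powr (1 / r) \<le> ideal_norm (\<Sum>j<n. e j *\<^sub>R y j)"
      using lower[of \<beta> "m n"] unfolding \<beta> .
    show "ideal_norm (\<Sum>j<n. e j *\<^sub>R y j) \<le> b * (\<Sum>j<n. \<bar>e j\<bar> powr r) powr (1 / r)"
      using upper[of \<beta> "m n"] unfolding \<beta> .
  qed
  have error: "ideal_norm (\<Sum>j<n. e j *\<^sub>R (y j - z j)) \<le> a / 4 * (\<Sum>j<n. \<bar>e j\<bar> powr r) powr (1 / r)"
    for n and e :: "nat \<Rightarrow> real"
  proof -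
    define \<rho> where "\<rho> = (\<Sum>j<n. \<bar>e j\<bar> powr r) powr (1 / r)"
    have coeff: "\<bar>e j\<bar> \<le> \<rho>" if "j < n" for j
    proof -
      have "\<bar>e j\<bar> powr r \<le> (\<Sum>j<n. \<bar>e j\<bar> powr r)"
        using that by (intro member_le_sum) auto
      then have "(\<bar>e j\<bar> powr r) powr (1 / r) \<le> \<rho>"
        unfolding \<rho>_def using r by (intro powr_mono2) auto
      then show ?thesis
        using r by (simp add: powr_powr)
    qed
    have yz: "y j - z j \<in> ideal" for j
      by (rule ideal_diff(1)[OF y z])
    have "ideal_norm (\<Sum>j<n. e j *\<^sub>R (y j - z j)) \<le> (\<Sum>j<n. 2 ^ Suc j * ideal_norm (e j *\<^sub>R (y j - z j)))"
      by (intro ideal_norm_sum ideal_scaleR(1) yz)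
    also have "\<dots> \<le> (\<Sum>j<n. 2 ^ Suc j * (\<rho> * \<delta> j))"
      unfolding ideal_scaleR(2)[OF yz] using coeff close less_imp_le[OF \<delta>] ideal_norm_nonneg[OF yz]
      by (intro sum_mono mult_left_mono mult_mono) (auto simp: less_imp_le \<rho>_def)
    also have "\<dots> = a / 4 * \<rho> * (\<Sum>j<n. (1 / 2) ^ Suc j)"
    proof -
      have "2 ^ Suc j * (\<rho> * \<delta> j) = a / 4 * \<rho> * (1 / 2) ^ Suc j" for j
      proof -
        have "(4::real) ^ Suc j = 2 ^ Suc j * 2 ^ Suc j"
          by (simp flip: power_mult_distrib)
        then show ?thesis
          by (simp add: \<delta>_def power_one_over field_simps del: power_Suc)
      qed
      then show ?thesis
        by (simp only: sum_distrib_left)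
    qed
    also have "\<dots> \<le> a / 4 * \<rho> * 1"
    proof (rule mult_left_mono)
      have "(\<Sum>j<n. (1 / 2 :: real) ^ Suc j) = 1 - (1 / 2) ^ n"
        by (induction n) (simp_all add: field_simps)
      then show "(\<Sum>j<n. (1 / 2 :: real) ^ Suc j) \<le> 1"
        by simp
    qed (use a in \<open>simp add: \<rho>_def\<close>)
    finally show ?thesis
      by (simp add: \<rho>_def)
  qed
  show ?thesis
  proof (rule lp_space_embeds)
    show "0 < r" "0 < a / 4"
      using r a by simp_all
    fix n and e :: "nat \<Rightarrow> real"
    define \<rho> where "\<rho> = (\<Sum>j<n. \<bar>e j\<bar> powr r) powr (1 / r)"
    let ?Y = "\<Sum>j<n. e j *\<^sub>R y j" and ?Z = "\<Sum>j<n. e j *\<^sub>R z j" and ?D = "\<Sum>j<n. e j *\<^sub>R (y j - z j)"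
    have in_ideal: "?Y \<in> ideal" "?Z \<in> ideal" "?D \<in> ideal"
      by (intro ideal_sum ideal_scaleR(1) y z ideal_diff(1)[OF y z])+
    have eq: "?Y = ?Z + ?D" "?Z = ?Y - ?D"
      by (simp_all add: scaleR_diff_right sum_subtractf)
    have "ideal_norm ?Y \<le> 2 * ideal_norm ?Z + 2 * ideal_norm ?D"
      by (subst eq(1)) (rule ideal_add(2)[OF in_ideal(2,3)])
    then show "a / 4 * (\<Sum>j<n. \<bar>e j\<bar> powr r) powr (1 / r) \<le> ideal_norm ?Z"
      using Y(1)[of e n] error[of e n] by simp
    have "ideal_norm ?Z \<le> 2 * ideal_norm ?Y + 2 * ideal_norm ?D"
      by (subst eq(2)) (rule ideal_diff(2)[OF in_ideal(1,3)])
    also have "\<dots> \<le> 2 * (b * \<rho>) + 2 * (a / 4 * \<rho>)"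
      unfolding \<rho>_def by (intro add_mono mult_left_mono Y(2) error) auto
    finally show "ideal_norm ?Z \<le> (2 * b + a / 2) * (\<Sum>j<n. \<bar>e j\<bar> powr r) powr (1 / r)"
      by (simp add: \<rho>_def algebra_simps)
  qed
qed

end

section \<open>Sums of independent symmetric random variables\<close>

locale symmetric_family = prob_space +
  fixes X :: "nat \<Rightarrow> 'a \<Rightarrow> real"
  assumes indep: "indep_vars (\<lambda>_. borel) X UNIV"
    and symmetric_X: "\<And>k. distr M borel (\<lambda>\<omega>. - X k \<omega>) = distr M borel (X k)"
begin

lemma measurable_X [measurable]: "X k \<in> borel_measurable M"
  using indep by (auto simp: indep_vars_def)

lemma indep_partial_sum: "indep_var borel (\<lambda>\<omega>. c n * X n \<omega>) borel (\<lambda>\<omega>. \<Sum>k<n. c k * X k \<omega>)"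
proof -
  have "indep_vars (\<lambda>_. borel) (\<lambda>k \<omega>. c k * X k \<omega>) UNIV"
    by (rule indep_vars_compose2[OF indep]) simp
  then have "indep_vars (\<lambda>_. borel) (\<lambda>k \<omega>. c k * X k \<omega>) (insert n {..<n})"
    by (rule indep_vars_subset) simp
  then show ?thesis
    by (intro indep_vars_sum) auto
qed

lemma distr_uminus: "distr M borel (\<lambda>\<omega>. - (a * X k \<omega>)) = distr M borel (\<lambda>\<omega>. a * X k \<omega>)"
proof -
  have "distr M borel (\<lambda>\<omega>. - (a * X k \<omega>)) = distr (distr M borel (\<lambda>\<omega>. - X k \<omega>)) borel (\<lambda>x. a * x)"
    by (subst distr_distr) (auto simp: comp_def)
  also have "\<dots> = distr M borel (\<lambda>\<omega>. a * X k \<omega>)"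
    unfolding symmetric_X by (subst distr_distr) (auto simp: comp_def)
  finally show ?thesis .
qed

text \<open>The joint law of a partial sum and the next term is invariant under a sign change of the latter.\<close>

lemma nn_integral_flip:
  assumes [measurable]: "g \<in> borel_measurable borel"
  shows "(\<integral>\<^sup>+\<omega>. g ((\<Sum>k<n. c k * X k \<omega>) - c n * X n \<omega>) \<partial>M) = (\<integral>\<^sup>+\<omega>. g ((\<Sum>k<n. c k * X k \<omega>) + c n * X n \<omega>) \<partial>M)"
proof -
  let ?S = "\<lambda>\<omega>. \<Sum>k<n. c k * X k \<omega>" and ?Y = "\<lambda>\<omega>. c n * X n \<omega>"
  have "indep_var borel (uminus \<circ> ?Y) borel (id \<circ> ?S)"
    by (rule indep_var_compose[OF indep_partial_sum]) auto
  then have neg: "indep_var borel (\<lambda>\<omega>. - ?Y \<omega>) borel ?S"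
    by (simp add: comp_def)
  note joint = conjunct2[OF conjunct2[OF iffD1[OF indep_var_distribution_eq]]]
  have "distr M (borel \<Otimes>\<^sub>M borel) (\<lambda>\<omega>. (- ?Y \<omega>, ?S \<omega>)) = distr M borel (\<lambda>\<omega>. - ?Y \<omega>) \<Otimes>\<^sub>M distr M borel ?S"
    by (rule joint[OF neg, symmetric])
  also have "\<dots> = distr M (borel \<Otimes>\<^sub>M borel) (\<lambda>\<omega>. (?Y \<omega>, ?S \<omega>))"
    unfolding distr_uminus by (rule joint[OF indep_partial_sum])
  finally have eq: "distr M (borel \<Otimes>\<^sub>M borel) (\<lambda>\<omega>. (- ?Y \<omega>, ?S \<omega>)) = distr M (borel \<Otimes>\<^sub>M borel) (\<lambda>\<omega>. (?Y \<omega>, ?S \<omega>))" .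
  have "(\<integral>\<^sup>+\<omega>. g (?S \<omega> - ?Y \<omega>) \<partial>M) = (\<integral>\<^sup>+x. g (snd x + fst x) \<partial>distr M (borel \<Otimes>\<^sub>M borel) (\<lambda>\<omega>. (- ?Y \<omega>, ?S \<omega>)))"
    by (subst nn_integral_distr) auto
  also have "\<dots> = (\<integral>\<^sup>+\<omega>. g (?S \<omega> + ?Y \<omega>) \<partial>M)"
    unfolding eq by (subst nn_integral_distr) auto
  finally show ?thesis .
qed

text \<open>
  For \<open>\<Phi> s = s\<^sup>2\<close> this is the orthogonality of the terms. The proof for general \<open>\<Phi>\<close> replaces the
  parallelogram identity by an inequality.
\<close>

lemma nn_integral_sum_le:
  fixes \<Phi> :: "real \<Rightarrow> real"
  assumes [measurable]: "\<Phi> \<in> borel_measurable borel"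
    and \<Phi>: "\<And>s. 0 \<le> \<Phi> s" "\<Phi> 0 = 0" "\<And>s t. \<Phi> (s + t) + \<Phi> (s - t) \<le> 2 * \<Phi> s + 2 * \<Phi> t"
  shows "(\<integral>\<^sup>+\<omega>. ennreal (\<Phi> (\<Sum>k<n. c k * X k \<omega>)) \<partial>M) \<le> (\<Sum>k<n. \<integral>\<^sup>+\<omega>. ennreal (\<Phi> (c k * X k \<omega>)) \<partial>M)"
proof (induction n)
  case 0
  then show ?case
    by (simp add: \<Phi>(2))
next
  case (Suc n)
  let ?S = "\<lambda>\<omega>. \<Sum>k<n. c k * X k \<omega>" and ?Y = "\<lambda>\<omega>. c n * X n \<omega>"
  have "2 * (\<integral>\<^sup>+\<omega>. ennreal (\<Phi> (?S \<omega> + ?Y \<omega>)) \<partial>M)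
      = (\<integral>\<^sup>+\<omega>. ennreal (\<Phi> (?S \<omega> + ?Y \<omega>)) \<partial>M) + (\<integral>\<^sup>+\<omega>. ennreal (\<Phi> (?S \<omega> - ?Y \<omega>)) \<partial>M)"
    using nn_integral_flip[of "\<lambda>s. ennreal (\<Phi> s)" c n] by (simp add: mult_2)
  also have "\<dots> = (\<integral>\<^sup>+\<omega>. ennreal (\<Phi> (?S \<omega> + ?Y \<omega>) + \<Phi> (?S \<omega> - ?Y \<omega>)) \<partial>M)"
    by (subst nn_integral_add[symmetric]) (auto simp: \<Phi>(1) simp flip: ennreal_plus)
  also have "\<dots> \<le> (\<integral>\<^sup>+\<omega>. 2 * (ennreal (\<Phi> (?S \<omega>)) + ennreal (\<Phi> (?Y \<omega>))) \<partial>M)"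
  proof (rule nn_integral_mono)
    fix \<omega>
    have "ennreal (\<Phi> (?S \<omega> + ?Y \<omega>) + \<Phi> (?S \<omega> - ?Y \<omega>)) \<le> ennreal (2 * (\<Phi> (?S \<omega>) + \<Phi> (?Y \<omega>)))"
      using \<Phi>(3)[of "?S \<omega>" "?Y \<omega>"] by (intro ennreal_leI) simp
    also have "\<dots> = 2 * (ennreal (\<Phi> (?S \<omega>)) + ennreal (\<Phi> (?Y \<omega>)))"
      using \<Phi>(1) by (simp add: ennreal_mult)
    finally show "ennreal (\<Phi> (?S \<omega> + ?Y \<omega>) + \<Phi> (?S \<omega> - ?Y \<omega>)) \<le> 2 * (ennreal (\<Phi> (?S \<omega>)) + ennreal (\<Phi> (?Y \<omega>)))" .
  qed
  also have "\<dots> = 2 * ((\<integral>\<^sup>+\<omega>. ennreal (\<Phi> (?S \<omega>)) \<partial>M) + (\<integral>\<^sup>+\<omega>. ennreal (\<Phi> (?Y \<omega>)) \<partial>M))"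
    by (subst nn_integral_cmult) (auto simp: nn_integral_add)
  finally have "(\<integral>\<^sup>+\<omega>. ennreal (\<Phi> (?S \<omega> + ?Y \<omega>)) \<partial>M)
      \<le> (\<integral>\<^sup>+\<omega>. ennreal (\<Phi> (?S \<omega>)) \<partial>M) + (\<integral>\<^sup>+\<omega>. ennreal (\<Phi> (?Y \<omega>)) \<partial>M)"
    by (subst (asm) ennreal_mult_le_mult_iff) auto
  also have "\<dots> \<le> (\<Sum>k<n. \<integral>\<^sup>+\<omega>. ennreal (\<Phi> (c k * X k \<omega>)) \<partial>M) + (\<integral>\<^sup>+\<omega>. ennreal (\<Phi> (?Y \<omega>)) \<partial>M)"
    by (intro add_right_mono Suc)
  finally show ?case
    by simp
qed

lemma expectation_sin: "expectation (\<lambda>\<omega>. sin (a * X k \<omega>)) = 0"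
proof -
  have "expectation (\<lambda>\<omega>. sin (a * X k \<omega>)) = integral\<^sup>L (distr M borel (\<lambda>\<omega>. - (a * X k \<omega>))) sin"
    unfolding distr_uminus by (subst integral_distr) auto
  also have "\<dots> = - expectation (\<lambda>\<omega>. sin (a * X k \<omega>))"
    by (subst integral_distr) auto
  finally show ?thesis
    by simp
qed

lemma expectation_cos_sum:
  "expectation (\<lambda>\<omega>. cos (\<Sum>k<n. c k * X k \<omega>)) = (\<Prod>k<n. expectation (\<lambda>\<omega>. cos (c k * X k \<omega>)))"
proof (induction n)
  case 0
  then show ?case
    by (simp add: prob_space)
next
  case (Suc n)
  let ?S = "\<lambda>\<omega>. \<Sum>k<n. c k * X k \<omega>" and ?Y = "\<lambda>\<omega>. c n * X n \<omega>"
  have int: "integrable M (\<lambda>\<omega>. cos (?S \<omega>))" "integrable M (\<lambda>\<omega>. sin (?S \<omega>))"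
    "integrable M (\<lambda>\<omega>. cos (?Y \<omega>))" "integrable M (\<lambda>\<omega>. sin (?Y \<omega>))"
    by (auto intro!: integrable_const_bound[where B = 1])
  have "indep_var borel (cos \<circ> ?Y) borel (cos \<circ> ?S)" "indep_var borel (sin \<circ> ?Y) borel (sin \<circ> ?S)"
    by (auto intro!: indep_var_compose[OF indep_partial_sum])
  then have indep': "indep_var borel (\<lambda>\<omega>. cos (?Y \<omega>)) borel (\<lambda>\<omega>. cos (?S \<omega>))"
    "indep_var borel (\<lambda>\<omega>. sin (?Y \<omega>)) borel (\<lambda>\<omega>. sin (?S \<omega>))"
    by (simp_all add: comp_def)
  have "expectation (\<lambda>\<omega>. cos (?S \<omega> + ?Y \<omega>))
      = expectation (\<lambda>\<omega>. cos (?Y \<omega>) * cos (?S \<omega>) - sin (?Y \<omega>) * sin (?S \<omega>))"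
    by (simp add: cos_add mult.commute)
  also have "\<dots> = expectation (\<lambda>\<omega>. cos (?Y \<omega>) * cos (?S \<omega>)) - expectation (\<lambda>\<omega>. sin (?Y \<omega>) * sin (?S \<omega>))"
    by (intro Bochner_Integration.integral_diff indep_var_integrable[OF indep'(1)] indep_var_integrable[OF indep'(2)] int)
  also have "expectation (\<lambda>\<omega>. cos (?Y \<omega>) * cos (?S \<omega>)) = expectation (\<lambda>\<omega>. cos (?Y \<omega>)) * expectation (\<lambda>\<omega>. cos (?S \<omega>))"
    by (rule indep_var_lebesgue_integral[OF indep'(1) int(3,1)])
  also have "expectation (\<lambda>\<omega>. sin (?Y \<omega>) * sin (?S \<omega>)) = 0"
    unfolding indep_var_lebesgue_integral[OF indep'(2) int(4,2)] expectation_sin by simp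
  finally show ?case
    using Suc by simp
qed

text \<open>A sum is rarely close to 0 if its characteristic function at 1 is bounded away from 1.\<close>

lemma prob_sum_ge:
  assumes e: "0 < e" "\<And>k. k < n \<Longrightarrow> \<bar>expectation (\<lambda>\<omega>. cos (c k * X k \<omega>))\<bar> \<le> 1 - e * d k"
    and d: "\<And>k. 0 \<le> d k" "(\<Sum>k<n. d k) = 1"
  defines "\<gamma> \<equiv> 1 - exp (- e)"
  shows "\<gamma> / 4 \<le> prob {\<omega> \<in> space M. sqrt \<gamma> \<le> \<bar>\<Sum>k<n. c k * X k \<omega>\<bar>}"
proof -
  let ?S = "\<lambda>\<omega>. \<Sum>k<n. c k * X k \<omega>"
  define A where "A = {\<omega> \<in> space M. sqrt \<gamma> \<le> \<bar>?S \<omega>\<bar>}"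
  have [measurable]: "A \<in> sets M"
    unfolding A_def by measurable
  have \<gamma>: "0 < \<gamma>"
    using e(1) by (simp add: \<gamma>_def)
  have "expectation (\<lambda>\<omega>. cos (?S \<omega>)) \<le> (\<Prod>k<n. \<bar>expectation (\<lambda>\<omega>. cos (c k * X k \<omega>))\<bar>)"
    unfolding expectation_cos_sum abs_prod[symmetric] by (rule abs_ge_self)
  also have "\<dots> \<le> (\<Prod>k<n. exp (- (e * d k)))"
  proof (rule prod_mono)
    fix k assume "k \<in> {..<n}"
    then show "0 \<le> \<bar>expectation (\<lambda>\<omega>. cos (c k * X k \<omega>))\<bar> \<and> \<bar>expectation (\<lambda>\<omega>. cos (c k * X k \<omega>))\<bar> \<le> exp (- (e * d k))"
      using e(2)[of k] exp_ge_add_one_self[of "- (e * d k)"] by auto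
  qed
  also have "\<dots> = exp (- e)"
    using d(2) by (simp add: sum_negf flip: exp_sum sum_distrib_left)
  finally have cos_le: "expectation (\<lambda>\<omega>. cos (?S \<omega>)) \<le> 1 - \<gamma>"
    by (simp add: \<gamma>_def)
  have int: "integrable M (\<lambda>\<omega>. cos (?S \<omega>))"
    by (auto intro!: integrable_const_bound[where B = 1])
  have "\<gamma> \<le> expectation (\<lambda>\<omega>. 1 - cos (?S \<omega>))"
    using cos_le int by (simp add: prob_space)
  also have "\<dots> \<le> expectation (\<lambda>\<omega>. \<gamma> / 2 + 2 * indicator A \<omega>)"
  proof (rule integral_mono)
    fix \<omega> assume \<omega>: "\<omega> \<in> space M"
    show "1 - cos (?S \<omega>) \<le> \<gamma> / 2 + 2 * indicator A \<omega>"
    proof (cases "\<omega> \<in> A")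
      case True
      then have "indicator A \<omega> = (1 :: real)"
        by simp
      then show ?thesis
        using cos_ge_minus_one[of "?S \<omega>"] \<gamma> by linarith
    next
      case False
      then have "\<bar>?S \<omega>\<bar> \<le> sqrt \<gamma>"
        using \<omega> by (simp add: A_def)
      then have "(?S \<omega>)\<^sup>2 \<le> \<gamma>"
        using power_mono[of "\<bar>?S \<omega>\<bar>" "sqrt \<gamma>" 2] \<gamma> by simp
      moreover have "1 - cos (?S \<omega>) \<le> (?S \<omega>)\<^sup>2 / 2"
      proof -
        have "1 - cos (?S \<omega>) = 2 * (sin (?S \<omega> / 2))\<^sup>2"
          using cos_double_sin[of "?S \<omega> / 2"] by simp
        also have "\<dots> \<le> 2 * (?S \<omega> / 2)\<^sup>2"
          using iffD1[OF abs_le_square_iff abs_sin_x_le_abs_x[of "?S \<omega> / 2"]] by linarith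
        finally show ?thesis
          by (simp add: power_divide)
      qed
      ultimately show ?thesis
        using False by simp
    qed
  qed (use int \<gamma> in \<open>auto intro!: integrable_const_bound[where B = "\<gamma> / 2 + 2"] simp: indicator_def\<close>)
  also have "\<dots> = \<gamma> / 2 + 2 * prob A"
  proof -
    have "integrable M (\<lambda>\<omega>. 2 * indicator A \<omega> :: real)"
      by (rule integrable_const_bound[where B = 2]) (auto simp: indicator_def)
    then show ?thesis
      by (subst Bochner_Integration.integral_add) (simp_all add: prob_space)
  qed
  finally show ?thesis
    unfolding A_def by simp
qed

end

section \<open>A function adapted to power tails\<close>

text \<open>
  The function is \<open>\<bar>s\<bar> powr p\<close> for large \<open>s\<close>, where it controls the \<open>L\<^sub>p\<close>-norm, and \<open>s\<^sup>2\<close> for small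
  \<open>s\<close>. A variable \<open>X\<close> with \<open>r\<close>-tails, \<open>p < r < 2\<close>, is integrable at both ends, so that the expectation
  of \<open>mixed_power p (c * X)\<close> is of the order \<open>\<bar>c\<bar> powr r\<close>. The power \<open>p\<close> alone would give \<open>\<bar>c\<bar> powr p\<close>.
\<close>

definition mixed_power :: "real \<Rightarrow> real \<Rightarrow> real"
  where "mixed_power p s = min (s\<^sup>2) (\<bar>s\<bar> powr p)"

lemma powr_le_1_add_mixed_power:
  assumes "0 \<le> p" "p \<le> 2"
  shows "\<bar>s\<bar> powr p \<le> 1 + mixed_power p s"
proof (cases "\<bar>s\<bar> \<le> 1")
  case True
  then have "\<bar>s\<bar> powr p \<le> 1"
    using assms powr_mono2[of p "\<bar>s\<bar>" 1] by simp
  then show ?thesis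
    by (simp add: mixed_power_def add_increasing2)
next
  case False
  then have "\<bar>s\<bar> powr p \<le> \<bar>s\<bar> powr 2"
    using assms by (intro powr_mono) auto
  then show ?thesis
    using False by (simp add: mixed_power_def)
qed

lemma powr_midpoint_concave:
  fixes u v \<theta> :: real
  assumes u: "0 \<le> u" and v: "0 \<le> v" and \<theta>: "0 < \<theta>" "\<theta> \<le> 1"
  shows "u powr \<theta> + v powr \<theta> \<le> 2 * ((u + v) / 2) powr \<theta>"
proof -
  have zero: "u powr \<theta> \<le> 2 * (u / 2) powr \<theta>" if "0 \<le> u" for u :: real
  proof -
    have "(2::real) powr \<theta> \<le> 2"
      using powr_mono[of \<theta> 1 "2::real"] \<theta> by simp
    then have "u powr \<theta> * 2 powr \<theta> \<le> u powr \<theta> * 2"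
      by (intro mult_left_mono) auto
    then show ?thesis
      using that by (simp add: powr_divide field_simps)
  qed
  consider "u = 0" | "v = 0" | "u > 0" "v > 0"
    using u v by linarith
  then show ?thesis
  proof cases
    case 3
    have convex: "convex_on {0<..} (\<lambda>x::real. x powr (1 / \<theta>))"
      using \<theta> by (intro powr_convex) simp
    have "((u powr \<theta> + v powr \<theta>) / 2) powr (1 / \<theta>) \<le> (u + v) / 2"
      using convex_onD[OF convex, of "1 / 2" "u powr \<theta>" "v powr \<theta>"] 3 \<theta>
      by (simp add: powr_powr add_divide_distrib)
    then have "(((u powr \<theta> + v powr \<theta>) / 2) powr (1 / \<theta>)) powr \<theta> \<le> ((u + v) / 2) powr \<theta>"
      using \<theta> by (intro powr_mono2) auto
    then show ?thesis
      using 3 \<theta> by (simp add: powr_powr)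
  qed (use zero u v in auto)
qed

text \<open>
  In terms of \<open>t = s\<^sup>2\<close> this is \<open>min t (t powr (p / 2))\<close>, which is concave and subadditive.
\<close>

lemma mixed_power_parallelogram:
  assumes p: "0 < p" "p \<le> 2"
  shows "mixed_power p (s + t) + mixed_power p (s - t) \<le> 2 * mixed_power p s + 2 * mixed_power p t"
proof -
  define \<theta> where "\<theta> = p / 2"
  have \<theta>: "0 < \<theta>" "\<theta> \<le> 1"
    using p by (simp_all add: \<theta>_def)
  define \<psi> where "\<psi> u = min u (u powr \<theta>)" for u :: real
  have \<psi>: "mixed_power p a = \<psi> (a\<^sup>2)" for a
  proof (cases "a = 0")
    case False
    have "\<bar>a\<bar> powr 2 = a\<^sup>2"
      using False by simp
    then have "a\<^sup>2 powr \<theta> = \<bar>a\<bar> powr (2 * \<theta>)"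
      by (metis powr_powr)
    then show ?thesis
      by (simp add: mixed_power_def \<psi>_def \<theta>_def)
  qed (simp add: mixed_power_def \<psi>_def)
  have subadd: "\<psi> (u + v) \<le> \<psi> u + \<psi> v" if uv: "0 \<le> u" "0 \<le> v" for u v
  proof (cases "u = 0 \<or> v = 0")
    case False
    define \<mu> where "\<mu> w = min 1 (w powr (\<theta> - 1))" for w :: real
    have eq: "\<psi> w = w * \<mu> w" if "w > 0" for w
      using that by (simp add: \<psi>_def \<mu>_def min_mult_distrib_left powr_diff)
    have anti: "\<mu> w' \<le> \<mu> w" if "0 < w" "w \<le> w'" for w w'
      using that \<theta> powr_mono2'[of "\<theta> - 1" w w'] by (auto simp: \<mu>_def)
    have "\<psi> (u + v) = u * \<mu> (u + v) + v * \<mu> (u + v)"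
      using False uv by (simp add: eq distrib_right)
    also have "\<dots> \<le> u * \<mu> u + v * \<mu> v"
      using False uv by (intro add_mono mult_left_mono anti) auto
    finally show ?thesis
      using False uv by (simp add: eq)
  qed (auto simp: \<psi>_def)
  let ?a = "(s + t)\<^sup>2" and ?b = "(s - t)\<^sup>2"
  have mid: "(?a + ?b) / 2 = s\<^sup>2 + t\<^sup>2"
    by (simp add: power2_eq_square algebra_simps)
  have "\<psi> ?a + \<psi> ?b \<le> min (?a + ?b) (?a powr \<theta> + ?b powr \<theta>)"
    by (simp add: \<psi>_def min_def)
  also have "\<dots> \<le> min (2 * ((?a + ?b) / 2)) (2 * ((?a + ?b) / 2) powr \<theta>)"
    using powr_midpoint_concave[OF _ _ \<theta>, of ?a ?b] by (intro min.mono) auto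
  also have "\<dots> = 2 * \<psi> (s\<^sup>2 + t\<^sup>2)"
    unfolding mid by (simp add: \<psi>_def min_mult_distrib_left)
  also have "\<dots> \<le> 2 * \<psi> (s\<^sup>2) + 2 * \<psi> (t\<^sup>2)"
    using subadd[of "s\<^sup>2" "t\<^sup>2"] by simp
  finally show ?thesis
    unfolding \<psi> .
qed

lemma mixed_power_nonneg: "0 \<le> mixed_power p s"
  by (simp add: mixed_power_def)

lemma mixed_power_abs: "mixed_power p \<bar>s\<bar> = mixed_power p s"
  by (simp add: mixed_power_def)

lemma measurable_mixed_power [measurable]: "mixed_power p \<in> borel_measurable borel"
  unfolding mixed_power_def[abs_def] by measurable

section \<open>Independent variables with power tails\<close>

text \<open>
  A random sign and an independent exponent \<open>n\<close> with probability \<open>2 ^ (- n - 1)\<close>. The variable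
  \<open>\<plusminus> 2 powr (n / r)\<close> then has the tails of an \<open>r\<close>-stable variable, up to constants.
\<close>

definition step_pmf :: "(bool \<times> nat) pmf"
  where "step_pmf = pair_pmf (bernoulli_pmf (1 / 2)) (geometric_pmf (1 / 2))"

definition step_val :: "real \<Rightarrow> bool \<times> nat \<Rightarrow> real"
  where "step_val r x = (if fst x then 1 else - 1) * 2 powr (real (snd x) / r)"

definition step_seq :: "(nat \<Rightarrow> bool \<times> nat) measure"
  where "step_seq = PiM UNIV (\<lambda>_. measure_pmf step_pmf)"

lemma step_pmf_flip: "map_pmf (apfst Not) step_pmf = step_pmf"
proof -
  have "map_pmf Not (bernoulli_pmf (1 / 2)) = bernoulli_pmf (1 / 2)"
  proof (rule pmf_eqI)
    fix b
    have "pmf (map_pmf Not (bernoulli_pmf (1 / 2))) (Not (\<not> b)) = pmf (bernoulli_pmf (1 / 2)) (\<not> b)"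
      by (rule pmf_map_inj') (auto simp: inj_def)
    then show "pmf (map_pmf Not (bernoulli_pmf (1 / 2))) b = pmf (bernoulli_pmf (1 / 2)) b"
      by (cases b) simp_all
  qed
  then show ?thesis
    unfolding step_pmf_def by (simp add: pair_map_pmf1[symmetric])
qed

lemma nn_integral_step_pmf_even:
  assumes "\<And>t. g (- t) = g t"
  shows "(\<integral>\<^sup>+x. g (step_val r x) \<partial>step_pmf) = (\<Sum>n. ennreal ((1 / 2) ^ Suc n) * g (2 powr (real n / r)))"
proof -
  have "g (step_val r (b, n)) = g (2 powr (real n / r))" for b n
    by (simp add: step_val_def assms)
  then have "(\<integral>\<^sup>+x. g (step_val r x) \<partial>step_pmf) = (\<integral>\<^sup>+n. g (2 powr (real n / r)) \<partial>geometric_pmf (1 / 2))"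
    unfolding step_pmf_def nn_integral_pair_pmf' by (simp add: measure_pmf.emeasure_space_1)
  then show ?thesis
    by (simp add: nn_integral_measure_pmf nn_integral_count_space_nat mult.commute)
qed

lemma product_prob_space_step: "product_prob_space (\<lambda>_::nat. measure_pmf step_pmf)"
  by (rule product_prob_spaceI) (rule measure_pmf.prob_space_axioms)

lemma measurable_step_component [measurable]: "(\<lambda>\<omega>. \<omega> k) \<in> measurable step_seq (count_space UNIV)"
proof -
  have "(\<lambda>\<omega>. \<omega> k) \<in> measurable step_seq (measure_pmf step_pmf)"
    unfolding step_seq_def by (rule measurable_component_singleton) simp
  then show ?thesis
    by simp
qed

lemma distr_step_component: "distr step_seq (measure_pmf step_pmf) (\<lambda>\<omega>. \<omega> k) = measure_pmf step_pmf"
  unfolding step_seq_def by (rule distr_PiM_component) (auto intro: measure_pmf.prob_space_axioms)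

lemma nn_integral_step_component:
  "(\<integral>\<^sup>+\<omega>. g (\<omega> k) \<partial>step_seq) = (\<integral>\<^sup>+x. g x \<partial>step_pmf)"
proof -
  have "(\<integral>\<^sup>+x. g x \<partial>step_pmf) = (\<integral>\<^sup>+x. g x \<partial>distr step_seq (measure_pmf step_pmf) (\<lambda>\<omega>. \<omega> k))"
    by (simp only: distr_step_component)
  also have "\<dots> = (\<integral>\<^sup>+\<omega>. g (\<omega> k) \<partial>step_seq)"
    by (rule nn_integral_distr) simp_all
  finally show ?thesis
    by simp
qed

lemma symmetric_family_step: "symmetric_family step_seq (\<lambda>k \<omega>. step_val r (\<omega> k))"
proof -
  interpret product_prob_space "\<lambda>_::nat. measure_pmf step_pmf" UNIV
    by (rule product_prob_space_step)
  interpret prob_space step_seq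
    unfolding step_seq_def by (rule P.prob_space_axioms)
  have rv: "(\<lambda>\<omega>. \<omega> k) \<in> measurable step_seq (measure_pmf step_pmf)" for k
    by simp
  show ?thesis
  proof unfold_locales
    have "distr step_seq (PiM UNIV (\<lambda>_. measure_pmf step_pmf)) (\<lambda>x. \<lambda>i\<in>UNIV. x i)
        = PiM UNIV (\<lambda>i. distr step_seq (measure_pmf step_pmf) (\<lambda>\<omega>. \<omega> i))"
      unfolding distr_step_component restrict_UNIV by (simp add: step_seq_def)
    then have "indep_vars (\<lambda>_. measure_pmf step_pmf) (\<lambda>i \<omega>. \<omega> i) (UNIV :: nat set)"
      by (subst indep_vars_iff_distr_eq_PiM) (auto simp: rv)
    then show "indep_vars (\<lambda>_. borel) (\<lambda>k \<omega>. step_val r (\<omega> k)) UNIV"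
      by (rule indep_vars_compose2) simp
    fix k
    have component: "distr step_seq borel (\<lambda>\<omega>. h (\<omega> k)) = distr (measure_pmf step_pmf) borel h" for h :: "_ \<Rightarrow> real"
    proof -
      have "distr (distr step_seq (measure_pmf step_pmf) (\<lambda>\<omega>. \<omega> k)) borel h = distr step_seq borel (\<lambda>\<omega>. h (\<omega> k))"
        by (subst distr_distr) (auto simp: comp_def)
      then show ?thesis
        by (simp only: distr_step_component)
    qed
    have "distr (measure_pmf step_pmf) borel (step_val r)
        = distr (measure_pmf (map_pmf (apfst Not) step_pmf)) borel (step_val r)"
      by (simp only: step_pmf_flip)
    also have "\<dots> = distr (measure_pmf step_pmf) borel (\<lambda>x. - step_val r x)"
    proof -
      have "(\<lambda>x. step_val r (apfst Not x)) = (\<lambda>x. - step_val r x)"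
        by (auto simp: step_val_def)
      then show ?thesis
        unfolding map_pmf_rep_eq by (subst distr_distr) (auto simp: comp_def)
    qed
    finally show "distr step_seq borel (\<lambda>\<omega>. - step_val r (\<omega> k)) = distr step_seq borel (\<lambda>\<omega>. step_val r (\<omega> k))"
      using component[of "\<lambda>x. - step_val r x"] component[of "step_val r"] by simp
  qed
qed

lemma dyadic_level:
  fixes A :: real
  assumes "0 < A" "A \<le> 1"
  obtains J :: nat where "2 ^ J * A \<le> 1" "1 < 2 ^ Suc J * A"
proof -
  define K where "K = (LEAST k. 1 < 2 ^ k * A)"
  obtain k where "1 / A < 2 ^ k"
    using real_arch_pow[of 2 "1 / A"] by auto
  then have "1 < 2 ^ k * A"
    using assms(1) by (simp add: field_simps)
  then have K: "1 < 2 ^ K * A"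
    unfolding K_def by (rule LeastI)
  then have "K \<noteq> 0"
    using assms(2) by (intro notI) simp
  then obtain J where J: "K = Suc J"
    by (cases K) auto
  then have "\<not> 1 < 2 ^ J * A"
    using not_less_Least[of J "\<lambda>k. 1 < 2 ^ k * A"] by (simp add: K_def)
  then show ?thesis
    using that[of J] K J by simp
qed

lemma geometric_sum_le:
  fixes x :: real
  assumes "0 \<le> x" "x < 1"
  shows "(\<Sum>i<n. x ^ i) \<le> 1 / (1 - x)"
  using assms by (simp add: sum_gp_strict divide_right_mono)

text \<open>
  Let \<open>A = \<bar>c\<bar> powr r\<close>. The summands of the expectation of \<open>\<lambda>x. mixed_power p (c * x)\<close> are \<open>A / 2\<close> times
  \<open>min ((2 ^ n * A) powr (2 / r - 1)) ((2 ^ n * A) powr (p / r - 1))\<close>. Since \<open>p < r < 2\<close>, they decrease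
  geometrically on both sides of the index where \<open>2 ^ n * A\<close> passes 1.
\<close>

lemma mixed_power_step_le:
  assumes p: "0 < p" "p < r" "r < 2"
  shows "\<exists>C\<ge>0. \<forall>c. \<bar>c\<bar> \<le> 1 \<longrightarrow>
    (\<integral>\<^sup>+x. ennreal (mixed_power p (c * step_val r x)) \<partial>step_pmf) \<le> ennreal (C * \<bar>c\<bar> powr r)"
proof -
  define \<alpha> \<beta> where "\<alpha> = 2 / r - 1" and "\<beta> = 1 - p / r"
  have \<alpha>\<beta>: "0 < \<alpha>" "0 < \<beta>"
    using p by (simp_all add: \<alpha>_def \<beta>_def field_simps)
  define \<rho> \<sigma> :: real where "\<rho> = 2 powr (- \<alpha>)" and "\<sigma> = 2 powr (- \<beta>)"
  have \<rho>\<sigma>: "0 \<le> \<rho>" "\<rho> < 1" "0 \<le> \<sigma>" "\<sigma> < 1"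
    using \<alpha>\<beta> powr_less_mono[of "- \<alpha>" 0 "2::real"] powr_less_mono[of "- \<beta>" 0 "2::real"]
    by (simp_all add: \<rho>_def \<sigma>_def)
  define C where "C = 1 / (1 - \<rho>) + 1 / (1 - \<sigma>)"
  have "0 \<le> C"
    using \<rho>\<sigma> by (simp add: C_def)
  have "(\<integral>\<^sup>+x. ennreal (mixed_power p (c * step_val r x)) \<partial>step_pmf) \<le> ennreal (C * \<bar>c\<bar> powr r)"
    if c: "\<bar>c\<bar> \<le> 1" for c
  proof (cases "c = 0")
    case True
    then show ?thesis
      by (simp add: mixed_power_def)
  next
    case False
    define A where "A = \<bar>c\<bar> powr r"
    have A: "0 < A" "A \<le> 1"
      using False c p powr_mono2[of r "\<bar>c\<bar>" 1] by (simp_all add: A_def)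
    obtain J where J: "2 ^ J * A \<le> 1" "1 < 2 ^ Suc J * A"
      by (rule dyadic_level[OF A])
    define h where "h n = (if n \<le> J then \<rho> ^ (J - n) else \<sigma> ^ (n - Suc J))" for n
    have h_nonneg: "0 \<le> h n" for n
      using \<rho>\<sigma> by (simp add: h_def)
    have term_le: "(1 / 2) ^ Suc n * mixed_power p (c * 2 powr (real n / r)) \<le> A * h n" for n
    proof -
      define u where "u = 2 ^ n * A"
      have u: "0 < u"
        using A by (simp add: u_def)
      have "\<bar>c * 2 powr (real n / r)\<bar> = u powr (1 / r)"
      proof -
        have "u powr (1 / r) = (2 powr real n) powr (1 / r) * A powr (1 / r)"
          using A by (simp add: u_def powr_mult powr_realpow)
        also have "A powr (1 / r) = \<bar>c\<bar>"
          using p by (simp add: A_def powr_powr)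
        finally show ?thesis
          by (simp add: abs_mult powr_powr)
      qed
      then have "mixed_power p (c * 2 powr (real n / r)) = min ((u powr (1 / r)) powr 2) ((u powr (1 / r)) powr p)"
        using u by (subst mixed_power_abs[symmetric]) (simp add: mixed_power_def)
      also have "\<dots> = min (u * u powr \<alpha>) (u * u powr (- \<beta>))"
      proof -
        have "(u powr (1 / r)) powr 2 = u powr (1 + \<alpha>)" "(u powr (1 / r)) powr p = u powr (1 + - \<beta>)"
          by (simp_all add: powr_powr \<alpha>_def \<beta>_def)
        then show ?thesis
          using u by (simp only: powr_add powr_one)
      qed
      also have "\<dots> \<le> u * h n"
      proof (cases "n \<le> J")
        case True
        have "(2::real) ^ J = 2 ^ (J - n) * 2 ^ n"
          using True by (simp flip: power_add)
        then have "u \<le> 1 / 2 ^ (J - n)"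
          using J(1) by (simp add: u_def field_simps)
        then have "u powr \<alpha> \<le> (1 / 2 ^ (J - n)) powr \<alpha>"
          using u \<alpha>\<beta> by (intro powr_mono2) auto
        also have "\<dots> = \<rho> ^ (J - n)"
          by (simp add: \<rho>_def powr_divide powr_minus_divide powr_power power_one_over flip: powr_realpow)
            (simp add: powr_powr mult.commute)
        finally have "u * u powr \<alpha> \<le> u * h n"
          using True u by (simp add: h_def)
        then show ?thesis
          by linarith
      next
        case False
        have "(2::real) ^ n = 2 ^ (n - Suc J) * 2 ^ Suc J"
          using False by (simp flip: power_add power_Suc)
        then have eq: "u = 2 ^ (n - Suc J) * (2 ^ Suc J * A)"
          by (simp add: u_def)
        have "2 ^ (n - Suc J) \<le> u"
          unfolding eq using J(2) by (simp add: mult_left_mono)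
        then have "u powr (- \<beta>) \<le> (2 ^ (n - Suc J)) powr (- \<beta>)"
          using \<alpha>\<beta> by (intro powr_mono2') auto
        also have "\<dots> = \<sigma> ^ (n - Suc J)"
          by (simp add: \<sigma>_def powr_power flip: powr_realpow) (simp add: powr_powr mult.commute)
        finally have "u * u powr (- \<beta>) \<le> u * h n"
          using False u by (simp add: h_def)
        then show ?thesis
          by linarith
      qed
      finally have "(1 / 2) ^ Suc n * mixed_power p (c * 2 powr (real n / r)) \<le> (1 / 2) ^ Suc n * (u * h n)"
        by (intro mult_left_mono) auto
      also have "(1 / 2) ^ Suc n * (u * h n) = A * h n / 2"
        by (simp add: u_def power_one_over field_simps)
      also have "\<dots> \<le> A * h n"
        using A h_nonneg[of n] by simp
      finally show ?thesis .
    qed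
    have sum_h: "(\<Sum>n<m. h n) \<le> C" for m
    proof -
      have "(\<Sum>n<m. h n) \<le> (\<Sum>n<Suc J + m. h n)"
        using h_nonneg by (intro sum_mono2) auto
      also have "\<dots> = (\<Sum>n<Suc J. h n) + (\<Sum>n<m. h (Suc J + n))"
        by (induction m) simp_all
      also have "(\<Sum>n<Suc J. h n) = (\<Sum>n<Suc J. \<rho> ^ (Suc J - Suc n))"
        by (rule sum.cong) (auto simp: h_def)
      also have "\<dots> = (\<Sum>n<Suc J. \<rho> ^ n)"
        by (rule sum.nat_diff_reindex)
      also have "(\<Sum>n<m. h (Suc J + n)) = (\<Sum>n<m. \<sigma> ^ n)"
        by (rule sum.cong) (auto simp: h_def)
      also have "(\<Sum>n<Suc J. \<rho> ^ n) + (\<Sum>n<m. \<sigma> ^ n) \<le> C"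
        unfolding C_def using \<rho>\<sigma> by (intro add_mono geometric_sum_le)
      finally show ?thesis .
    qed
    have even: "ennreal (mixed_power p (c * - t)) = ennreal (mixed_power p (c * t))" for t
      by (simp add: mixed_power_def)
    have "(\<integral>\<^sup>+x. ennreal (mixed_power p (c * step_val r x)) \<partial>step_pmf)
        = (\<Sum>n. ennreal ((1 / 2) ^ Suc n) * ennreal (mixed_power p (c * 2 powr (real n / r))))"
      by (rule nn_integral_step_pmf_even[of "\<lambda>t. ennreal (mixed_power p (c * t))", OF even])
    also have "\<dots> \<le> ennreal (C * A)"
      unfolding suminf_eq_SUP
    proof (rule SUP_least)
      fix m
      have "(\<Sum>n<m. ennreal ((1 / 2) ^ Suc n) * ennreal (mixed_power p (c * 2 powr (real n / r))))
          \<le> (\<Sum>n<m. ennreal (A * h n))"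
        by (intro sum_mono) (simp only: ennreal_mult[symmetric] mixed_power_nonneg zero_le_power
            zero_le_divide_1_iff zero_le_numeral ennreal_leI term_le)
      also have "\<dots> = ennreal (A * (\<Sum>n<m. h n))"
        using A h_nonneg by (simp add: sum_distrib_left)
      also have "\<dots> \<le> ennreal (C * A)"
        using A sum_h[of m] by (intro ennreal_leI) (simp add: mult.commute mult_left_mono)
      finally show "(\<Sum>n<m. ennreal ((1 / 2) ^ Suc n) * ennreal (mixed_power p (c * 2 powr (real n / r)))) \<le> ennreal (C * A)" .
    qed
    finally show ?thesis
      by (simp add: A_def)
  qed
  with \<open>0 \<le> C\<close> show ?thesis
    by (intro exI[of _ C] conjI allI impI)
qed

text \<open>
  The variable \<open>c * step_val r x\<close> lies in \<open>{1..2}\<close> in absolute value with probability of the order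
  \<open>\<bar>c\<bar> powr r\<close>, and there \<open>\<bar>cos\<bar>\<close> is bounded away from 1, as \<open>2 < pi\<close>.
\<close>

lemma expectation_cos_step_le:
  assumes r: "1 \<le> r"
  shows "\<exists>e>0. \<forall>c k. \<bar>c\<bar> \<le> 1 \<longrightarrow>
    \<bar>prob_space.expectation step_seq (\<lambda>\<omega>. cos (c * step_val r (\<omega> k)))\<bar> \<le> 1 - e * \<bar>c\<bar> powr r"
proof -
  interpret symmetric_family step_seq "\<lambda>k \<omega>. step_val r (\<omega> k)"
    by (rule symmetric_family_step)
  define \<kappa> where "\<kappa> = 1 - max (cos 1) (- cos (2::real))"
  have "cos 2 > cos pi"
    using pi_gt3 by (intro cos_monotone_0_pi) auto
  moreover have "cos 1 < cos (0::real)"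
    using pi_gt3 by (intro cos_monotone_0_pi) auto
  ultimately have \<kappa>: "0 < \<kappa>"
    by (simp add: \<kappa>_def)
  have cos_le: "\<bar>cos t\<bar> \<le> 1 - \<kappa>" if "1 \<le> t" "t \<le> 2" for t
    using that pi_gt3 cos_monotone_0_pi_le[of 1 t] cos_monotone_0_pi_le[of t 2] by (auto simp: \<kappa>_def)
  have "\<bar>expectation (\<lambda>\<omega>. cos (c * step_val r (\<omega> k)))\<bar> \<le> 1 - \<kappa> / 4 * \<bar>c\<bar> powr r"
    if c: "\<bar>c\<bar> \<le> 1" for c k
  proof (cases "c = 0")
    case True
    then show ?thesis
      by (simp add: prob_space)
  next
    case False
    define A where "A = \<bar>c\<bar> powr r"
    have A: "0 < A" "A \<le> 1"
      using False c r powr_mono2[of r "\<bar>c\<bar>" 1] by (simp_all add: A_def)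
    obtain J where J: "2 ^ J * A \<le> 1" "1 < 2 ^ Suc J * A"
      by (rule dyadic_level[OF A])
    define t where "t = \<bar>c\<bar> * 2 powr (real (Suc J) / r)"
    have t: "t = (2 ^ Suc J * A) powr (1 / r)"
    proof -
      have "(2 ^ Suc J * A) powr (1 / r) = (2 powr real (Suc J)) powr (1 / r) * A powr (1 / r)"
        using A by (simp add: powr_mult powr_realpow del: power_Suc of_nat_Suc)
      also have "A powr (1 / r) = \<bar>c\<bar>"
        using r by (simp add: A_def powr_powr)
      finally show ?thesis
        by (simp add: t_def powr_powr)
    qed
    have "1 \<le> t"
      unfolding t using J(2) r by (intro ge_one_powr_ge_zero) auto
    moreover have "t \<le> 2"
    proof -
      have "t \<le> (2::real) powr (1 / r)"
        unfolding t using J A r by (intro powr_mono2) auto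
      also have "\<dots> \<le> 2 powr 1"
        using r by (intro powr_mono) auto
      finally show ?thesis
        by simp
    qed
    ultimately have cos_t: "\<kappa> \<le> 1 - \<bar>cos t\<bar>"
      using cos_le[of t] by simp
    let ?g = "\<lambda>x. 1 - \<bar>cos (c * x)\<bar>"
    have g: "0 \<le> ?g x" for x
      by simp
    have g_even: "ennreal (?g (- x)) = ennreal (?g x)" for x
      by simp
    have "ennreal (A / 4 * \<kappa>) \<le> ennreal ((1 / 2) ^ Suc (Suc J)) * ennreal (?g (2 powr (real (Suc J) / r)))"
    proof -
      have "A / 4 \<le> (1 / 2) ^ Suc (Suc J)"
        using J(1) by (simp add: power_one_over field_simps)
      moreover have "\<kappa> \<le> ?g (2 powr (real (Suc J) / r))"
        using cos_t unfolding t_def by (cases "c \<ge> 0") auto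
      ultimately have "A / 4 * \<kappa> \<le> (1 / 2) ^ Suc (Suc J) * ?g (2 powr (real (Suc J) / r))"
        using A \<kappa> by (intro mult_mono) auto
      then have "ennreal (A / 4 * \<kappa>) \<le> ennreal ((1 / 2) ^ Suc (Suc J) * ?g (2 powr (real (Suc J) / r)))"
        by (rule ennreal_leI)
      also have "\<dots> = ennreal ((1 / 2) ^ Suc (Suc J)) * ennreal (?g (2 powr (real (Suc J) / r)))"
        by (rule ennreal_mult) (simp, rule g)
      finally show ?thesis .
    qed
    also have "\<dots> = (\<Sum>n\<in>{Suc J}. ennreal ((1 / 2) ^ Suc n) * ennreal (?g (2 powr (real n / r))))"
      by simp
    also have "\<dots> \<le> (\<Sum>n. ennreal ((1 / 2) ^ Suc n) * ennreal (?g (2 powr (real n / r))))"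
      by (rule sum_le_suminf) auto
    also have "\<dots> = (\<integral>\<^sup>+x. ennreal (?g (step_val r x)) \<partial>step_pmf)"
      by (rule nn_integral_step_pmf_even[of "\<lambda>x. ennreal (?g x)", OF g_even, symmetric])
    also have "\<dots> = (\<integral>\<^sup>+\<omega>. ennreal (?g (step_val r (\<omega> k))) \<partial>step_seq)"
      by (rule nn_integral_step_component[symmetric])
    also have "\<dots> = ennreal (expectation (\<lambda>\<omega>. ?g (step_val r (\<omega> k))))"
      by (intro nn_integral_eq_integral integrable_const_bound[where B = 1]) auto
    finally have "A / 4 * \<kappa> \<le> expectation (\<lambda>\<omega>. ?g (step_val r (\<omega> k)))"
      by (subst (asm) ennreal_le_iff) (auto intro!: integral_nonneg_AE)
    also have "\<dots> = 1 - expectation (\<lambda>\<omega>. \<bar>cos (c * step_val r (\<omega> k))\<bar>)"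
    proof -
      have "integrable step_seq (\<lambda>\<omega>. \<bar>cos (c * step_val r (\<omega> k))\<bar>)"
        by (rule integrable_const_bound[where B = 1]) auto
      then show ?thesis
        by (subst Bochner_Integration.integral_diff) (simp_all add: prob_space)
    qed
    finally have "A / 4 * \<kappa> \<le> 1 - expectation (\<lambda>\<omega>. \<bar>cos (c * step_val r (\<omega> k))\<bar>)" .
    moreover have "\<kappa> / 4 * \<bar>c\<bar> powr r = A / 4 * \<kappa>"
      by (simp add: A_def)
    ultimately show ?thesis
      using integral_abs_bound[of step_seq "\<lambda>\<omega>. cos (c * step_val r (\<omega> k))"] by linarith
  qed
  moreover have "0 < \<kappa> / 4"
    using \<kappa> by simp
  ultimately show ?thesis
    by (intro exI[of _ "\<kappa> / 4"] conjI allI impI)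
qed

section \<open>Transfer to the unit interval\<close>

lemma floor_base_4:
  fixes b :: "nat \<Rightarrow> bool"
  shows "\<lfloor>4 ^ Suc m * (\<Sum>i. of_bool (b i) / (4::real) ^ Suc i)\<rfloor> mod 4 = of_bool (b m)"
proof -
  define f where "f i = of_bool (b i) / (4::real) ^ Suc i" for i
  have geo: "(\<lambda>i. (1 / 4 :: real) ^ Suc i) sums (1 / 3)"
    using sums_mult[OF geometric_sums[of "1 / 4 :: real"], of "1 / 4"] by simp
  have le: "0 \<le> of_bool q / (4::real) ^ Suc i" "of_bool q / (4::real) ^ Suc i \<le> (1 / 4) ^ Suc i" for q i
    by (simp_all add: power_one_over divide_right_mono)
  have summable: "summable (\<lambda>i. of_bool (q i) / (4::real) ^ Suc i)" for q
    by (rule summable_comparison_test'[OF sums_summable[OF geo]]) (use le in simp)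
  define t where "t = (\<Sum>i. of_bool (b (i + Suc m)) / (4::real) ^ Suc i)"
  have t: "0 \<le> t" "t < 1"
  proof -
    show "0 \<le> t"
      unfolding t_def by (rule suminf_nonneg[OF summable le(1)])
    have "t \<le> (\<Sum>i. (1 / 4 :: real) ^ Suc i)"
      unfolding t_def by (rule suminf_le[OF le(2) summable sums_summable[OF geo]])
    then show "t < 1"
      using sums_unique[OF geo] by simp
  qed
  define d :: int where "d = (\<Sum>i<m. of_bool (b i) * 4 ^ (m - i)) + of_bool (b m)"
  have "(\<Sum>i. f i) = (\<Sum>i. f (i + Suc m)) + (\<Sum>i<Suc m. f i)"
    unfolding f_def by (rule suminf_split_initial_segment[OF summable])
  then have "4 ^ Suc m * (\<Sum>i. f i) = 4 ^ Suc m * (\<Sum>i. f (i + Suc m)) + (\<Sum>i<Suc m. 4 ^ Suc m * f i)"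
    by (simp only: distrib_left sum_distrib_left)
  also have "4 ^ Suc m * (\<Sum>i. f (i + Suc m)) = t"
  proof -
    have "4 ^ Suc m * f (i + Suc m) = of_bool (b (i + Suc m)) / (4::real) ^ Suc i" for i
      by (simp add: f_def power_add)
    moreover have "summable (\<lambda>i. f (i + Suc m))"
      unfolding f_def using summable[of b] by (rule summable_ignore_initial_segment)
    ultimately show ?thesis
      unfolding t_def by (subst suminf_mult[symmetric]) simp_all
  qed
  also have "(\<Sum>i<Suc m. 4 ^ Suc m * f i) = real_of_int d"
  proof -
    have "4 ^ Suc m * f i = of_bool (b i) * 4 ^ (m - i)" if "i < m" for i
    proof -
      have "(4::real) ^ Suc m = 4 ^ (m - i) * 4 ^ Suc i"
        using that by (simp flip: power_add power_Suc)
      then show ?thesis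
        by (simp add: f_def)
    qed
    then show ?thesis
      by (simp add: d_def) (simp add: f_def)
  qed
  finally have "\<lfloor>4 ^ Suc m * (\<Sum>i. f i)\<rfloor> = d"
    using t by (intro floor_unique) simp_all
  moreover have "d mod 4 = of_bool (b m)"
  proof -
    have "4 dvd (\<Sum>i<m. of_bool (b i) * 4 ^ (m - i) :: int)"
      by (intro dvd_sum dvd_mult) (simp add: dvd_power)
    then have "d mod 4 = of_bool (b m) mod 4"
      unfolding d_def by (metis mod_add_left_eq add_0 dvd_imp_mod_0)
    then show ?thesis
      by (simp add: of_bool_def)
  qed
  ultimately show ?thesis
    by (simp add: f_def)
qed

text \<open>
  A sequence of values of a countable type is coded into one real number, through the base 4 digits
  of which it can be read off by Borel functions. The quantile function of the law of this number
  then carries the whole independent sequence over to \<open>{0<..<1}\<close>.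
\<close>

definition code :: "(nat \<Rightarrow> bool \<times> nat) \<Rightarrow> real"
  where "code \<omega> = (\<Sum>i. of_bool (case prod_decode i of (k, j) \<Rightarrow> to_nat (\<omega> k) = j) / 4 ^ Suc i)"

definition decode :: "real \<Rightarrow> nat \<Rightarrow> real \<Rightarrow> real"
  where "decode r k y = (\<Sum>j. of_bool (\<lfloor>4 ^ Suc (prod_encode (k, j)) * y\<rfloor> mod 4 = 1) * step_val r (from_nat j))"

lemma measurable_code [measurable]: "code \<in> borel_measurable step_seq"
proof -
  have "(\<lambda>\<omega>. of_bool (case prod_decode i of (k, j) \<Rightarrow> to_nat (\<omega> k) = j) / (4::real) ^ Suc i) \<in> borel_measurable step_seq" for i
  proof -
    obtain k j where kj: "prod_decode i = (k, j)"
      by fastforce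
    have "(\<lambda>x. of_bool (to_nat x = j) / (4::real) ^ Suc i) \<in> measurable (count_space UNIV) borel"
      by simp
    from measurable_compose[OF measurable_step_component[of k] this] show ?thesis
      by (simp add: kj)
  qed
  then show ?thesis
    unfolding code_def[abs_def] by (rule borel_measurable_suminf)
qed

lemma measurable_decode [measurable]: "decode r k \<in> borel_measurable borel"
  unfolding decode_def[abs_def] by measurable

lemma decode_code: "decode r k (code \<omega>) = step_val r (\<omega> k)"
proof -
  have "of_bool (\<lfloor>4 ^ Suc (prod_encode (k, j)) * code \<omega>\<rfloor> mod 4 = 1) = (of_bool (to_nat (\<omega> k) = j) :: real)" for j
    unfolding code_def floor_base_4 by simp
  then have "decode r k (code \<omega>) = (\<Sum>j. of_bool (to_nat (\<omega> k) = j) * step_val r (from_nat j))"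
    by (simp add: decode_def)
  also have "\<dots> = (\<Sum>j\<in>{to_nat (\<omega> k)}. of_bool (to_nat (\<omega> k) = j) * step_val r (from_nat j))"
    by (rule suminf_finite) auto
  finally show ?thesis
    by simp
qed

lemma nn_integral_lebesgue_on_unit:
  "(\<integral>\<^sup>+x. g x \<partial>lebesgue_on {0<..<1::real}) = (\<integral>\<^sup>+x. g x \<partial>restrict_space lborel {0<..<1})"
  by (subst (1 2) nn_integral_restrict_space) (simp_all add: nn_integral_completion)

lemma exists_step_functions:
  "\<exists>f :: nat \<Rightarrow> real \<Rightarrow> real. (\<forall>k. f k \<in> borel_measurable borel) \<and>
    (\<forall>n c. \<forall>g :: real \<Rightarrow> ennreal. g \<in> borel_measurable borel \<longrightarrow>
      (\<integral>\<^sup>+x. g (\<Sum>k<n. c k * f k x) \<partial>lebesgue_on {0<..<1})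
        = (\<integral>\<^sup>+\<omega>. g (\<Sum>k<n. c k * step_val r (\<omega> k)) \<partial>step_seq))"
proof -
  interpret symmetric_family step_seq "\<lambda>k \<omega>. step_val r (\<omega> k)"
    by (rule symmetric_family_step)
  define \<nu> where "\<nu> = distr step_seq borel code"
  interpret \<nu>: prob_space \<nu>
    unfolding \<nu>_def by (rule prob_space_distr) simp
  interpret \<nu>: cdf_distribution \<nu>
    by unfold_locales (simp add: \<nu>_def)
  \<comment> \<open>the quantile function of \<open>\<nu>\<close>\<close>
  define Q where "Q \<omega> = Inf {x. \<omega> \<le> cdf \<nu> x}" for \<omega>
  have Q: "Q \<in> borel_measurable (restrict_space borel {0<..<1})" "distr (restrict_space lborel {0<..<1}) borel Q = \<nu>"
    unfolding Q_def[abs_def] by (rule \<nu>.measurable_CI, rule \<nu>.distr_I_eq_M)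
  define f where "f k x = (if x \<in> {0<..<1} then decode r k (Q x) else 0)" for k x
  show ?thesis
  proof (intro exI[of _ f] conjI allI impI)
    show "f k \<in> borel_measurable borel" for k
    proof -
      have "(\<lambda>x. decode r k (Q x)) \<in> borel_measurable (restrict_space borel {0<..<1})"
        by (rule measurable_compose[OF Q(1) measurable_decode])
      then show ?thesis
        unfolding f_def[abs_def] by (subst (asm) borel_measurable_restrict_space_iff) (auto simp: if_distrib mult.commute
            intro: measurable_cong[THEN iffD1, rotated])
    qed
    fix n c and g :: "real \<Rightarrow> ennreal"
    assume [measurable]: "g \<in> borel_measurable borel"
    have "(\<integral>\<^sup>+x. g (\<Sum>k<n. c k * f k x) \<partial>lebesgue_on {0<..<1})
        = (\<integral>\<^sup>+x. g (\<Sum>k<n. c k * f k x) \<partial>restrict_space lborel {0<..<1})"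
      by (rule nn_integral_lebesgue_on_unit)
    also have "\<dots> = (\<integral>\<^sup>+x. g (\<Sum>k<n. c k * decode r k (Q x)) \<partial>restrict_space lborel {0<..<1})"
      by (rule nn_integral_cong) (simp add: space_restrict_space f_def)
    also have "\<dots> = (\<integral>\<^sup>+y. g (\<Sum>k<n. c k * decode r k y) \<partial>distr (restrict_space lborel {0<..<1}) borel Q)"
      using Q(1) by (subst nn_integral_distr) (simp_all cong: measurable_cong_sets)
    also have "\<dots> = (\<integral>\<^sup>+\<omega>. g (\<Sum>k<n. c k * step_val r (\<omega> k)) \<partial>step_seq)"
      unfolding Q(2) \<nu>_def by (subst nn_integral_distr) (simp_all add: decode_code)
    finally show "(\<integral>\<^sup>+x. g (\<Sum>k<n. c k * f k x) \<partial>lebesgue_on {0<..<1})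
        = (\<integral>\<^sup>+\<omega>. g (\<Sum>k<n. c k * step_val r (\<omega> k)) \<partial>step_seq)" .
  qed
qed

lemma exists_lr_functions:
  assumes p: "1 \<le> p" "p < r" "r < 2"
  shows "\<exists>f :: nat \<Rightarrow> real \<Rightarrow> real. \<exists>\<eta>>0. \<exists>\<delta>>0. \<exists>K\<ge>0. (\<forall>k. f k \<in> borel_measurable borel) \<and>
    (\<forall>n c. (\<Sum>k<n. \<bar>c k\<bar> powr r) = 1 \<longrightarrow>
      (\<integral>\<^sup>+x. ennreal (\<bar>\<Sum>k<n. c k * f k x\<bar> powr p) \<partial>lebesgue_on {0<..<1}) \<le> ennreal K \<and>
      ennreal \<delta> \<le> emeasure (lebesgue_on {0<..<1}) {x \<in> {0<..<1}. \<eta> \<le> \<bar>\<Sum>k<n. c k * f k x\<bar>})"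
proof -
  interpret symmetric_family step_seq "\<lambda>k \<omega>. step_val r (\<omega> k)"
    by (rule symmetric_family_step)
  obtain f :: "nat \<Rightarrow> real \<Rightarrow> real" where f': "\<forall>k. f k \<in> borel_measurable borel"
    and transfer': "\<forall>n c. \<forall>g :: real \<Rightarrow> ennreal. g \<in> borel_measurable borel \<longrightarrow>
      (\<integral>\<^sup>+x. g (\<Sum>k<n. c k * f k x) \<partial>lebesgue_on {0<..<1})
        = (\<integral>\<^sup>+\<omega>. g (\<Sum>k<n. c k * step_val r (\<omega> k)) \<partial>step_seq)"
    using exists_step_functions[of r] by (elim exE conjE) (rule that)
  note transfer = transfer'[rule_format]
  have f [measurable]: "f k \<in> borel_measurable borel" for k
    by (rule f'[rule_format])
  have p01: "0 < p" "1 \<le> r"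
    using p by simp_all
  obtain C where C: "0 \<le> C" "\<forall>c. \<bar>c\<bar> \<le> 1 \<longrightarrow>
    (\<integral>\<^sup>+x. ennreal (mixed_power p (c * step_val r x)) \<partial>step_pmf) \<le> ennreal (C * \<bar>c\<bar> powr r)"
    using mixed_power_step_le[OF p01(1) p(2,3)] by (elim exE conjE) (rule that)
  obtain e where e: "0 < e" "\<forall>c k. \<bar>c\<bar> \<le> 1 \<longrightarrow>
    \<bar>expectation (\<lambda>\<omega>. cos (c * step_val r (\<omega> k)))\<bar> \<le> 1 - e * \<bar>c\<bar> powr r"
    using expectation_cos_step_le[OF p01(2)] by (elim exE conjE) (rule that)
  define \<gamma> where "\<gamma> = 1 - exp (- e)"
  have \<gamma>: "0 < \<gamma>"
    using e(1) by (simp add: \<gamma>_def)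
  have c_le: "\<bar>c k\<bar> \<le> 1" if "(\<Sum>k<n. \<bar>c k\<bar> powr r) = 1" "k < n" for c :: "nat \<Rightarrow> real" and k n
  proof -
    have "\<bar>c k\<bar> powr r \<le> (\<Sum>k<n. \<bar>c k\<bar> powr r)"
      using that(2) by (intro member_le_sum) auto
    then have "(\<bar>c k\<bar> powr r) powr (1 / r) \<le> 1 powr (1 / r)"
      unfolding that(1) using p by (intro powr_mono2) auto
    then show ?thesis
      using p by (simp add: powr_powr)
  qed
  have pos: "0 < sqrt \<gamma>" "0 < \<gamma> / 4" "0 \<le> 1 + C"
    using \<gamma> C(1) by auto
  show ?thesis
  proof (rule exI[of _ f], rule exI[of _ "sqrt \<gamma>"], rule conjI[OF pos(1)], rule exI[of _ "\<gamma> / 4"],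
      rule conjI[OF pos(2)], rule exI[of _ "1 + C"], rule conjI[OF pos(3)], intro conjI allI impI)
    show "f k \<in> borel_measurable borel" for k
      by (rule f)
    fix n and c :: "nat \<Rightarrow> real" assume c: "(\<Sum>k<n. \<bar>c k\<bar> powr r) = 1"
    let ?S = "\<lambda>\<omega>. \<Sum>k<n. c k * step_val r (\<omega> k)"
    have "(\<integral>\<^sup>+x. ennreal (\<bar>\<Sum>k<n. c k * f k x\<bar> powr p) \<partial>lebesgue_on {0<..<1}) = (\<integral>\<^sup>+\<omega>. ennreal (\<bar>?S \<omega>\<bar> powr p) \<partial>step_seq)"
      by (rule transfer) simp
    also have "\<dots> \<le> (\<integral>\<^sup>+\<omega>. 1 + ennreal (mixed_power p (?S \<omega>)) \<partial>step_seq)"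
    proof (rule nn_integral_mono)
      fix \<omega>
      have "ennreal (\<bar>?S \<omega>\<bar> powr p) \<le> ennreal (1 + mixed_power p (?S \<omega>))"
        using p by (intro ennreal_leI powr_le_1_add_mixed_power) auto
      then show "ennreal (\<bar>?S \<omega>\<bar> powr p) \<le> 1 + ennreal (mixed_power p (?S \<omega>))"
        by (simp add: mixed_power_nonneg)
    qed
    also have "\<dots> = 1 + (\<integral>\<^sup>+\<omega>. ennreal (mixed_power p (?S \<omega>)) \<partial>step_seq)"
      by (subst nn_integral_add) (simp_all add: emeasure_space_1)
    also have "(\<integral>\<^sup>+\<omega>. ennreal (mixed_power p (?S \<omega>)) \<partial>step_seq)
        \<le> (\<Sum>k<n. \<integral>\<^sup>+\<omega>. ennreal (mixed_power p (c k * step_val r (\<omega> k))) \<partial>step_seq)"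
      by (rule nn_integral_sum_le)
        (use p mixed_power_parallelogram in \<open>auto simp: mixed_power_nonneg, simp add: mixed_power_def\<close>)
    also have "\<dots> \<le> (\<Sum>k<n. ennreal (C * \<bar>c k\<bar> powr r))"
    proof (rule sum_mono)
      fix k assume "k \<in> {..<n}"
      then show "(\<integral>\<^sup>+\<omega>. ennreal (mixed_power p (c k * step_val r (\<omega> k))) \<partial>step_seq) \<le> ennreal (C * \<bar>c k\<bar> powr r)"
        using C(2)[rule_format] c_le[OF c] by (subst nn_integral_step_component) simp
    qed
    also have "\<dots> = ennreal C"
      using C(1) c by (simp add: sum_distrib_left[symmetric])
    finally show "(\<integral>\<^sup>+x. ennreal (\<bar>\<Sum>k<n. c k * f k x\<bar> powr p) \<partial>lebesgue_on {0<..<1}) \<le> ennreal (1 + C)"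
      using C(1) by simp
    have "\<gamma> / 4 \<le> prob {\<omega> \<in> space step_seq. sqrt \<gamma> \<le> \<bar>?S \<omega>\<bar>}"
      unfolding \<gamma>_def
      by (rule prob_sum_ge[OF e(1), of n c "\<lambda>k. \<bar>c k\<bar> powr r"]) (use e(2)[rule_format] c_le[OF c] c in auto)
    then have "ennreal (\<gamma> / 4) \<le> emeasure step_seq {\<omega> \<in> space step_seq. sqrt \<gamma> \<le> \<bar>?S \<omega>\<bar>}"
      by (simp add: emeasure_eq_measure)
    also have "\<dots> = (\<integral>\<^sup>+\<omega>. indicator {s. sqrt \<gamma> \<le> \<bar>s\<bar>} (?S \<omega>) \<partial>step_seq)"
    proof -
      have "{\<omega> \<in> space step_seq. sqrt \<gamma> \<le> \<bar>?S \<omega>\<bar>} \<in> sets step_seq"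
        by measurable
      then have "emeasure step_seq {\<omega> \<in> space step_seq. sqrt \<gamma> \<le> \<bar>?S \<omega>\<bar>}
          = (\<integral>\<^sup>+\<omega>. indicator {\<omega> \<in> space step_seq. sqrt \<gamma> \<le> \<bar>?S \<omega>\<bar>} \<omega> \<partial>step_seq)"
        by (rule nn_integral_indicator[symmetric])
      also have "\<dots> = (\<integral>\<^sup>+\<omega>. indicator {s. sqrt \<gamma> \<le> \<bar>s\<bar>} (?S \<omega>) \<partial>step_seq)"
        by (rule nn_integral_cong) (simp add: indicator_def)
      finally show ?thesis .
    qed
    also have "\<dots> = (\<integral>\<^sup>+x. indicator {s. sqrt \<gamma> \<le> \<bar>s\<bar>} (\<Sum>k<n. c k * f k x) \<partial>lebesgue_on {0<..<1})"
      by (rule transfer[symmetric]) simp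
    also have "\<dots> = (\<integral>\<^sup>+x. indicator {x \<in> {0<..<1}. sqrt \<gamma> \<le> \<bar>\<Sum>k<n. c k * f k x\<bar>} x \<partial>lebesgue_on {0<..<1})"
      by (rule nn_integral_cong) (auto simp: indicator_def)
    also have "\<dots> = emeasure (lebesgue_on {0<..<1}) {x \<in> {0<..<1}. sqrt \<gamma> \<le> \<bar>\<Sum>k<n. c k * f k x\<bar>}"
    proof (rule nn_integral_indicator)
      have "{x \<in> {0<..<1}. sqrt \<gamma> \<le> \<bar>\<Sum>k<n. c k * f k x\<bar>} \<in> sets borel"
        by measurable
      then show "{x \<in> {0<..<1}. sqrt \<gamma> \<le> \<bar>\<Sum>k<n. c k * f k x\<bar>} \<in> sets (lebesgue_on {0<..<1})"
        by (subst sets_restrict_space_iff) auto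
    qed
    finally show "ennreal (\<gamma> / 4) \<le> emeasure (lebesgue_on {0<..<1}) {x \<in> {0<..<1}. sqrt \<gamma> \<le> \<bar>\<Sum>k<n. c k * f k x\<bar>}" .
  qed
qed

section \<open>Symmetric function spaces containing \<open>L\<^sub>p\<close>\<close>

locale symmetric_fun_space =
  fixes E :: "(real \<Rightarrow> real) set" and N :: "(real \<Rightarrow> real) \<Rightarrow> real"
  assumes symmetric: "symmetric_function_space E N"
begin

abbreviation unit_measure :: "real measure"
  where "unit_measure \<equiv> lebesgue_on {0<..<1}"

lemma banach: "banach_function_space unit_measure E N"
  using symmetric by (simp add: symmetric_function_space_def symmetric_space_def)

lemma norm_scale: "f \<in> E \<Longrightarrow> N (c *\<^sub>R f) = \<bar>c\<bar> * N f"
  and norm_nonneg: "f \<in> E \<Longrightarrow> 0 \<le> N f"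
  and norm_eq_0: "f \<in> E \<Longrightarrow> N f = 0 \<longleftrightarrow> (AE x in unit_measure. f x = 0)"
  and subspace_E: "subspace E"
  using banach by (auto simp: banach_function_space_def)

lemma lattice:
  assumes "f \<in> E" "g \<in> borel_measurable unit_measure" "AE x in unit_measure. \<bar>g x\<bar> \<le> \<bar>f x\<bar>"
  shows "g \<in> E" "N g \<le> N f"
proof -
  have "\<forall>f\<in>E. \<forall>g\<in>borel_measurable unit_measure. (AE x in unit_measure. \<bar>g x\<bar> \<le> \<bar>f x\<bar>) \<longrightarrow> g \<in> E \<and> N g \<le> N f"
    using symmetric unfolding symmetric_function_space_def symmetric_space_def by blast
  then show "g \<in> E" "N g \<le> N f"
    using assms by blast+
qed

lemma equimeasurable:
  assumes "f \<in> E" "g \<in> borel_measurable unit_measure" "rearrangement unit_measure g = rearrangement unit_measure f"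
  shows "N g = N f"
proof -
  have "\<forall>f\<in>E. \<forall>g\<in>borel_measurable unit_measure.
      rearrangement unit_measure g = rearrangement unit_measure f \<longrightarrow> g \<in> E \<and> N g = N f"
    using symmetric unfolding symmetric_function_space_def symmetric_space_def by blast
  then show ?thesis
    using assms by blast
qed

lemma indicator_E:
  assumes "A \<in> sets unit_measure"
  shows "indicator A \<in> E"
proof (rule lattice(1))
  show "indicator {0..1} \<in> E"
    using symmetric by (simp add: symmetric_function_space_def)
  show "indicator A \<in> borel_measurable unit_measure"
    using assms by simp
  have "A \<subseteq> {0<..<1}"
    using sets.sets_into_space[OF assms] by simp
  then show "AE x in unit_measure. \<bar>indicator A x :: real\<bar> \<le> \<bar>indicator {0..1} x\<bar>"
    by (intro AE_I2) (auto simp: indicator_def)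
qed

lemma emeasure_unit_initial: "0 \<le> d \<Longrightarrow> d \<le> 1 \<Longrightarrow> emeasure unit_measure {0<..<d} = ennreal d"
  by (subst emeasure_restrict_space) auto

lemma initial_sets: "d \<le> 1 \<Longrightarrow> {0<..<d} \<in> sets unit_measure"
  by (subst sets_restrict_space_iff) auto

text \<open>By symmetry the norm of an indicator depends on the measure of the set only.\<close>

lemma norm_indicator_ge:
  assumes A: "A \<in> sets unit_measure" "ennreal d \<le> emeasure unit_measure A" and d: "0 < d"
  shows "N (indicator {0<..<d}) \<le> N (indicator A)"
proof -
  have "emeasure unit_measure A \<le> emeasure unit_measure (space unit_measure)"
    by (rule emeasure_mono[OF sets.sets_into_space[OF A(1)]]) simp
  also have "\<dots> = 1"
    by (subst emeasure_restrict_space) auto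
  finally have le1: "emeasure unit_measure A \<le> 1" .
  then obtain a where a: "emeasure unit_measure A = ennreal a" "0 \<le> a"
    by (cases "emeasure unit_measure A") (auto simp: top_unique)
  have ad: "d \<le> a" "a \<le> 1"
    using A(2) le1 a d by (auto simp: ennreal_le_iff)
  let ?I = "{0<..<a}"
  have "rearrangement unit_measure (indicator ?I) = rearrangement unit_measure (indicator A)"
  proof (rule rearrangement_cong)
    fix s :: real assume s: "0 \<le> s"
    have level: "{x \<in> space unit_measure. s < \<bar>indicator B x\<bar>} = (if s < 1 then B else {})"
      if "B \<in> sets unit_measure" for B
      using sets.sets_into_space[OF that] s by (auto simp: indicator_def)
    show "emeasure unit_measure {x \<in> space unit_measure. s < \<bar>indicator ?I x\<bar>}
        = emeasure unit_measure {x \<in> space unit_measure. s < \<bar>indicator A x\<bar>}"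
      unfolding level[OF initial_sets[OF ad(2)]] level[OF A(1)]
      using ad a by (simp add: emeasure_unit_initial)
  qed
  then have "N (indicator ?I) = N (indicator A)"
    using indicator_E[OF A(1)] initial_sets[OF ad(2)] by (intro equimeasurable) auto
  moreover have "N (indicator {0<..<d}) \<le> N (indicator ?I)"
    using ad initial_sets[of d] by (intro lattice(2) indicator_E initial_sets AE_I2) (auto simp: indicator_def)
  ultimately show ?thesis
    by simp
qed

lemma norm_indicator_pos:
  assumes "0 < d" "d \<le> 1"
  shows "0 < N (indicator {0<..<d})"
proof -
  have I: "indicator {0<..<d} \<in> E"
    by (rule indicator_E[OF initial_sets[OF assms(2)]])
  have "N (indicator {0<..<d}) \<noteq> 0"
  proof
    assume "N (indicator {0<..<d}) = 0"
    then have "AE x in unit_measure. indicator {0<..<d} x = (0::real)"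
      using norm_eq_0[OF I] by simp
    then have "AE x in unit_measure. x \<notin> {0<..<d}"
      by eventually_elim (auto simp: indicator_def)
    then have "emeasure unit_measure {0<..<d} = 0"
      using initial_sets[OF assms(2)] assms(2) by (subst (asm) AE_iff_measurable[of "{0<..<d}"]) auto
    then show False
      using assms by (simp add: emeasure_unit_initial)
  qed
  then show ?thesis
    using norm_nonneg[OF I] by simp
qed

text \<open>
  The inclusion of \<open>L\<^sub>p\<close> is automatically bounded: if \<open>f n\<close> is in the unit ball of \<open>L\<^sub>p\<close> with norm in
  \<open>E\<close> at least \<open>4 ^ n\<close>, then \<open>(\<Sum>n. \<bar>f n\<bar> powr p / 2 ^ Suc n) powr (1 / p)\<close> is in \<open>L\<^sub>p\<close> and
  dominates all \<open>\<bar>f n\<bar> / 2 ^ Suc n\<close>, the norms of which are unbounded.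
\<close>

lemma Lp_bound:
  assumes p: "1 \<le> p" and sub: "Lp_space unit_measure p \<subseteq> E"
  shows "\<exists>C. \<forall>f\<in>borel_measurable unit_measure.
    (\<integral>\<^sup>+x. ennreal (\<bar>f x\<bar> powr p) \<partial>unit_measure) \<le> 1 \<longrightarrow> f \<in> E \<and> N f \<le> C"
proof (rule ccontr)
  define U where "U = {f \<in> borel_measurable unit_measure. (\<integral>\<^sup>+x. ennreal (\<bar>f x\<bar> powr p) \<partial>unit_measure) \<le> 1}"
  have in_Lp: "f \<in> E" if "f \<in> borel_measurable unit_measure" "(\<integral>\<^sup>+x. ennreal (\<bar>f x\<bar> powr p) \<partial>unit_measure) < \<infinity>" for f
  proof -
    have "integrable unit_measure (\<lambda>x. \<bar>f x\<bar> powr p)"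
      using that by (intro integrableI_bounded) auto
    then show ?thesis
      using that(1) sub by (auto simp: Lp_space_def)
  qed
  have U_E: "f \<in> E" if "f \<in> U" for f
    using that by (intro in_Lp) (auto simp: U_def less_top[symmetric] top_unique)
  assume neg: "\<nexists>C. \<forall>f\<in>borel_measurable unit_measure.
    (\<integral>\<^sup>+x. ennreal (\<bar>f x\<bar> powr p) \<partial>unit_measure) \<le> 1 \<longrightarrow> f \<in> E \<and> N f \<le> C"
  have "\<exists>f\<in>U. C < N f" for C
  proof (rule ccontr)
    assume "\<not> (\<exists>f\<in>U. C < N f)"
    then have U_C: "f \<in> E \<and> N f \<le> C" if "f \<in> U" for f
      using U_E[OF that] that by (auto simp: not_less)
    have "\<exists>C. \<forall>f\<in>borel_measurable unit_measure.
        (\<integral>\<^sup>+x. ennreal (\<bar>f x\<bar> powr p) \<partial>unit_measure) \<le> 1 \<longrightarrow> f \<in> E \<and> N f \<le> C"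
      by (rule exI[of _ C], intro ballI impI, rule U_C) (simp add: U_def)
    then show False
      by (rule notE[OF neg])
  qed
  then have "\<exists>f\<in>U. 4 ^ n < N f" for n :: nat
    by blast
  then obtain f where f: "\<And>n::nat. f n \<in> U" "\<And>n. 4 ^ n < N (f n)"
    by metis
  have [measurable]: "f n \<in> borel_measurable unit_measure" for n
    using f(1) by (simp add: U_def)
  define h where "h x = (\<Sum>n. ennreal ((1 / 2) ^ Suc n) * ennreal (\<bar>f n x\<bar> powr p))" for x
  have [measurable]: "h \<in> borel_measurable unit_measure"
    unfolding h_def[abs_def] by measurable
  have h_int: "(\<integral>\<^sup>+x. h x \<partial>unit_measure) \<le> 1"
  proof -
    have "(\<integral>\<^sup>+x. h x \<partial>unit_measure) = (\<Sum>n. \<integral>\<^sup>+x. ennreal ((1 / 2) ^ Suc n) * ennreal (\<bar>f n x\<bar> powr p) \<partial>unit_measure)"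
      unfolding h_def by (rule nn_integral_suminf) measurable
    also have "\<dots> \<le> (\<Sum>n. ennreal ((1 / 2) ^ Suc n))"
    proof (rule suminf_le)
      fix n
      have "(\<integral>\<^sup>+x. ennreal ((1 / 2) ^ Suc n) * ennreal (\<bar>f n x\<bar> powr p) \<partial>unit_measure)
          = ennreal ((1 / 2) ^ Suc n) * (\<integral>\<^sup>+x. ennreal (\<bar>f n x\<bar> powr p) \<partial>unit_measure)"
        by (rule nn_integral_cmult) measurable
      also have "\<dots> \<le> ennreal ((1 / 2) ^ Suc n) * 1"
        using f(1)[of n] by (intro mult_left_mono) (auto simp: U_def)
      finally show "(\<integral>\<^sup>+x. ennreal ((1 / 2) ^ Suc n) * ennreal (\<bar>f n x\<bar> powr p) \<partial>unit_measure) \<le> ennreal ((1 / 2) ^ Suc n)"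
        by simp
    qed auto
    also have "\<dots> = 1"
      by (subst suminf_ennreal_eq[OF _ power_half_series]) (simp_all del: power_Suc)
    finally show ?thesis .
  qed
  have "AE x in unit_measure. h x \<noteq> \<infinity>"
    using h_int by (intro nn_integral_noteq_infinite) (auto simp: top_unique)
  define H where "H x = (enn2real (h x)) powr (1 / p)" for x
  have H_powr: "\<bar>H x\<bar> powr p = enn2real (h x)" for x
    using p by (simp add: H_def powr_powr)
  have [measurable]: "H \<in> borel_measurable unit_measure"
    unfolding H_def[abs_def] by measurable
  have "H \<in> E"
  proof (rule in_Lp)
    have "(\<integral>\<^sup>+x. ennreal (\<bar>H x\<bar> powr p) \<partial>unit_measure) \<le> (\<integral>\<^sup>+x. h x \<partial>unit_measure)"
      unfolding H_powr by (intro nn_integral_mono) (simp add: ennreal_enn2real_if)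
    also note h_int
    finally show "(\<integral>\<^sup>+x. ennreal (\<bar>H x\<bar> powr p) \<partial>unit_measure) < \<infinity>"
      by (simp add: less_top[symmetric] top_unique) (auto simp: top_unique)
  qed measurable
  have "2 ^ n \<le> 2 * N H" for n :: nat
  proof -
    have "AE x in unit_measure. \<bar>((1 / 2) ^ Suc n *\<^sub>R f n) x\<bar> \<le> \<bar>H x\<bar>"
      using \<open>AE x in unit_measure. h x \<noteq> \<infinity>\<close>
    proof eventually_elim
      case (elim x)
      have "ennreal ((1 / 2) ^ Suc n * \<bar>f n x\<bar> powr p)
          = (\<Sum>n\<in>{n}. ennreal ((1 / 2) ^ Suc n) * ennreal (\<bar>f n x\<bar> powr p))"
        by (subst ennreal_mult) (simp_all del: power_Suc)
      also have "\<dots> \<le> h x"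
        unfolding h_def by (rule sum_le_suminf) auto
      finally have "(1 / 2) ^ Suc n * \<bar>f n x\<bar> powr p \<le> enn2real (h x)"
        using elim by (cases "h x") auto
      moreover have "((1 / 2) ^ Suc n * \<bar>f n x\<bar>) powr p \<le> (1 / 2) ^ Suc n * \<bar>f n x\<bar> powr p"
      proof -
        have "((1 / 2 :: real) ^ Suc n) powr p \<le> ((1 / 2) ^ Suc n) powr 1"
          using p by (intro powr_mono') (auto simp: power_le_one simp del: power_Suc)
        then have "((1 / 2) ^ Suc n) powr p * \<bar>f n x\<bar> powr p \<le> ((1 / 2) ^ Suc n) powr 1 * \<bar>f n x\<bar> powr p"
          by (rule mult_right_mono) simp
        then show ?thesis
          by (simp add: powr_mult del: power_Suc)
      qed
      ultimately have "((1 / 2) ^ Suc n * \<bar>f n x\<bar>) powr p \<le> \<bar>H x\<bar> powr p"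
        unfolding H_powr by linarith
      then have "(1 / 2) ^ Suc n * \<bar>f n x\<bar> \<le> \<bar>H x\<bar>"
        using p powr_less_mono2[of p "\<bar>H x\<bar>" "(1 / 2) ^ Suc n * \<bar>f n x\<bar>"] by force
      then show ?case
        by (simp add: scaleR_fun_def abs_mult)
    qed
    moreover have "((1 / 2) ^ Suc n *\<^sub>R f n) \<in> borel_measurable unit_measure"
      by (simp add: scaleR_fun_def)
    ultimately have "N ((1 / 2) ^ Suc n *\<^sub>R f n) \<le> N H"
      using lattice(2)[OF \<open>H \<in> E\<close>] by blast
    then have "(1 / 2) ^ Suc n * N (f n) \<le> N H"
      using norm_scale[OF U_E[OF f(1)], of "(1 / 2) ^ Suc n" n] by simp
    moreover have "(1 / 2) ^ Suc n * 4 ^ n \<le> (1 / 2) ^ Suc n * N (f n)"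
      using f(2)[of n] by (intro mult_left_mono) auto
    moreover have "(1 / 2 :: real) ^ Suc n * 4 ^ n = 2 ^ n / 2"
      by (simp flip: power_mult_distrib)
    ultimately show ?thesis
      by linarith
  qed
  moreover obtain n where "2 * N H < 2 ^ n"
    using real_arch_pow[of 2 "2 * N H"] by auto
  ultimately show False
    by (metis not_less)
qed

lemma lr_basis:
  assumes p: "1 \<le> p" "p < r" "r < 2" and sub: "Lp_space unit_measure p \<subseteq> E"
  shows "\<exists>f :: nat \<Rightarrow> real \<Rightarrow> real. \<exists>a>0. \<exists>b. \<forall>n c. (\<Sum>k<n. c k *\<^sub>R f k) \<in> E \<and>
    a * (\<Sum>k<n. \<bar>c k\<bar> powr r) powr (1 / r) \<le> N (\<Sum>k<n. c k *\<^sub>R f k) \<and>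
    N (\<Sum>k<n. c k *\<^sub>R f k) \<le> b * (\<Sum>k<n. \<bar>c k\<bar> powr r) powr (1 / r)"
proof -
  obtain f :: "nat \<Rightarrow> real \<Rightarrow> real" and \<eta> \<delta> K :: real
    where pos: "0 < \<eta>" "0 < \<delta>" "0 \<le> K" and f': "\<forall>k. f k \<in> borel_measurable borel"
      and bounds: "\<forall>n c. (\<Sum>k<n. \<bar>c k\<bar> powr r) = 1 \<longrightarrow>
        (\<integral>\<^sup>+x. ennreal (\<bar>\<Sum>k<n. c k * f k x\<bar> powr p) \<partial>unit_measure) \<le> ennreal K \<and>
        ennreal \<delta> \<le> emeasure unit_measure {x \<in> {0<..<1}. \<eta> \<le> \<bar>\<Sum>k<n. c k * f k x\<bar>}"
    using exists_lr_functions[OF p] by (elim exE conjE) (rule that)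
  note f = f'[rule_format]
  note upper = bounds[rule_format, THEN conjunct1] and lower = bounds[rule_format, THEN conjunct2]
  obtain C where C': "\<forall>f\<in>borel_measurable unit_measure.
    (\<integral>\<^sup>+x. ennreal (\<bar>f x\<bar> powr p) \<partial>unit_measure) \<le> 1 \<longrightarrow> f \<in> E \<and> N f \<le> C"
    using Lp_bound[OF p(1) sub] by (elim exE) (rule that)
  note C = C'[rule_format]
  have S_apply: "(\<Sum>k<n. c k *\<^sub>R f k) = (\<lambda>x. \<Sum>k<n. c k * f k x)" for n and c :: "nat \<Rightarrow> real"
    by (simp add: fun_eq_iff sum_fun_apply scaleR_fun_def)
  have S_borel: "(\<lambda>x. \<Sum>k<n. c k * f k x) \<in> borel_measurable borel" for n and c :: "nat \<Rightarrow> real"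
    using f by measurable
  have S_meas: "(\<lambda>x. \<Sum>k<n. c k * f k x) \<in> borel_measurable unit_measure" for n and c :: "nat \<Rightarrow> real"
    using S_borel by (intro measurable_restrict_space1 measurable_completion) simp
  define L where "L = (K + 1) powr (1 / p)"
  have L: "0 < L" "1 \<le> L powr p" "K \<le> L powr p"
    using pos p by (simp_all add: L_def powr_powr)
  define \<delta>' where "\<delta>' = min \<delta> 1"
  have \<delta>': "0 < \<delta>'" "\<delta>' \<le> 1" "\<delta>' \<le> \<delta>"
    using pos by (simp_all add: \<delta>'_def)
  define a where "a = \<eta> * N (indicator {0<..<\<delta>'})"
  have a: "0 < a"
    unfolding a_def using pos(1) norm_indicator_pos[OF \<delta>'(1,2)] by simp
  have normalized: "(\<Sum>k<n. c k *\<^sub>R f k) \<in> E \<and> a \<le> N (\<Sum>k<n. c k *\<^sub>R f k) \<and> N (\<Sum>k<n. c k *\<^sub>R f k) \<le> L * C"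
    if c: "(\<Sum>k<n. \<bar>c k\<bar> powr r) = 1" for n c
  proof -
    define S where "S = (\<lambda>x. \<Sum>k<n. c k * f k x)"
    have S: "(\<Sum>k<n. c k *\<^sub>R f k) = S"
      unfolding S_def by (rule S_apply)
    have [measurable]: "S \<in> borel_measurable unit_measure"
      unfolding S_def by (rule S_meas)
    have "(\<integral>\<^sup>+x. ennreal (\<bar>((1 / L) *\<^sub>R S) x\<bar> powr p) \<partial>unit_measure) = (\<integral>\<^sup>+x. ennreal (1 / L powr p) * ennreal (\<bar>S x\<bar> powr p) \<partial>unit_measure)"
      using L(1) by (intro nn_integral_cong)
        (simp add: scaleR_fun_def abs_mult powr_divide flip: ennreal_mult)
    also have "\<dots> = ennreal (1 / L powr p) * (\<integral>\<^sup>+x. ennreal (\<bar>S x\<bar> powr p) \<partial>unit_measure)"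
      by (rule nn_integral_cmult) measurable
    also have "\<dots> \<le> ennreal (1 / L powr p) * ennreal K"
      using upper[OF c] by (intro mult_left_mono) (simp_all add: S_def)
    also have "\<dots> = ennreal (K / L powr p)"
      using pos(3) by (simp flip: ennreal_mult)
    also have "\<dots> \<le> 1"
      using L by (simp add: ennreal_le_1)
    finally have "(1 / L) *\<^sub>R S \<in> E \<and> N ((1 / L) *\<^sub>R S) \<le> C"
      by (intro C) (simp_all add: scaleR_fun_def)
    moreover have "S = L *\<^sub>R ((1 / L) *\<^sub>R S)"
      using L(1) by simp
    ultimately have SE: "S \<in> E" and NS: "N S \<le> L * C"
      using subspace_scale[OF subspace_E, of "(1 / L) *\<^sub>R S" L] norm_scale[of "(1 / L) *\<^sub>R S" L] L(1)
      by (metis, metis abs_of_pos mult_left_mono less_imp_le)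
    define A where "A = {x \<in> {0<..<1}. \<eta> \<le> \<bar>S x\<bar>}"
    have A: "A \<in> sets unit_measure"
    proof -
      have "{x \<in> space unit_measure. \<eta> \<le> \<bar>S x\<bar>} \<in> sets unit_measure"
        by measurable
      then show ?thesis
        by (simp add: A_def)
    qed
    have "ennreal \<delta>' \<le> emeasure unit_measure A"
      using order.trans[OF ennreal_leI[OF \<delta>'(3)] lower[OF c]] by (simp add: A_def S_def)
    then have "a \<le> \<eta> * N (indicator A)"
      unfolding a_def using pos(1) \<delta>'(1) A by (intro mult_left_mono norm_indicator_ge) auto
    also have "\<dots> = N (\<eta> *\<^sub>R indicator A)"
      using norm_scale[OF indicator_E[OF A], of \<eta>] pos(1) by simp
    also have "\<dots> \<le> N S"
    proof (rule lattice(2)[OF SE])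
      show "\<eta> *\<^sub>R (indicator A :: real \<Rightarrow> real) \<in> borel_measurable unit_measure"
        using A by (simp add: scaleR_fun_def)
      show "AE x in unit_measure. \<bar>(\<eta> *\<^sub>R indicator A) x\<bar> \<le> \<bar>S x\<bar>"
        using pos(1) by (intro AE_I2) (auto simp: A_def scaleR_fun_def indicator_def)
    qed
    finally show ?thesis
      unfolding S using SE NS by blast
  qed
  have main: "(\<Sum>k<n. c k *\<^sub>R f k) \<in> E \<and> a * (\<Sum>k<n. \<bar>c k\<bar> powr r) powr (1 / r) \<le> N (\<Sum>k<n. c k *\<^sub>R f k)
      \<and> N (\<Sum>k<n. c k *\<^sub>R f k) \<le> (L * C) * (\<Sum>k<n. \<bar>c k\<bar> powr r) powr (1 / r)" for n c
  proof -
    define \<rho> where "\<rho> = (\<Sum>k<n. \<bar>c k\<bar> powr r) powr (1 / r)"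
    have sum_nonneg: "0 \<le> (\<Sum>k<n. \<bar>c k\<bar> powr r)"
      by (rule sum_nonneg) simp
    show ?thesis
    proof (cases "(\<Sum>k<n. \<bar>c k\<bar> powr r) = 0")
      case True
      then have "\<forall>k<n. c k = 0"
        by (simp add: sum_nonneg_eq_0_iff)
      then have "(\<Sum>k<n. c k *\<^sub>R f k) = 0"
        by (intro sum.neutral) auto
      moreover have "N 0 = 0"
        using norm_eq_0[OF subspace_0[OF subspace_E]] by simp
      ultimately show ?thesis
        using True subspace_0[OF subspace_E] by (simp only: powr_0 mult_zero_right order.refl simp_thms)
    next
      case False
      then have \<rho>: "0 < \<rho>"
        using sum_nonneg by (simp add: \<rho>_def)
      have "\<rho> powr r = (\<Sum>k<n. \<bar>c k\<bar> powr r)"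
        using p sum_nonneg by (simp add: \<rho>_def powr_powr)
      moreover have "\<bar>c k / \<rho>\<bar> powr r = \<bar>c k\<bar> powr r / \<rho> powr r" for k
        using \<rho> by (simp add: powr_divide)
      ultimately have "(\<Sum>k<n. \<bar>c k / \<rho>\<bar> powr r) = 1"
        using False by (simp flip: sum_divide_distrib)
      note n = normalized[OF this]
      let ?T = "\<Sum>k<n. (c k / \<rho>) *\<^sub>R f k"
      have eq: "(\<Sum>k<n. c k *\<^sub>R f k) = \<rho> *\<^sub>R ?T"
        unfolding scaleR_sum_right using \<rho> by (intro sum.cong) simp_all
      have T: "?T \<in> E" "a \<le> N ?T" "N ?T \<le> L * C"
        using n by blast+
      have "N (\<rho> *\<^sub>R ?T) = \<rho> * N ?T"
        using norm_scale[OF T(1), of \<rho>] \<rho> by simp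
      moreover have "\<rho> * a \<le> \<rho> * N ?T" "\<rho> * N ?T \<le> \<rho> * (L * C)"
        using T(2,3) \<rho> by (auto intro: mult_left_mono)
      moreover have "\<rho> *\<^sub>R ?T \<in> E"
        by (rule subspace_scale[OF subspace_E T(1)])
      ultimately show ?thesis
        unfolding eq \<rho>_def[symmetric] by (simp only: mult.commute simp_thms)
    qed
  qed
  show ?thesis
    by (rule exI[of _ f], rule exI[of _ a], rule conjI[OF a], rule exI[of _ "L * C"], intro allI) (rule main)
qed

end

section \<open>The theorem\<close>

theorem mainTheorem3:
  fixes E :: "(real \<Rightarrow> real) set" and norm_E :: "(real \<Rightarrow> real) \<Rightarrow> real"
    and F :: "(nat \<Rightarrow> real) set" and norm_F :: "(nat \<Rightarrow> real) \<Rightarrow> real"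
  assumes "symmetric_function_space E norm_E"
    and "\<exists>p. 1 \<le> p \<and> p < 2 \<and> Lp_space (lebesgue_on {0<..<1}) p \<subseteq> E"
    and "symmetric_sequence_space F norm_F"
    and "separable_normed F norm_F"
    and "\<forall>\<epsilon>>0. \<exists>r\<in>{2 - \<epsilon><..<2}.
           \<not> isomorphically_embeds (lp_space r) (lp_norm r) F norm_F"
  shows "\<not> isomorphically_embeds E norm_E (operator_space F) (operator_space_norm norm_F)"
proof
  assume "isomorphically_embeds E norm_E (operator_space F) (operator_space_norm norm_F)"
  then obtain T C c0 where T: "\<And>f. f \<in> E \<Longrightarrow> T f \<in> operator_space F"
    "\<And>f g. f \<in> E \<Longrightarrow> g \<in> E \<Longrightarrow> T (f + g) = T f + T g"
    "\<And>f c. f \<in> E \<Longrightarrow> T (c *\<^sub>R f) = c *\<^sub>R T f"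
    "\<And>f. f \<in> E \<Longrightarrow> operator_space_norm norm_F (T f) \<le> C * norm_E f"
    "c0 > 0" "\<And>f. f \<in> E \<Longrightarrow> c0 * norm_E f \<le> operator_space_norm norm_F (T f)"
    unfolding isomorphically_embeds_def by blast
  obtain p where p: "1 \<le> p" "p < 2" "Lp_space (lebesgue_on {0<..<1}) p \<subseteq> E"
    using assms(2) by blast
  have "2 - p > 0"
    using p(2) by simp
  with assms(5) obtain r where "r \<in> {2 - (2 - p)<..<2}"
    and not_embeds: "\<not> isomorphically_embeds (lp_space r) (lp_norm r) F norm_F"
    by blast
  then have r: "p < r" "r < 2"
    by simp_all
  interpret E: symmetric_fun_space E norm_E
    by unfold_locales (rule assms(1))
  interpret F: separable_seq_space F norm_F
    by unfold_locales (rule assms(3), rule assms(4))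
  obtain f :: "nat \<Rightarrow> real \<Rightarrow> real" and a b :: real where "0 < a"
    and bounds: "\<forall>n c. (\<Sum>k<n. c k *\<^sub>R f k) \<in> E \<and>
      a * (\<Sum>k<n. \<bar>c k\<bar> powr r) powr (1 / r) \<le> norm_E (\<Sum>k<n. c k *\<^sub>R f k) \<and>
      norm_E (\<Sum>k<n. c k *\<^sub>R f k) \<le> b * (\<Sum>k<n. \<bar>c k\<bar> powr r) powr (1 / r)"
    using E.lr_basis[OF p(1) r(1,2) p(3)] by (elim exE conjE) (rule that)
  note f = \<open>0 < a\<close> bounds[rule_format, THEN conjunct1]
    bounds[rule_format, THEN conjunct2, THEN conjunct1] bounds[rule_format, THEN conjunct2, THEN conjunct2]
  have f_E: "f k \<in> E" for k
  proof -
    have "(\<Sum>j<Suc k. (if j = k then 1 else 0 :: real) *\<^sub>R f j) = f k"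
      by (simp add: sum.neutral)
    then show ?thesis
      using f(2)[of "\<lambda>j. if j = k then 1 else 0" "Suc k"] by simp
  qed
  define x where "x k = T (f k)" for k
  have T_sum: "T (\<Sum>k<n. c k *\<^sub>R f k) = (\<Sum>k<n. c k *\<^sub>R x k)" for n c
  proof (induction n)
    case 0
    show ?case
      using T(3)[OF f_E, of 0 0] by (simp only: lessThan_0 sum.empty scaleR_zero_left)
  next
    case (Suc n)
    have "T (\<Sum>k<Suc n. c k *\<^sub>R f k) = T ((\<Sum>k<n. c k *\<^sub>R f k) + c n *\<^sub>R f n)"
      by (simp only: sum.lessThan_Suc)
    also have "\<dots> = T (\<Sum>k<n. c k *\<^sub>R f k) + c n *\<^sub>R x n"
      unfolding x_def by (simp only: T(2)[OF f(2) subspace_scale[OF E.subspace_E f_E]] T(3)[OF f_E])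
    finally show ?case
      by (simp only: Suc sum.lessThan_Suc)
  qed
  have x_op: "(\<Sum>k<n. c k *\<^sub>R x k) \<in> operator_space F" for n c
    unfolding T_sum[symmetric] by (rule T(1)[OF f(2)])
  interpret lr_sequence F norm_F x r "c0 * a" "2 * (\<bar>C\<bar> * b)"
  proof unfold_locales
    show "1 < r" "r < 2" "c0 * a > 0"
      using p(1) r T(5) f(1) by auto
    fix n and c :: "nat \<Rightarrow> real"
    let ?S = "\<Sum>k<n. c k *\<^sub>R f k" and ?X = "\<Sum>k<n. c k *\<^sub>R x k"
    define \<rho> where "\<rho> = (\<Sum>k<n. \<bar>c k\<bar> powr r) powr (1 / r)"
    note X = F.operator_space_ideal[OF x_op[of c n]]
    show "?X \<in> F.ideal" "compact_operator ?X"
      using X(1) F.operator_space_compact(2)[OF x_op] by blast+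
    have "c0 * (a * \<rho>) \<le> c0 * norm_E ?S"
      unfolding \<rho>_def using f(3) T(5) by (intro mult_left_mono) auto
    also have "\<dots> \<le> operator_space_norm norm_F ?X"
      using T(6)[OF f(2)] unfolding T_sum by blast
    also note X(2)
    finally show "c0 * a * (\<Sum>k<n. \<bar>c k\<bar> powr r) powr (1 / r) \<le> F.ideal_norm ?X"
      by (simp add: \<rho>_def mult.assoc)
    have "operator_space_norm norm_F ?X \<le> C * norm_E ?S"
      using T(4)[OF f(2)] unfolding T_sum by blast
    also have "\<dots> \<le> \<bar>C\<bar> * norm_E ?S"
      by (intro mult_right_mono abs_ge_self E.norm_nonneg f(2))
    also have "\<dots> \<le> \<bar>C\<bar> * (b * \<rho>)"
      unfolding \<rho>_def by (intro mult_left_mono f(4)) simp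
    finally show "F.ideal_norm ?X \<le> 2 * (\<bar>C\<bar> * b) * (\<Sum>k<n. \<bar>c k\<bar> powr r) powr (1 / r)"
      using X(3) by (simp add: \<rho>_def mult.assoc)
  qed
  show False
    using lp_space_embeds_F not_embeds by blast
qed

end
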